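(* Let $\nu_0>-2$ and $a\in\mathbb R$ be constants, and let $H$ be a real-valued harmonic function in a neighborhood of $0\in\mathbb R^2$ with $H(0)=0$. Write $H(x)=\sum_{i\ge 1}|x|^iX_i(\theta)$, $\theta=x/|x|$, with $X_i\in\mathscr E_i$ for every $i\ge 1$. Let $\{\mu_\ell\}_{\ell\ge1}$ be the index set associated with $\tau_0=\nu_0+2$, and let $\{P_\ell(\mathcal X)\}_{\ell\ge1}$ be the sequence of smooth functions on $\mathbb S^1$ determined by $\mathcal X=\{X_i\}_{i\ge1}$, $\tau_0=\nu_0+2$ and the coefficients $a_j=-e^a/j!$, $j\ge0$ (as defined in the context). Then there exists a unique smooth solution $u$ of $$\Delta u+e^u=0$$ in a punctured ball $B_r\setminus\{0\}\subset\mathbb R^2$, for some $r>0$, such that: (1) $\big|u(x)-\nu_0\ln|x|-a\big|\le C|x|^\gamma$ in $B_r\setminus\{0\}$ for some constants $C>0$ and $\gamma>0$; (2) the asymptotics of $u(x)-\nu_0\ln|x|-a$ is determined by $\{X_i\}_{i\ge1}$, i.e., for every $\ell\ge1$ there is a constant $C_\ell>0$ such that, for all $x\in B_r\setminus\{0\}$ with $\theta=x/|x|$, $$\Big|u(x)-\nu_0\ln|x|-a-\sum_{j=1}^\ell P_j(\mathcal X)(\theta)\,|x|^{\mu_j}\Big|\le C_\ell|x|^{\mu_{\ell+1}}.$$ Here uniqueness means that any two such solutions, defined in possibly different punctured balls centered at $0$, coincide in the smaller one.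
   Context: $B_r$ is the open disc of radius $r$ centered at $0$ in $\mathbb R^2$. $\mathbb S^1$ is the unit circle with angular variable $\theta$. $\mathscr E_0$ is the space of constant functions on $\mathbb S^1$, and for $i\ge1$, $\mathscr E_i=\mathrm{span}_{\mathbb R}\{\cos(i\theta),\sin(i\theta)\}$ (spherical harmonics of degree $i$, including $0$). $\mathbb Z_+$ denotes the nonnegative integers. Index set. Given $\tau_0>0$, set $\rho_0=\tau_0$ and $\rho_i=i$ for $i\ge1$. The index set associated with $\tau_0$ is the set of all nontrivial (nonzero) sums $\sum_{i\ge0}m_i\rho_i$ with $m_i\in\mathbb Z_+$, only finitely many $m_i>0$; it is written as a strictly increasing sequence $\{\mu_\ell\}_{\ell\ge1}$ of positive numbers. The sequence $\{P_\ell(\mathcal X)\}$. Given $\tau_0>0$, real numbers $\{a_j\}_{j\ge0}$ and $\mathcal X=\{X_i\}_{i\ge1}$ with $X_i\in\mathscr E_i$, the smooth functions $P_\ell=P_\ell(\mathcal X)$ on $\mathbb S^1$ are determined recursively in $\ell$ by: (1) if $\mu_\ell<\rho_0$, then $\mu_\ell=\ell$ and $P_\ell=X_\ell$; (2) if $\mu_\ell=\rho_0$, then $P_\ell=a_0/\rho_0^2$ if $\rho_0$ is not an integer, and $P_\ell=a_0/\rho_0^2+X_{\rho_0}$ if $\rho_0$ is an integer; (3) if $\mu_\ell>\rho_0$ and $\mu_\ell\ne\rho_0+\mu_m$ for all $m\ge1$, then $\mu_\ell$ is an integer and $P_\ell=X_{\mu_\ell}$; (4) if $\mu_\ell>\rho_0$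 and $\mu_\ell=\rho_0+\mu_m$ for some $1\le m<\ell$, consider the equation $$(\ast)\qquad \partial_{\theta\theta}P+\mu_\ell^2P=\sum_{j=1}^m a_j\sum_{\mu_{k_1}+\cdots+\mu_{k_j}=\mu_m}P_{k_1}\cdots P_{k_j}\quad\text{on }\mathbb S^1,$$ where the inner sum is over all $(k_1,\dots,k_j)$ of positive integers with the indicated property. (4a) If $\mu_\ell$ is not an integer, $P_\ell$ is the unique solution of $(\ast)$. (4b) If $\mu_\ell$ is an integer, $P_\ell=X_{\mu_\ell}+Q_\ell$, where $Q_\ell$ is the unique solution of $(\ast)$ that is orthogonal to $\mathscr E_{\mu_\ell}$ in $L^2(\mathbb S^1)$. *)

theory Defs
  imports "HOL-Analysis.Analysis"
begin

text \<open>The plane \<open>\<real>\<^sup>2\<close> is the type \<^typ>\<open>complex\<close>, regarded as a two-dimensional real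
  Euclidean space. A function on the unit circle is a \<open>2\<pi>\<close>-periodic function of the
  angular variable \<open>\<theta>\<close>; its value at \<open>x / |x|\<close> is therefore its value at \<open>Arg x\<close>.\<close>

section \<open>Smooth and harmonic functions\<close>

text \<open>These notions are only meaningful for open sets \<open>S\<close>.\<close>

primrec Ck_on :: "nat \<Rightarrow> ('a::euclidean_space \<Rightarrow> real) \<Rightarrow> 'a set \<Rightarrow> bool" where
  "Ck_on 0 f S \<longleftrightarrow> continuous_on S f"
| "Ck_on (Suc k) f S \<longleftrightarrow> (\<forall>x\<in>S. f differentiable (at x)) \<and>
     (\<forall>v. Ck_on k (\<lambda>x. frechet_derivative f (at x) v) S)"

definition smooth_on :: "('a::euclidean_space \<Rightarrow> real) \<Rightarrow> 'a set \<Rightarrow> bool" where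
  "smooth_on f S \<longleftrightarrow> (\<forall>k. Ck_on k f S)"

definition laplacian :: "('a::euclidean_space \<Rightarrow> real) \<Rightarrow> 'a \<Rightarrow> real" where
  "laplacian f x =
     (\<Sum>b\<in>Basis. frechet_derivative (\<lambda>y. frechet_derivative f (at y) b) (at x) b)"

definition harmonic_on :: "('a::euclidean_space \<Rightarrow> real) \<Rightarrow> 'a set \<Rightarrow> bool" where
  "harmonic_on f S \<longleftrightarrow> Ck_on 2 f S \<and> (\<forall>x\<in>S. laplacian f x = 0)"

section \<open>Functions on the circle\<close>

text \<open>For \<open>i = 0\<close> this is the space of constant functions.\<close>

definition spherical_harmonics :: "nat \<Rightarrow> (real \<Rightarrow> real) set" where
  "spherical_harmonics i =
     {Y. \<exists>\<alpha> \<beta>. Y = (\<lambda>\<theta>. \<alpha> * cos (real i * \<theta>) + \<beta> * sin (real i * \<theta>))}"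

definition circle_orthogonal :: "(real \<Rightarrow> real) \<Rightarrow> (real \<Rightarrow> real) set \<Rightarrow> bool" where
  "circle_orthogonal Q E \<longleftrightarrow> (\<forall>Y\<in>E. integral {0..2 * pi} (\<lambda>\<theta>. Q \<theta> * Y \<theta>) = 0)"

definition circle_solution :: "real \<Rightarrow> (real \<Rightarrow> real) \<Rightarrow> (real \<Rightarrow> real) \<Rightarrow> bool" where
  "circle_solution \<mu> F Q \<longleftrightarrow>
     smooth_on Q UNIV \<and> (\<forall>\<theta>. Q (\<theta> + 2 * pi) = Q \<theta>) \<and>
     (\<forall>\<theta>. deriv (deriv Q) \<theta> + \<mu>\<^sup>2 * Q \<theta> = F \<theta>)"

section \<open>The index set\<close>

definition rho :: "real \<Rightarrow> nat \<Rightarrow> real" where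
  "rho \<tau> i = (if i = 0 then \<tau> else real i)"

definition index_set :: "real \<Rightarrow> real set" where
  "index_set \<tau> =
     {s. \<exists>m :: nat \<Rightarrow> nat. finite {i. m i > 0} \<and> (\<exists>i. m i > 0) \<and>
         s = (\<Sum>i\<in>{i. m i > 0}. real (m i) * rho \<tau> i)}"

text \<open>The increasing enumeration starts at index 1; the value at index 0 is a dummy that
  lies below all elements of the index set.\<close>

primrec index_seq :: "real \<Rightarrow> nat \<Rightarrow> real" where
  "index_seq \<tau> 0 = 0"
| "index_seq \<tau> (Suc l) = (LEAST s. s \<in> index_set \<tau> \<and> index_seq \<tau> l < s)"

lemma index_set_pos:
  assumes "\<tau> > 0" "s \<in> index_set \<tau>"
  shows "s > 0"
proof -
  obtain m :: "nat \<Rightarrow> nat" where m: "finite {i. m i > 0}" "\<exists>i. m i > 0"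
    "s = (\<Sum>i\<in>{i. m i > 0}. real (m i) * rho \<tau> i)"
    using assms(2) by (auto simp: index_set_def)
  show ?thesis
    unfolding m(3) using m(1,2) assms(1) by (intro sum_pos) (auto simp: rho_def)
qed

lemma of_nat_in_index_set:
  assumes "n \<ge> 1"
  shows "real n \<in> index_set \<tau>"
proof -
  have "{i. (if i = n then 1 else 0 :: nat) > 0} = {n}" by auto
  then show ?thesis
    unfolding index_set_def using assms
    by (intro CollectI exI[of _ "\<lambda>i. if i = n then 1 else 0 :: nat"]) (auto simp: rho_def)
qed

lemma finite_index_set_atMost:
  assumes "\<tau> > 0"
  shows "finite {s \<in> index_set \<tau>. s \<le> b}"
proof (rule finite_subset)
  show "{s \<in> index_set \<tau>. s \<le> b} \<subseteq>
      (\<lambda>(p, q). real p * \<tau> + real q) ` ({..nat \<lfloor>b / \<tau>\<rfloor>} \<times> {..nat \<lfloor>b\<rfloor>})"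
  proof safe
    fix s assume s: "s \<in> index_set \<tau>" "s \<le> b"
    then obtain m :: "nat \<Rightarrow> nat" where m: "finite {i. m i > 0}"
      "s = (\<Sum>i\<in>{i. m i > 0}. real (m i) * rho \<tau> i)"
      by (auto simp: index_set_def)
    define A where "A = insert 0 {i. m i > 0}"
    have A: "finite A" "0 \<in> A" using m(1) by (auto simp: A_def)
    have "s = (\<Sum>i\<in>A. real (m i) * rho \<tau> i)"
      unfolding m(2) by (rule sum.mono_neutral_left) (use m(1) in \<open>auto simp: A_def\<close>)
    also have "\<dots> = real (m 0) * \<tau> + (\<Sum>i\<in>A - {0}. real (m i) * rho \<tau> i)"
      using A by (simp add: sum.remove rho_def)
    also have "(\<Sum>i\<in>A - {0}. real (m i) * rho \<tau> i) = real (\<Sum>i\<in>A - {0}. m i * i)"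
      unfolding of_nat_sum by (rule sum.cong) (auto simp: rho_def)
    finally have eq: "s = real (m 0) * \<tau> + real (\<Sum>i\<in>A - {0}. m i * i)" (is "_ = _ + real ?q") .
    have "real (m 0) * \<tau> \<le> b" "real ?q \<le> b"
    proof -
      have "real (m 0) * \<tau> \<ge> 0" "real ?q \<ge> 0" using assms by (simp, linarith)
      then show "real (m 0) * \<tau> \<le> b" "real ?q \<le> b" using eq s(2) by linarith+
    qed
    then have "m 0 \<le> nat \<lfloor>b / \<tau>\<rfloor>" "?q \<le> nat \<lfloor>b\<rfloor>"
      using assms by (simp_all add: le_nat_floor field_simps)
    with eq show "s \<in> (\<lambda>(p, q). real p * \<tau> + real q) ` ({..nat \<lfloor>b / \<tau>\<rfloor>} \<times> {..nat \<lfloor>b\<rfloor>})"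
      by (intro image_eqI[of _ _ "(m 0, ?q)"]) auto
  qed
qed auto

lemma index_seq_Suc:
  assumes "\<tau> > 0"
  shows "index_seq \<tau> (Suc l) \<in> index_set \<tau>"
    and "index_seq \<tau> l < index_seq \<tau> (Suc l)"
    and "\<And>s. s \<in> index_set \<tau> \<Longrightarrow> index_seq \<tau> l < s \<Longrightarrow> index_seq \<tau> (Suc l) \<le> s"
proof -
  define P where "P s \<longleftrightarrow> s \<in> index_set \<tau> \<and> index_seq \<tau> l < s" for s
  obtain n0 :: nat where "index_seq \<tau> l < real n0" using reals_Archimedean2 by blast
  then have n': "index_seq \<tau> l < real (Suc n0)" by simp
  define n where "n = Suc n0"
  have n: "n \<ge> 1" "index_seq \<tau> l < real n" using n' unfolding n_def by auto
  define F where "F = {s \<in> index_set \<tau>. s \<le> real n} \<inter> {s. index_seq \<tau> l < s}"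
  have fin: "finite F" unfolding F_def using finite_index_set_atMost[OF assms] by blast
  have nF: "real n \<in> F" using n of_nat_in_index_set unfolding F_def by auto
  have P1: "P (Min F)"
    using Min_in[OF fin] nF unfolding F_def P_def by blast
  have P2: "Min F \<le> s" if "P s" for s
  proof (cases "s \<le> real n")
    case True
    then show ?thesis using that fin by (intro Min_le) (auto simp: F_def P_def)
  next
    case False
    then show ?thesis using Min_le[OF fin nF] by linarith
  qed
  have eq: "index_seq \<tau> (Suc l) = Min F"
    using Least_equality[of P "Min F", OF P1 P2] unfolding P_def index_seq.simps .
  show "index_seq \<tau> (Suc l) \<in> index_set \<tau>" "index_seq \<tau> l < index_seq \<tau> (Suc l)"
    using P1 unfolding eq P_def by auto
  show "\<And>s. s \<in> index_set \<tau> \<Longrightarrow> index_seq \<tau> l < s \<Longrightarrow> index_seq \<tau> (Suc l) \<le> s"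
    using P2 unfolding eq P_def by auto
qed

lemma strict_mono_index_seq: "\<tau> > 0 \<Longrightarrow> strict_mono (index_seq \<tau>)"
  unfolding strict_mono_Suc_iff using index_seq_Suc(2) by blast

lemma index_seq_image:
  assumes "\<tau> > 0"
  shows "index_seq \<tau> ` {1..} = index_set \<tau>"
proof (intro equalityI subsetI)
  fix s assume "s \<in> index_seq \<tau> ` {1..}"
  then obtain l where "l \<ge> 1" "s = index_seq \<tau> l" by auto
  then show "s \<in> index_set \<tau>"
    using index_seq_Suc(1)[OF assms, of "l - 1"] by (simp del: index_seq.simps)
next
  fix s assume s: "s \<in> index_set \<tau>"
  show "s \<in> index_seq \<tau> ` {1..}"
  proof (rule ccontr)
    assume no: "s \<notin> index_seq \<tau> ` {1..}"
    have less: "index_seq \<tau> l < s" for l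
    proof (induction l)
      case 0
      then show ?case using index_set_pos[OF assms s] by simp
    next
      case (Suc l)
      have "index_seq \<tau> (Suc l) \<noteq> s" using no by (auto simp del: index_seq.simps)
      then show ?case using index_seq_Suc(3)[OF assms s Suc] by linarith
    qed
    have "range (\<lambda>l. index_seq \<tau> (Suc l)) \<subseteq> {t \<in> index_set \<tau>. t \<le> s}"
      using less index_seq_Suc(1)[OF assms] by (auto intro: less_imp_le simp del: index_seq.simps)
    moreover have "inj (\<lambda>l. index_seq \<tau> (Suc l))"
      using strict_mono_index_seq[OF assms]
      by (auto simp: inj_def strict_mono_eq simp del: index_seq.simps)
    ultimately show False
      using finite_index_set_atMost[OF assms] finite_subset range_inj_infinite by blast
  qed
qed

section \<open>The functions determined by spherical harmonics\<close>

text \<open>Tuples \<open>(k\<^sub>1, \<dots>, k\<^sub>j)\<close> of positive integers are lists of length \<open>j\<close>. The restriction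
  \<open>set ks \<subseteq> {1..<l}\<close> excludes no tuple: for \<open>\<tau> > 0\<close> the sequence \<open>index_seq \<tau>\<close> is positive
  and strictly increasing, so \<open>\<mu> k\<^sub>1 + \<dots> + \<mu> k\<^sub>j = \<mu> m\<close> forces all entries to be at most
  \<open>m < l\<close>. It makes the recursion well-founded and the sum visibly finite. The number \<open>m\<close> is
  unique because \<open>index_seq \<tau>\<close> is injective. The solution picked by \<open>THE\<close> is among the smooth
  \<open>2\<pi>\<close>-periodic ones.\<close>

function P_seq :: "real \<Rightarrow> (nat \<Rightarrow> real) \<Rightarrow> (nat \<Rightarrow> real \<Rightarrow> real) \<Rightarrow> nat \<Rightarrow> real \<Rightarrow> real" where
  "P_seq \<tau> a X l = (let \<mu> = index_seq \<tau> in
     if \<mu> l < \<tau> then X l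
     else if \<mu> l = \<tau> then
       (if \<tau> \<in> \<int> then (\<lambda>\<theta>. a 0 / \<tau>\<^sup>2 + X (nat \<lfloor>\<tau>\<rfloor>) \<theta>) else (\<lambda>\<theta>. a 0 / \<tau>\<^sup>2))
     else if \<forall>m\<ge>1. \<mu> l \<noteq> \<tau> + \<mu> m then X (nat \<lfloor>\<mu> l\<rfloor>)
     else
       (let m = (THE m. m \<ge> 1 \<and> \<mu> l = \<tau> + \<mu> m);
            F = (\<lambda>\<theta>. \<Sum>j=1..m. a j *
                  (\<Sum>ks\<in>{ks. length ks = j \<and> set ks \<subseteq> {1..<l} \<and> sum_list (map \<mu> ks) = \<mu> m}.
                     prod_list (map (\<lambda>k. P_seq \<tau> a X k \<theta>) ks)))
        in if \<mu> l \<notin> \<int> then (THE Q. circle_solution (\<mu> l) F Q)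
           else
             (let i = nat \<lfloor>\<mu> l\<rfloor>;
                  Q = (THE Q. circle_solution (\<mu> l) F Q \<and>
                              circle_orthogonal Q (spherical_harmonics i))
              in (\<lambda>\<theta>. X i \<theta> + Q \<theta>))))"
  by auto
termination
  by (relation "Wellfounded.measure (\<lambda>(_, _, _, l). l)") auto

declare P_seq.simps [simp del]

section \<open>Singular solutions of the Liouville equation\<close>

definition liouville_solution :: "real \<Rightarrow> (complex \<Rightarrow> real) \<Rightarrow> bool" where
  "liouville_solution r u \<longleftrightarrow>
     smooth_on u (ball 0 r - {0}) \<and> (\<forall>x\<in>ball 0 r - {0}. laplacian u x + exp (u x) = 0)"

definition leading_asymptotics ::
    "real \<Rightarrow> real \<Rightarrow> real \<Rightarrow> (complex \<Rightarrow> real) \<Rightarrow> bool" where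
  "leading_asymptotics \<nu> a r u \<longleftrightarrow>
     (\<exists>C>0. \<exists>\<gamma>>0. \<forall>x\<in>ball 0 r - {0}.
        \<bar>u x - \<nu> * ln (norm x) - a\<bar> \<le> C * norm x powr \<gamma>)"

definition full_asymptotics ::
    "real \<Rightarrow> real \<Rightarrow> (nat \<Rightarrow> real) \<Rightarrow> (nat \<Rightarrow> real \<Rightarrow> real) \<Rightarrow> real \<Rightarrow> (complex \<Rightarrow> real) \<Rightarrow> bool" where
  "full_asymptotics \<nu> a \<mu> P r u \<longleftrightarrow>
     (\<forall>l\<ge>1. \<exists>C>0. \<forall>x\<in>ball 0 r - {0}.
        \<bar>u x - \<nu> * ln (norm x) - a - (\<Sum>j=1..l. P j (Arg x) * norm x powr \<mu> j)\<bar>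
          \<le> C * norm x powr \<mu> (Suc l))"

end

theory Submission
  imports Defs "HOL-Complex_Analysis.Complex_Analysis"
begin

text \<open>With t = ln |x| the operator |x|^2 \<Delta> becomes the flat Laplacian and the factor
  |x|^(\<tau> - 2), unbounded at 0 when \<tau> < 2, becomes e^(\<tau>t). A weight linear in t gives
  no positive term. Concavity e^(\<tau>t), multiplied by the square of the large slope, dominates
  the squared right-hand side K^2 e^(2\<tau>t) at every t below ln r, so the whole punctured ball is
  treated at once and no continuation from a small ball is required.

  For existence the danger is resonance at integral \<tau>. The power series of g has denominators
  \<tau>/2 + n, which never vanish, so no powers of ln |z| arise.

  Termwise differentiation of the triple series is avoided. With v = u - \<nu> ln |z| - a, the
  function -e^a |z|^\<tau> e^v is expanded on its own, and its coefficients turn out to be those of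
  v times \<mu>^2 - n^2, for exponent \<mu> and frequency n: the equation |z|^2 \<Delta>v = -e^a
  |z|^\<tau> e^v read on coefficients. Exponentiating the expansion of v along each ray gives the
  same coefficients as the right-hand side of the recursion.\<close>

text \<open>
  Existence is explicit. Put \<open>\<tau> = \<nu>\<^sub>0 + 2\<close>, let \<open>L\<close> be holomorphic with \<open>H = Re L\<close>, \<open>L(0) = 0\<close>, and let
  \<open>g\<close> be the holomorphic solution of \<open>(\<tau>/2) g + z g' = f\<close>, \<open>f = e\<^bsup>a/2\<^esup> e\<^bsup>L/2\<^esup> / \<surd>8\<close>. By Liouville's formula
  \<open>u = \<nu>\<^sub>0 ln \<bar>z\<bar> + a + Re L - 2 ln (1 + \<bar>z\<bar>\<^sup>\<tau> \<bar>g\<bar>\<^sup>2)\<close> solves the equation. Expanding the logarithm and the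
  powers of \<open>g\<close> gives an absolutely convergent series in \<open>\<bar>z\<bar>\<^sup>\<tau>\<close>, \<open>z\<close>, \<open>cnj z\<close>, whose terms of homogeneity
  \<open>\<mu>\<^sub>l\<close> add up to a trigonometric polynomial \<open>R\<^sub>l\<close>. Its part independent of \<open>\<bar>z\<bar>\<^sup>\<tau>\<close> is \<open>H\<close>; the other
  terms have frequency less than \<open>\<mu>\<^sub>l\<close> and satisfy the recursive equation on the circle,
  as one sees by comparing coefficients in the expanded equation. Hence \<open>R\<^sub>l = P\<^sub>l\<close>.

  For uniqueness, the difference \<open>w\<close> of two solutions vanishes to infinite order at \<open>0\<close> and
  satisfies \<open>\<bar>\<Delta>w\<bar> \<le> K \<bar>x\<bar>\<^bsup>\<tau> - 2\<^esup> \<bar>w\<bar>\<close> on the whole punctured ball. A Carleman estimate in logarithmic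
  polar coordinates, with a weight whose concavity matches \<open>\<bar>x\<bar>\<^sup>\<tau>\<close>, yields \<open>w = 0\<close>.
\<close>

section \<open>A Carleman estimate on the half-cylinder\<close>

lemma continuous_on_slice:
  assumes "continuous_on ({..<T::real} \<times> UNIV) (\<lambda>(t, h). F t h)" "t < T"
  shows "continuous_on S (F t)"
  using continuous_on_compose2[OF assms(1), of S "\<lambda>h. (t, h)"] assms(2)
  by (simp add: image_subset_iff continuous_on_Pair)

lemma has_derivative_circle_integral:
  fixes F Ft :: "real \<Rightarrow> real \<Rightarrow> real"
  assumes "\<And>t h. t < T \<Longrightarrow> ((\<lambda>t. F t h) has_real_derivative Ft t h) (at t)"
    and cF: "continuous_on ({..<T} \<times> UNIV) (\<lambda>(t, h). F t h)"
    and cFt: "continuous_on ({..<T} \<times> UNIV) (\<lambda>(t, h). Ft t h)"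
    and t: "t < T"
  shows "((\<lambda>t. integral {a..b} (F t)) has_real_derivative integral {a..b} (Ft t)) (at t)"
proof -
  have "((\<lambda>t. integral (cbox a b) (F t)) has_field_derivative integral (cbox a b) (Ft t)) (at t within {..<T})"
  proof (rule leibniz_rule_field_derivative)
    show "((\<lambda>t. F t h) has_field_derivative Ft x h) (at x within {..<T})" if "x \<in> {..<T}" for x h
      using that assms(1)[of x h] by (auto intro: has_field_derivative_at_within)
    show "F x integrable_on cbox a b" if "x \<in> {..<T}" for x
    proof (rule integrable_continuous)
      show "continuous_on (cbox a b) (F x)"
        by (rule continuous_on_slice[OF cF]) (use that in auto)
    qed
    show "continuous_on ({..<T} \<times> cbox a b) (\<lambda>(x, t). Ft x t)"
      by (rule continuous_on_subset[OF cFt]) auto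
  qed (use t in auto)
  then show ?thesis
    using t by (simp add: at_within_open[of t "{..<T}"])
qed

lemma integral_periodic_derivative:
  fixes f :: "real \<Rightarrow> real"
  assumes "\<And>h. (f has_real_derivative f' h) (at h)" and "f b = f a" "a \<le> b"
  shows "(f' has_integral 0) {a..b}"
  using fundamental_theorem_of_calculus[of a b f f'] assms
  by (auto simp: has_real_derivative_iff_has_vector_derivative[symmetric]
      intro: has_field_derivative_at_within)

text \<open>\<open>W t h\<close> stands for w(e^(t + ih)). Multiplication by |z|^2 turns the
  Laplacian into W_tt + W_hh and the bound K |z|^(\<tau> - 2) |w| into \<open>ineq\<close>. Decay is
  assumed for \<open>W\<close> alone, since the asymptotic expansions say nothing about
  derivatives.\<close>

locale cylinder_inequality =
  fixes W Wt Wh Wtt Wht Whh :: "real \<Rightarrow> real \<Rightarrow> real" and T K \<tau> :: real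
  assumes W_t: "\<And>t h. t < T \<Longrightarrow> ((\<lambda>t. W t h) has_real_derivative Wt t h) (at t)"
    and W_h: "\<And>t h. t < T \<Longrightarrow> (W t has_real_derivative Wh t h) (at h)"
    and Wt_t: "\<And>t h. t < T \<Longrightarrow> ((\<lambda>t. Wt t h) has_real_derivative Wtt t h) (at t)"
    and Wh_t: "\<And>t h. t < T \<Longrightarrow> ((\<lambda>t. Wh t h) has_real_derivative Wht t h) (at t)"
    and Wh_h: "\<And>t h. t < T \<Longrightarrow> (Wh t has_real_derivative Whh t h) (at h)"
    and cont: "continuous_on ({..<T} \<times> UNIV) (\<lambda>(t, h). W t h)"
      "continuous_on ({..<T} \<times> UNIV) (\<lambda>(t, h). Wt t h)"
      "continuous_on ({..<T} \<times> UNIV) (\<lambda>(t, h). Wh t h)"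
      "continuous_on ({..<T} \<times> UNIV) (\<lambda>(t, h). Wtt t h)"
      "continuous_on ({..<T} \<times> UNIV) (\<lambda>(t, h). Wht t h)"
      "continuous_on ({..<T} \<times> UNIV) (\<lambda>(t, h). Whh t h)"
    and per: "\<And>t. t < T \<Longrightarrow> W t (2 * pi) = W t 0"
      "\<And>t. t < T \<Longrightarrow> Wt t (2 * pi) = Wt t 0"
      "\<And>t. t < T \<Longrightarrow> Wh t (2 * pi) = Wh t 0"
    and ineq: "\<And>t h. t < T \<Longrightarrow> \<bar>Wtt t h + Whh t h\<bar> \<le> K * exp (\<tau> * t) * \<bar>W t h\<bar>"
    and K: "0 \<le> K" and tau: "0 < \<tau>"
    and decay: "\<And>N::nat. \<exists>C. \<forall>t<T. \<forall>h. \<bar>W t h\<bar> \<le> C * exp (real N * t)"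
begin

abbreviation "ex t \<equiv> exp (\<tau> * t)"

abbreviation I :: "(real \<Rightarrow> real) \<Rightarrow> real" where "I \<equiv> integral {0..2*pi}"

lemmas cont_proj = cont[unfolded case_prod_unfold]

lemmas cont_slice = cont[THEN continuous_on_slice]

text \<open>Symmetry of the mixed derivatives; the Carleman identity also differentiates
  \<open>Wt\<close> in h. Integrating \<open>Wh\<close> in h and differentiating under the integral
  in t gives \<open>eq\<close>, and the fundamental theorem of calculus does the rest.\<close>

lemma Wt_h:
  assumes t: "t < T"
  shows "(Wt t has_real_derivative Wht t h) (at h)"
proof -
  define c d where "c = h - 1" and "d = h + 1"
  have h: "h \<in> {c<..<d}" by (auto simp: c_def d_def)
  have eq: "integral {c..x} (Wht t) = Wt t x - Wt t c" if "x \<in> {c..d}" for x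
  proof -
    have "((\<lambda>t. integral {c..x} (Wh t)) has_real_derivative integral {c..x} (Wht t)) (at t)"
      using has_derivative_circle_integral[OF Wh_t cont(3) cont(5) t] by simp
    moreover have "integral {c..x} (Wh s) = W s x - W s c" if "s \<in> {..<T}" for s
      using that \<open>x \<in> {c..d}\<close> W_h[of s]
      by (intro integral_unique fundamental_theorem_of_calculus)
         (auto simp: has_real_derivative_iff_has_vector_derivative[symmetric]
          intro: has_field_derivative_at_within)
    ultimately have "((\<lambda>s. W s x - W s c) has_real_derivative integral {c..x} (Wht t)) (at t)"
      using t by (subst DERIV_cong_ev[OF refl _ refl, where g = "\<lambda>t. integral {c..x} (Wh t)"])
        (auto simp: eventually_nhds intro!: exI[of _ "{..<T}"])
    moreover have "((\<lambda>s. W s x - W s c) has_real_derivative Wt t x - Wt t c) (at t)"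
      by (intro DERIV_diff W_t t)
    ultimately show ?thesis by (rule DERIV_unique)
  qed
  have "((\<lambda>x. integral {c..x} (Wht t)) has_real_derivative Wht t h) (at h within {c..d})"
    by (rule integral_has_real_derivative) (use cont_slice[OF t] h in auto)
  then have "((\<lambda>x. integral {c..x} (Wht t)) has_real_derivative Wht t h) (at h)"
    using h by (metis at_within_Icc_at greaterThanLessThan_iff)
  then have "((\<lambda>x. integral {c..x} (Wht t) + Wt t c) has_real_derivative Wht t h) (at h)"
    by (auto intro!: derivative_eq_intros)
  moreover have "\<forall>\<^sub>F x in nhds h. integral {c..x} (Wht t) + Wt t c = Wt t x"
    unfolding eventually_nhds using h eq by (intro exI[of _ "{c<..<d}"]) auto
  ultimately show ?thesis
    by (subst DERIV_cong_ev[OF refl _ refl]) (auto elim: eventually_mono)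
qed

lemma integrable_slice:
  assumes "continuous_on {0..2*pi} (f :: real \<Rightarrow> real)"
  shows "f integrable_on {0..2*pi}"
  using assms by (rule integrable_continuous_interval)

section \<open>Mass and energy of \<open>W\<close> on circles\<close>

definition y where "y t = I (\<lambda>h. (W t h)^2)"

definition y' where "y' t = I (\<lambda>h. 2 * W t h * Wt t h)"

definition y'' where "y'' t = I (\<lambda>h. 2 * (Wt t h)^2 + 2 * W t h * Wtt t h)"

definition D where "D t = I (\<lambda>h. (Wt t h)^2 + (Wh t h)^2)"

lemma y_deriv: "t < T \<Longrightarrow> (y has_real_derivative y' t) (at t)"
  unfolding y_def y'_def
  by (rule has_derivative_circle_integral[where T = T])
     (auto intro!: derivative_eq_intros W_t continuous_intros cont_proj simp: case_prod_unfold)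

lemma y'_deriv: "t < T \<Longrightarrow> (y' has_real_derivative y'' t) (at t)"
  unfolding y'_def y''_def
  by (rule has_derivative_circle_integral[where T = T])
     (auto intro!: derivative_eq_intros W_t Wt_t continuous_intros cont_proj
        simp: case_prod_unfold power2_eq_square)

lemma y_nonneg: "t < T \<Longrightarrow> 0 \<le> y t"
  unfolding y_def by (intro integral_nonneg integrable_slice continuous_intros cont_slice) auto

text \<open>\<open>y'' t / 2\<close> is the integral of Wt^2 + W Wtt. By \<open>ineq\<close>, W Wtt
  differs from -W Whh by at most K e^(\<tau>t) W^2, and -W Whh integrates to the same value as Wh^2
  because W Wh is periodic.\<close>

lemma D_le:
  assumes t: "t < T"
  shows "D t \<le> y'' t / 2 + K * ex t * y t"
proof -
  note [continuous_intros] = cont_slice[OF t]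
  have 0: "((\<lambda>h. Wh t h * Wh t h + W t h * Whh t h) has_integral 0) {0..2*pi}"
    by (rule integral_periodic_derivative[where f = "\<lambda>h. W t h * Wh t h"])
       (auto intro!: derivative_eq_intros W_h[OF t] Wh_h[OF t] simp: per[OF t])
  have "D t = I (\<lambda>h. (Wt t h)^2 + (Wh t h)^2)" by (simp add: D_def)
  also have "\<dots> \<le> I (\<lambda>h. (Wt t h)^2 + W t h * Wtt t h + (Wh t h * Wh t h + W t h * Whh t h)
      + K * ex t * (W t h)^2)"
  proof (intro integral_le integrable_slice continuous_intros)
    fix h
    have "- (W t h * (Wtt t h + Whh t h)) \<le> \<bar>W t h\<bar> * \<bar>Wtt t h + Whh t h\<bar>"
      by (metis abs_ge_minus_self abs_mult)
    also have "\<dots> \<le> \<bar>W t h\<bar> * (K * ex t * \<bar>W t h\<bar>)"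
      by (intro mult_left_mono ineq t) auto
    also have "\<dots> = K * ex t * (W t h)^2" by (simp add: power2_eq_square)
    finally show "(Wt t h)^2 + (Wh t h)^2 \<le> (Wt t h)^2 + W t h * Wtt t h
        + (Wh t h * Wh t h + W t h * Whh t h) + K * ex t * (W t h)^2"
      by (simp add: algebra_simps power2_eq_square)
  qed
  also have "\<dots> = I (\<lambda>h. (Wt t h)^2 + W t h * Wtt t h) + I (\<lambda>h. Wh t h * Wh t h + W t h * Whh t h)
      + I (\<lambda>h. K * ex t * (W t h)^2)"
    by (simp add: integral_add integrable_slice continuous_intros)
  also have "I (\<lambda>h. Wh t h * Wh t h + W t h * Whh t h) = 0" using 0 by (rule integral_unique)
  also have "I (\<lambda>h. (Wt t h)^2 + W t h * Wtt t h) = y'' t / 2"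
  proof -
    have "y'' t = I (\<lambda>h. 2 * ((Wt t h)^2 + W t h * Wtt t h))"
      by (simp add: y''_def algebra_simps)
    then show ?thesis by (simp only: integral_mult_right)
  qed
  also have "I (\<lambda>h. K * ex t * (W t h)^2) = K * ex t * y t"
    by (simp add: y_def)
  finally show ?thesis by simp
qed

text \<open>The decay assumption concerns \<open>W\<close> only; second differences of \<open>y\<close> transfer it to the
  first derivatives along a sequence of times.\<close>

lemma ex_small_D:
  assumes t: "t < T"
  shows "\<exists>s. t - 2 < s \<and> s < t \<and> D s \<le> (y t + y (t - 2)) / 2 + K * ex s * y s"
proof -
  have "\<exists>x. t - 1 < x \<and> x < t \<and>
      (y t - y (t - 1)) - (y (t - 1) - y (t - 1 - 1)) = (t - (t - 1)) * (y' x - y' (x - 1))"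
  proof (rule MVT2)
    fix x assume "t - 1 \<le> x" "x \<le> t"
    moreover have "((\<lambda>x. y (x - 1)) has_real_derivative y' (x - 1)) (at x)"
      using DERIV_shift[of y "y' (x - 1)" x "- 1"] y_deriv[of "x - 1"] t \<open>x \<le> t\<close> by simp
    ultimately show "((\<lambda>x. y x - y (x - 1)) has_real_derivative y' x - y' (x - 1)) (at x)"
      using t by (intro DERIV_diff y_deriv) auto
  qed auto
  then obtain x where x: "t - 1 < x" "x < t" "y t - 2 * y (t - 1) + y (t - 2) = y' x - y' (x - 1)"
    by (auto simp: algebra_simps)
  have "\<exists>s. x - 1 < s \<and> s < x \<and> y' x - y' (x - 1) = (x - (x - 1)) * y'' s"
    by (rule MVT2) (use x t in \<open>auto intro!: y'_deriv\<close>)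
  then obtain s where s: "x - 1 < s" "s < x" "y' x - y' (x - 1) = y'' s" by auto
  have "D s \<le> y'' s / 2 + K * ex s * y s" by (rule D_le) (use s x t in auto)
  moreover have "y'' s / 2 \<le> (y t + y (t - 2)) / 2" using y_nonneg[of "t - 1"] s x t by auto
  ultimately have "D s \<le> (y t + y (t - 2)) / 2 + K * ex s * y s" by linarith
  then show ?thesis using s x by (intro exI[of _ s]) auto
qed

text \<open>Carleman weight \<open>\<phi>(t) = \<alpha>t - e\<^bsup>\<tau>t\<^esup> / \<tau>\<^sup>2\<close>, increasing for large \<open>\<alpha>\<close> and concave, and
  \<open>E = e\<^bsup>-2\<phi>\<^esup>\<close>. With \<open>v = e\<^bsup>-\<phi>\<^esup> W\<close> the conjugated Laplacian is the sum of its symmetric part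
  \<open>v\<^sub>t\<^sub>t + v\<^sub>h\<^sub>h + \<phi>'\<^sup>2 v\<close> and its antisymmetric part \<open>2\<phi>' v\<^sub>t + \<phi>'' v\<close>. The density \<open>b\<close> below is
  \<open>2\<phi>' v\<^sub>t\<^sup>2 - 2\<phi>' v\<^sub>h\<^sup>2 + 2\<phi>'' v v\<^sub>t - (\<phi>'')' v\<^sup>2 + 2\<phi>'\<^sup>3 v\<^sup>2\<close>; twice the product of the two parts is
  its \<open>t\<close>-derivative, plus terms that integrate to zero over the circle, plus a positive
  quadratic form coming from \<open>-\<phi>''\<close>, which absorbs the right-hand side.\<close>

context
  fixes \<alpha> :: real
begin

definition \<phi>' where "\<phi>' t = \<alpha> - ex t / \<tau>"

definition E where "E t = exp (- 2 * (\<alpha> * t - ex t / \<tau>^2))"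

definition b where "b t h = E t * (2 * \<phi>' t * (Wt t h - \<phi>' t * W t h)^2 - 2 * \<phi>' t * (Wh t h)^2
  - 2 * ex t * W t h * (Wt t h - \<phi>' t * W t h) + \<tau> * ex t * (W t h)^2
  + 2 * \<phi>' t ^ 3 * (W t h)^2)"

definition bt where "bt t h = (let p = \<phi>' t; s = ex t; v = Wt t h - p * W t h;
    v' = Wtt t h + s * W t h - p * Wt t h in
  E t * (- 2 * p * (2 * p * v^2 - 2 * p * (Wh t h)^2 - 2 * s * W t h * v
    + \<tau> * s * (W t h)^2 + 2 * p ^ 3 * (W t h)^2)
  - 2 * s * v^2 + 4 * p * v * v' + 2 * s * (Wh t h)^2 - 4 * p * Wh t h * Wht t h
  - 2 * \<tau> * s * W t h * v - 2 * s * Wt t h * v - 2 * s * W t h * v' + \<tau>^2 * s * (W t h)^2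
  + 2 * \<tau> * s * W t h * Wt t h - 6 * p^2 * s * (W t h)^2 + 4 * p ^ 3 * W t h * Wt t h))"

definition B where "B t = I (b t)"

lemma \<phi>'_t: "(\<phi>' has_real_derivative - ex t) (at t)"
  unfolding \<phi>'_def using tau by (auto intro!: derivative_eq_intros)

lemma E_t: "(E has_real_derivative - 2 * \<phi>' t * E t) (at t)"
  unfolding \<phi>'_def E_def using tau
  by (auto intro!: derivative_eq_intros simp: field_simps power2_eq_square)

lemma b_t:
  assumes "t < T"
  shows "((\<lambda>t. b t h) has_real_derivative bt t h) (at t)"
  unfolding b_def bt_def Let_def
  by (rule derivative_eq_intros refl W_t Wt_t Wh_t E_t \<phi>'_t assms)+
    (simp add: algebra_simps power2_eq_square power3_eq_cube)

lemma cont_E: "continuous_on S E" and cont_\<phi>': "continuous_on S \<phi>'"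
  unfolding E_def \<phi>'_def by (intro continuous_intros; use tau in simp)+

lemma cont_b: "continuous_on ({..<T} \<times> UNIV) (\<lambda>(t, h). b t h)"
  and cont_bt: "continuous_on ({..<T} \<times> UNIV) (\<lambda>(t, h). bt t h)"
  unfolding b_def bt_def Let_def case_prod_unfold
  by (intro continuous_intros cont_proj continuous_on_compose2[OF cont_E]
      continuous_on_compose2[OF cont_\<phi>']; auto)+

lemma B_t: "t < T \<Longrightarrow> (B has_real_derivative I (bt t)) (at t)"
  unfolding B_def by (rule has_derivative_circle_integral[OF b_t cont_b cont_bt])

text \<open>\<open>M\<close> and \<open>A\<close> are the symmetric and the antisymmetric part
  multiplied by e^\<phi>. Their sum is Wtt + Whh, so 2 M A \<le> (M + A)^2 brings in
  \<open>ineq\<close>. The terms added to \<open>bt\<close> on the left are h-derivatives of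
  periodic functions, times functions of t. On the right the gain 4 \<phi>'^2 has to beat \<tau>^2
  and K^2 e^(\<tau>t), which a large \<alpha> ensures.\<close>

lemma bt_le:
  assumes t: "t < T"
  shows "bt t h + E t * (4 * \<phi>' t * (Whh t h * (Wt t h - \<phi>' t * W t h)
        + Wh t h * (Wht t h - \<phi>' t * Wh t h)) - 2 * ex t * (Wh t h * Wh t h + W t h * Whh t h))
     \<le> - (E t * ex t * (4 * (\<phi>' t)^2 - \<tau>^2 - K^2 * ex t) * (W t h)^2)" (is "?L \<le> ?R")
proof -
  define p s v where "p = \<phi>' t" and "s = ex t" and "v = Wt t h - p * W t h"
  define M where "M = Wtt t h + Whh t h - 2 * p * Wt t h + (2 * p^2 + s) * W t h"
  define A where "A = 2 * p * v - s * W t h"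
  have "(Wtt t h + Whh t h)^2 \<le> (K * s * \<bar>W t h\<bar>)^2"
    using ineq[OF t, of h] unfolding s_def by (metis abs_ge_zero power_mono power2_abs)
  also have "\<dots> = K^2 * s^2 * (W t h)^2" by (simp add: power_mult_distrib)
  finally have f: "(M + A)^2 \<le> K^2 * s^2 * (W t h)^2"
    by (simp add: M_def A_def v_def algebra_simps power2_eq_square)
  have "2 * M * A - 4 * s * v^2 \<le> (M + A)^2"
  proof -
    have "0 \<le> s * v^2" by (simp add: s_def)
    then show ?thesis using zero_le_power2[of M] zero_le_power2[of A] unfolding power2_sum by linarith
  qed
  have "?L = E t * (2 * M * A - 4 * s * v^2 + \<tau>^2 * s * (W t h)^2 - 4 * p^2 * s * (W t h)^2)"
    unfolding bt_def Let_def p_def[symmetric] s_def[symmetric] M_def A_def v_def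
      distrib_left[symmetric] by (rule arg_cong[where f = "(*) (E t)"]) algebra
  also have "\<dots> \<le> E t * (K^2 * s^2 * (W t h)^2 + \<tau>^2 * s * (W t h)^2 - 4 * p^2 * s * (W t h)^2)"
    using f \<open>2 * M * A - 4 * s * v^2 \<le> (M + A)^2\<close> by (intro mult_left_mono) (auto simp: E_def)
  also have "\<dots> = ?R" by (simp add: p_def s_def algebra_simps power2_eq_square)
  finally show ?thesis .
qed

section \<open>Monotonicity and two-sided bounds of \<open>B\<close> for large \<alpha>\<close>

context
  assumes large: "\<alpha> \<ge> 1 + \<tau> + (K^2 + 1) * ex T + ex T / \<tau>"
begin

text \<open>The summand \<open>ex T / \<tau>\<close> of \<open>large\<close> makes up for the term
  subtracted in \<open>\<phi>'\<close>. The rest is a margin: \<open>ex t\<close> and \<tau> stay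
  below \<open>\<phi>' t\<close>, and the gain in \<open>bt_le\<close> stays above 1.\<close>

lemma \<phi>'_ge: "t < T \<Longrightarrow> \<phi>' t \<ge> 1 + \<tau> + (K^2 + 1) * ex t"
proof -
  assume "t < T"
  then have "ex t \<le> ex T" using tau by simp
  then have "ex t / \<tau> \<le> ex T / \<tau>" "(K^2 + 1) * ex t \<le> (K^2 + 1) * ex T"
    using tau by (auto intro!: divide_right_mono mult_left_mono)
  then show ?thesis using large unfolding \<phi>'_def by linarith
qed

lemma \<phi>'_bounds:
  assumes "t < T"
  shows "1 \<le> \<phi>' t" "ex t \<le> \<phi>' t" "\<tau> \<le> \<phi>' t" "\<phi>' t \<le> \<alpha>"
proof -
  have "0 \<le> K^2 * ex t" "0 < ex t" by simp_all
  moreover have "(K^2 + 1) * ex t = K^2 * ex t + ex t"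
    by (simp add: algebra_simps)
  ultimately show "1 \<le> \<phi>' t" "ex t \<le> \<phi>' t" "\<tau> \<le> \<phi>' t"
    using \<phi>'_ge[OF assms] tau by linarith+
  show "\<phi>' t \<le> \<alpha>" using tau by (simp add: \<phi>'_def)
qed

text \<open>The h-derivatives added in \<open>bt_le\<close> integrate to zero over the circle, and
  \<open>c\<close> keeps the remaining coefficient of W^2 at least 1. This gives not only that
  \<open>B\<close> decreases but also how fast, in terms of \<open>y\<close>.\<close>

lemma B'_le:
  assumes t: "t < T"
  shows "I (bt t) \<le> - (E t * ex t * y t)"
proof -
  note [continuous_intros] = cont_slice[OF t] continuous_on_slice[OF cont_bt t]
  have 1: "((\<lambda>h. Wh t h * Wh t h + W t h * Whh t h) has_integral 0) {0..2*pi}"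
    by (rule integral_periodic_derivative[where f = "\<lambda>h. W t h * Wh t h"])
       (auto intro!: derivative_eq_intros W_h[OF t] Wh_h[OF t] simp: per[OF t])
  have 2: "((\<lambda>h. Whh t h * (Wt t h - \<phi>' t * W t h) + Wh t h * (Wht t h - \<phi>' t * Wh t h))
      has_integral 0) {0..2*pi}"
    by (rule integral_periodic_derivative[where f = "\<lambda>h. Wh t h * (Wt t h - \<phi>' t * W t h)"])
       (auto intro!: derivative_eq_intros W_h[OF t] Wt_h[OF t] Wh_h[OF t] simp: per[OF t])
  have c: "1 \<le> 4 * (\<phi>' t)^2 - \<tau>^2 - K^2 * ex t"
  proof -
    have "(1 + \<tau> + (K^2 + 1) * ex t)^2 \<le> (\<phi>' t)^2"
      using \<phi>'_ge[OF t] tau by (intro power_mono) auto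
    moreover have "1 + \<tau>^2 + K^2 * ex t \<le> (1 + \<tau> + (K^2 + 1) * ex t)^2"
    proof -
      define w where "w = K^2 * ex t"
      define s where "s = ex t"
      have "0 \<le> w" "0 \<le> s" by (auto simp: w_def s_def)
      have "(1 + \<tau> + (K^2 + 1) * ex t)^2 = (1 + \<tau> + w + s)^2"
        by (simp add: w_def s_def algebra_simps)
      also have "\<dots> = (1 + \<tau>^2 + w) + (w + s * 2 + \<tau> * 2 + (w + s)^2 + 2 * \<tau> * (w + s))"
        by (simp add: algebra_simps power2_eq_square)
      also have "\<dots> \<ge> 1 + \<tau>^2 + w" using \<open>0 \<le> w\<close> \<open>0 \<le> s\<close> tau by simp
      finally show ?thesis by (simp add: w_def)
    qed
    ultimately show ?thesis using zero_le_power2[of "\<phi>' t"] by linarith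
  qed
  have "I (bt t) = I (bt t) + (E t * (4 * \<phi>' t * 0 - 2 * ex t * 0))" by simp
  also have "\<dots> = I (\<lambda>h. bt t h + E t * (4 * \<phi>' t * (Whh t h * (Wt t h - \<phi>' t * W t h)
        + Wh t h * (Wht t h - \<phi>' t * Wh t h)) - 2 * ex t * (Wh t h * Wh t h + W t h * Whh t h)))"
    by (rule integral_unique[symmetric])
       (intro has_integral_add has_integral_mult_right has_integral_diff 1 2 integrable_integral
        integrable_slice continuous_intros)
  also have "\<dots> \<le> I (\<lambda>h. - (E t * ex t * (W t h)^2))"
  proof (intro integral_le integrable_slice continuous_intros)
    fix h
    have "E t * ex t * (W t h)^2 * 1 \<le> E t * ex t * (W t h)^2 *
        (4 * (\<phi>' t)^2 - \<tau>^2 - K^2 * ex t)"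
      using c by (intro mult_left_mono) (auto simp: E_def)
    then show "bt t h + E t * (4 * \<phi>' t * (Whh t h * (Wt t h - \<phi>' t * W t h)
        + Wh t h * (Wht t h - \<phi>' t * Wh t h)) - 2 * ex t * (Wh t h * Wh t h + W t h * Whh t h))
        \<le> - (E t * ex t * (W t h)^2)"
      using bt_le[OF t, of h] by (simp add: algebra_simps)
  qed
  also have "\<dots> = - (E t * ex t * y t)" by (simp add: y_def)
  finally show ?thesis .
qed

lemma B_antimono: "\<lbrakk>s \<le> t; t < T\<rbrakk> \<Longrightarrow> B t \<le> B s"
proof (rule DERIV_nonpos_imp_nonincreasing[of s t B])
  fix x assume "s \<le> x" "x \<le> t" "t < T"
  then have "x < T" by simp
  have "0 \<le> E x * ex x * y x" using y_nonneg[OF \<open>x < T\<close>] by (simp add: E_def)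
  then show "\<exists>y. (B has_real_derivative y) (at x) \<and> y \<le> 0"
    using B_t[OF \<open>x < T\<close>] B'_le[OF \<open>x < T\<close>] by (intro exI[of _ "I (bt x)"]) linarith
qed auto

text \<open>Only -2 \<phi>' Wh^2 can make \<open>b\<close> negative: the cross term is absorbed by
  the squares of \<open>v\<close> and W, because e^(\<tau>t) \<le> \<phi>' and \<phi>' \<ge> 1.
  Apart from \<open>E\<close> the bound is linear in \<alpha>, so that an exponential in \<alpha>
  will beat it.\<close>

lemma B_ge:
  assumes t: "t < T"
  shows "B t \<ge> - (2 * \<alpha> * E t * I (\<lambda>h. (Wh t h)^2))"
proof -
  note [continuous_intros] = cont_slice[OF t] continuous_on_slice[OF cont_b t]
  define p s where "p = \<phi>' t" and "s = ex t"
  have p: "1 \<le> p" "s \<le> p" "p \<le> \<alpha>" "0 < s" using \<phi>'_bounds[OF t] by (simp_all add: p_def s_def)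
  have "b t h \<ge> - (2 * \<alpha> * E t * (Wh t h)^2)" for h
  proof -
    define v where "v = Wt t h - p * W t h"
    have "2 * s * W t h * v \<le> 2 * s * (\<bar>W t h\<bar> * \<bar>v\<bar>)"
      using \<open>0 < s\<close> by (simp add: abs_mult[symmetric])
    also have "\<dots> \<le> 2 * p * (\<bar>W t h\<bar> * \<bar>v\<bar>)" using p by (intro mult_right_mono) auto
    also have "\<dots> = p * (2 * \<bar>W t h\<bar> * \<bar>v\<bar>)" by simp
    also have "\<dots> \<le> p * ((W t h)^2 + v^2)"
      using sum_squares_bound[of "\<bar>W t h\<bar>" "\<bar>v\<bar>"] p by (intro mult_left_mono) auto
    also have "\<dots> \<le> 2 * p ^ 3 * (W t h)^2 + 2 * p * v^2"
    proof -
      have "p ^ 1 \<le> p ^ 3" using p by (intro power_increasing) auto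
      then have "p \<le> 2 * p ^ 3" using p by simp
      then have "p * (W t h)^2 \<le> 2 * p ^ 3 * (W t h)^2" by (intro mult_right_mono) auto
      moreover have "0 \<le> p * v^2" using p by simp
      ultimately show ?thesis by (simp add: algebra_simps)
    qed
    finally have 1: "2 * s * W t h * v \<le> 2 * p ^ 3 * (W t h)^2 + 2 * p * v^2" .
    have 2: "2 * p * (Wh t h)^2 \<le> 2 * \<alpha> * (Wh t h)^2"
      using \<open>p \<le> \<alpha>\<close> by (intro mult_right_mono) auto
    have 3: "0 \<le> \<tau> * s * (W t h)^2" using tau \<open>0 < s\<close> by simp
    have "E t * (- (2 * \<alpha> * (Wh t h)^2)) \<le> b t h"
      unfolding b_def p_def[symmetric] s_def[symmetric] v_def[symmetric]
      using 1 2 3 by (intro mult_left_mono) (auto simp: E_def)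
    then show ?thesis by (simp add: algebra_simps)
  qed
  then have "I (\<lambda>h. - (2 * \<alpha> * E t * (Wh t h)^2)) \<le> B t"
    unfolding B_def by (intro integral_le integrable_slice continuous_intros) auto
  then show ?thesis by simp
qed

lemma B_le:
  assumes t: "t < T"
  shows "B t \<le> E t * (10 * \<alpha> ^ 3) * (D t + y t)"
proof -
  note [continuous_intros] = cont_slice[OF t] continuous_on_slice[OF cont_b t]
  define p s where "p = \<phi>' t" and "s = ex t"
  have p: "1 \<le> p" "s \<le> p" "\<tau> \<le> p" "p \<le> \<alpha>" "0 < s"
    using \<phi>'_bounds[OF t] by (simp_all add: p_def s_def)
  have "b t h \<le> E t * (10 * \<alpha> ^ 3) * ((Wt t h)^2 + (Wh t h)^2 + (W t h)^2)" for h
  proof -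
    define v where "v = Wt t h - p * W t h"
    have "0 \<le> (Wt t h + p * W t h)^2" by simp
    then have v2: "v^2 \<le> 2 * (Wt t h)^2 + 2 * p^2 * (W t h)^2"
      by (simp add: v_def power2_eq_square algebra_simps)
    have "- (2 * s * W t h * v) \<le> s * ((W t h)^2 + v^2)"
      using zero_le_power2[of "W t h + v"] p(5) mult_nonneg_nonneg[of s "(W t h + v)^2"]
      by (simp add: power2_eq_square algebra_simps)
    also have "\<dots> \<le> p * ((W t h)^2 + v^2)" using p by (intro mult_right_mono) auto
    finally have 1: "- (2 * s * W t h * v) \<le> p * (W t h)^2 + p * v^2" by (simp add: algebra_simps)
    have "\<tau> * s \<le> p * p" using p tau by (intro mult_mono) auto
    then have 2: "\<tau> * s * (W t h)^2 \<le> p^2 * (W t h)^2"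
      unfolding power2_eq_square[of p] by (intro mult_right_mono) auto
    have "3 * p * v^2 \<le> 3 * p * (2 * (Wt t h)^2 + 2 * p^2 * (W t h)^2)"
      using p v2 by (intro mult_left_mono) auto
    then have 3: "3 * p * v^2 \<le> 6 * p * (Wt t h)^2 + 6 * p ^ 3 * (W t h)^2"
      by (simp add: power2_eq_square power3_eq_cube algebra_simps)
    have le: "p \<le> p ^ 3" "p^2 \<le> p ^ 3" "0 \<le> p ^ 3"
      using p self_le_power[of p 3] power_increasing[of 2 3 p] by auto
    have 4: "p * (W t h)^2 \<le> p ^ 3 * (W t h)^2" "p^2 * (W t h)^2 \<le> p ^ 3 * (W t h)^2"
      "p * (Wt t h)^2 \<le> p ^ 3 * (Wt t h)^2" "0 \<le> p * (Wh t h)^2" "0 \<le> p ^ 3 * (Wh t h)^2"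
      "0 \<le> p ^ 3 * (Wt t h)^2"
      using le p by (auto intro!: mult_right_mono)
    \<comment> \<open>The coefficient of p^3 W^2 adds up to 6 + 1 + 1 + 2 = 10: from the squares of
      \<open>v\<close>, the cross term, the term with \<tau>, and the last term of
      \<open>b\<close>.\<close>
    have "2 * p * v^2 - 2 * p * (Wh t h)^2 - 2 * s * W t h * v + \<tau> * s * (W t h)^2 + 2 * p ^ 3 * (W t h)^2
        \<le> 10 * p ^ 3 * ((Wt t h)^2 + (Wh t h)^2 + (W t h)^2)"
      using 1 2 3 4 by (simp add: algebra_simps)
    also have "\<dots> \<le> 10 * \<alpha> ^ 3 * ((Wt t h)^2 + (Wh t h)^2 + (W t h)^2)"
      using p \<open>p \<le> \<alpha>\<close> by (intro mult_right_mono mult_left_mono power_mono) auto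
    finally have "E t * (2 * p * v^2 - 2 * p * (Wh t h)^2 - 2 * s * W t h * v + \<tau> * s * (W t h)^2
        + 2 * p ^ 3 * (W t h)^2)
        \<le> E t * (10 * \<alpha> ^ 3 * ((Wt t h)^2 + (Wh t h)^2 + (W t h)^2))"
      by (intro mult_left_mono) (auto simp: E_def)
    then show ?thesis
      unfolding b_def p_def[symmetric] s_def[symmetric] v_def[symmetric] by (simp add: mult.assoc)
  qed
  then have "B t \<le> I (\<lambda>h. E t * (10 * \<alpha> ^ 3) * ((Wt t h)^2 + (Wh t h)^2 + (W t h)^2))"
    unfolding B_def by (intro integral_le integrable_slice continuous_intros) auto
  also have "\<dots> = E t * (10 * \<alpha> ^ 3) * (D t + y t)"
    by (simp add: D_def y_def integral_add[symmetric] integrable_slice continuous_intros)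
  finally show ?thesis .
qed

text \<open>\<open>B\<close> decreases, so \<open>B t\<close> is at most any value of
  \<open>B\<close> further left. There \<open>E\<close> grows like e^(-2\<alpha>x), and decay of
  order N \<ge> \<alpha> + 1 overcomes it. \<open>ex_small_D\<close> controls the derivatives only
  at some s in (x - 2, x), which by monotonicity is enough and accounts for the factor e^(4\<alpha>)
  in \<open>G\<close>.\<close>

lemma B_nonpos:
  assumes t: "t < T"
  shows "B t \<le> 0"
proof -
  define N where "N = nat \<lceil>\<alpha> + 1\<rceil>"
  have N: "real N \<ge> \<alpha> + 1" unfolding N_def by linarith
  have "0 \<le> ex T / \<tau>" "0 \<le> (K^2 + 1) * ex T" using tau by auto
  then have \<alpha>: "0 < \<alpha>" using large tau by linarith
  obtain C where C: "\<And>t h. t < T \<Longrightarrow> \<bar>W t h\<bar> \<le> C * exp (real N * t)" using decay[of N] by blast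
  define c where "c = 2 * pi * C^2"
  have y: "y x \<le> c * exp (2 * real N * x)" if "x < T" for x
  proof -
    have "y x \<le> I (\<lambda>h. C^2 * exp (2 * real N * x))"
      unfolding y_def
    proof (intro integral_le integrable_slice continuous_intros cont_slice that)
      fix h
      have "(W x h)^2 \<le> (C * exp (real N * x))^2"
        using C[OF that, of h] by (metis abs_ge_zero power_mono power2_abs)
      then show "(W x h)^2 \<le> C^2 * exp (2 * real N * x)"
        by (simp add: power_mult_distrib exp_double[symmetric] mult.assoc)
    qed
    then show ?thesis by (simp add: c_def mult_ac)
  qed
  have "c \<ge> 0" by (simp add: c_def)
  define G where "G = exp (4 * \<alpha> + 2 * ex T / \<tau>^2) * (10 * \<alpha> ^ 3) * (2 * c + K * ex T * c)"
  have le: "B t \<le> G * exp (2 * x)" if "x < min 0 t" for x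
  proof -
    have x: "x < 0" "x < t" "x < T" using that t by auto
    obtain s where s: "x - 2 < s" "s < x" "D s \<le> (y x + y (x - 2)) / 2 + K * ex s * y s"
      using ex_small_D[OF x(3)] by blast
    have e: "c * exp (2 * real N * r) \<le> c * exp (2 * real N * x)" if "r \<le> x" for r
      using that \<open>c \<ge> 0\<close> by (intro mult_left_mono) (auto intro!: mult_left_mono)
    have ys: "y s \<le> c * exp (2 * real N * x)" "y x \<le> c * exp (2 * real N * x)"
      "y (x - 2) \<le> c * exp (2 * real N * x)"
      using y[of s] y[of x] y[of "x - 2"] e[of s] e[of "x - 2"] s x by auto
    have "K * ex s * y s \<le> K * ex T * (c * exp (2 * real N * x))"
      using K ys(1) tau s x y_nonneg[of s] by (intro mult_mono) auto
    moreover have "(y x + y (x - 2)) / 2 \<le> c * exp (2 * real N * x)" using ys by simp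
    ultimately have "D s + y s \<le> c * exp (2 * real N * x) + K * ex T * (c * exp (2 * real N * x))
        + c * exp (2 * real N * x)"
      by (intro add_mono ys(1) order.trans[OF s(3)])
    also have "\<dots> = (2 * c + K * ex T * c) * exp (2 * real N * x)" by (simp add: algebra_simps)
    finally have Dy: "D s + y s \<le> (2 * c + K * ex T * c) * exp (2 * real N * x)" .
    have "ex s / \<tau>^2 \<le> ex T / \<tau>^2" using tau s x by (intro divide_right_mono) auto
    moreover have "\<alpha> * (x - 2) \<le> \<alpha> * s" using \<alpha> s by (intro mult_left_mono) auto
    ultimately have Es: "E s \<le> exp (4 * \<alpha> + 2 * ex T / \<tau>^2) * exp (- 2 * \<alpha> * x)"
      unfolding E_def exp_add[symmetric] by (simp add: algebra_simps)
    have "B t \<le> B s" by (rule B_antimono) (use s x t in auto)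
    also have "\<dots> \<le> E s * (10 * \<alpha> ^ 3) * (D s + y s)" by (rule B_le) (use s x in auto)
    also have "\<dots> \<le> exp (4 * \<alpha> + 2 * ex T / \<tau>^2) * exp (- 2 * \<alpha> * x) * (10 * \<alpha> ^ 3) *
        ((2 * c + K * ex T * c) * exp (2 * real N * x))"
    proof (intro mult_mono Es Dy order.refl)
      show "0 \<le> D s + y s"
        unfolding D_def y_def using s x
        by (intro add_nonneg_nonneg integral_nonneg integrable_slice continuous_intros cont_slice) auto
    qed (use \<alpha> in auto)
    also have "\<dots> = G * (exp (- 2 * \<alpha> * x) * exp (2 * real N * x))"
      unfolding G_def by (simp only: mult_ac)
    also have "exp (- 2 * \<alpha> * x) * exp (2 * real N * x) = exp (2 * (real N - \<alpha>) * x)"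
      unfolding exp_add[symmetric] by (simp add: algebra_simps)
    also have "G * exp (2 * (real N - \<alpha>) * x) \<le> G * exp (2 * x)"
    proof (intro mult_left_mono)
      have "(real N - \<alpha>) * x \<le> 1 * x" using N x by (intro mult_right_mono_neg) auto
      then show "exp (2 * (real N - \<alpha>) * x) \<le> exp (2 * x)" by (simp add: algebra_simps)
      show "0 \<le> G" using \<open>c \<ge> 0\<close> K \<alpha> by (simp add: G_def)
    qed
    finally show ?thesis .
  qed
  moreover have "((\<lambda>x. G * exp (2 * x)) \<longlongrightarrow> G * 0) at_bot"
    by (intro tendsto_intros filterlim_compose[OF exp_at_bot]
        filterlim_tendsto_pos_mult_at_bot[OF tendsto_const] filterlim_ident) auto
  moreover have "\<forall>\<^sub>F x in at_bot. B t \<le> G * exp (2 * x)"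
    using eventually_gt_at_bot[of "min 0 t"] by (rule eventually_mono) (rule le)
  ultimately show ?thesis
    using tendsto_lowerbound[of "\<lambda>x. G * exp (2 * x)" 0 at_bot "B t"] by simp
qed

end

end

text \<open>If \<open>y\<close> were positive at some time, the monotone quantity \<open>B\<close> at a later time \<open>T1\<close> would be
  at most a negative multiple of \<open>e\<^bsup>-2\<alpha>(t\<^sub>1 + \<delta>)\<^esup>\<close>, but it is at least \<open>- O(\<alpha> e\<^bsup>-2\<alpha> T1\<^esup>)\<close>;
  let \<open>\<alpha> \<rightarrow> \<infinity>\<close>.\<close>

lemma y_eq_0:
  assumes t1: "t1 < T"
  shows "y t1 = 0"
proof (rule ccontr)
  assume "y t1 \<noteq> 0"
  then have pos: "y t1 > 0" using y_nonneg[OF t1] by simp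
  define T1 where "T1 = (t1 + T) / 2"
  have T1: "t1 < T1" "T1 < T" using t1 by (auto simp: T1_def)
  have "isCont y t1" using y_deriv[OF t1] by (rule DERIV_isCont)
  then have "\<forall>\<^sub>F x in nhds t1. y t1 / 2 < y x"
    using pos by (intro order_tendstoD(1)) (auto simp: isCont_def tendsto_at_iff_tendsto_nhds)
  then obtain d where d: "d > 0" "\<And>x. dist x t1 < d \<Longrightarrow> y t1 / 2 < y x"
    unfolding eventually_nhds_metric by blast
  define \<delta> where "\<delta> = min (d / 2) ((T1 - t1) / 2)"
  have \<delta>: "\<delta> > 0" "t1 + \<delta> < T1" using d T1 by (auto simp: \<delta>_def min_def field_simps)
  have yd: "y t1 / 2 < y x" if "t1 \<le> x" "x \<le> t1 + \<delta>" for x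
    using that d(1) by (intro d(2)) (auto simp: dist_real_def \<delta>_def)
  define \<kappa> where "\<kappa> = T1 - t1 - \<delta>"
  have \<kappa>: "\<kappa> > 0" using \<delta> by (simp add: \<kappa>_def)
  define c where "c = \<delta> * (ex t1 * (y t1 / 2))"
  define J where "J = exp (2 * ex T1 / \<tau>^2) * I (\<lambda>h. (Wh T1 h)^2)"
  define \<alpha>0 where "\<alpha>0 = 1 + \<tau> + (K^2 + 1) * ex T + ex T / \<tau>"
  have c: "c > 0" using \<delta> pos by (simp add: c_def)
  have "0 \<le> ex T / \<tau>" "0 \<le> (K^2 + 1) * ex T" using tau by auto
  then have "0 < \<alpha>0" using tau unfolding \<alpha>0_def by linarith
  have "\<alpha> \<le> J / (c * \<kappa>^2)" if \<alpha>: "\<alpha> \<ge> \<alpha>0" for \<alpha>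
  proof -
    note large = \<alpha>[unfolded \<alpha>0_def]
    have \<alpha>0: "0 < \<alpha>" using \<open>0 < \<alpha>0\<close> \<alpha> by simp
    have "\<exists>z>t1. z < t1 + \<delta> \<and> B \<alpha> (t1 + \<delta>) - B \<alpha> t1 = (t1 + \<delta> - t1) * I (bt \<alpha> z)"
      by (rule MVT2) (use \<delta> T1 in \<open>auto intro!: B_t\<close>)
    then obtain z where z: "z > t1" "z < t1 + \<delta>" "B \<alpha> (t1 + \<delta>) - B \<alpha> t1 = \<delta> * I (bt \<alpha> z)"
      by auto
    have "exp (- 2 * \<alpha> * (t1 + \<delta>)) * (ex t1 * (y t1 / 2)) \<le> E \<alpha> z * (ex z * y z)"
    proof (intro mult_mono)
      have "\<alpha> * z \<le> \<alpha> * (t1 + \<delta>)" using z \<alpha>0 by (intro mult_left_mono) auto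
      then have "2 * (\<alpha> * z) \<le> 2 * (\<alpha> * (t1 + \<delta>)) + 2 * (ex z / \<tau>^2)"
        by (intro add_increasing2) auto
      then show "exp (- 2 * \<alpha> * (t1 + \<delta>)) \<le> E \<alpha> z"
        unfolding E_def exp_le_cancel_iff by (simp only: algebra_simps)
    qed (use z tau yd[of z] pos in \<open>auto simp: E_def\<close>)
    then have "\<delta> * (exp (- 2 * \<alpha> * (t1 + \<delta>)) * (ex t1 * (y t1 / 2)))
        \<le> \<delta> * (E \<alpha> z * (ex z * y z))" using \<delta> by (intro mult_left_mono) auto
    moreover have "\<delta> * I (bt \<alpha> z) \<le> \<delta> * - (E \<alpha> z * ex z * y z)"
      using \<delta> z T1 by (intro mult_left_mono B'_le[OF large]) auto
    moreover have "B \<alpha> T1 \<le> B \<alpha> (t1 + \<delta>)"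
      by (rule B_antimono[OF large]) (use \<delta> T1 in auto)
    moreover have "B \<alpha> t1 \<le> 0" by (rule B_nonpos[OF large t1])
    ultimately have "B \<alpha> T1 \<le> - (c * exp (- 2 * \<alpha> * (t1 + \<delta>)))"
      using z(3) by (simp add: c_def mult_ac)
    then have "c * exp (- 2 * \<alpha> * (t1 + \<delta>)) \<le> 2 * \<alpha> * E \<alpha> T1 * I (\<lambda>h. (Wh T1 h)^2)"
      using B_ge[OF large T1(2)] by simp
    also have "\<dots> = 2 * \<alpha> * J * exp (- 2 * \<alpha> * T1)"
    proof -
      have "E \<alpha> T1 = exp (2 * ex T1 / \<tau>^2) * exp (- 2 * \<alpha> * T1)"
        unfolding E_def exp_add[symmetric] by (simp add: algebra_simps)
      then show ?thesis by (simp add: J_def)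
    qed
    finally have "c * exp (- 2 * \<alpha> * (t1 + \<delta>)) * exp (2 * \<alpha> * T1)
        \<le> 2 * \<alpha> * J * exp (- 2 * \<alpha> * T1) * exp (2 * \<alpha> * T1)" by (intro mult_right_mono) auto
    then have *: "c * exp (2 * \<alpha> * \<kappa>) \<le> 2 * \<alpha> * J"
      by (simp add: mult.assoc exp_add[symmetric] \<kappa>_def algebra_simps)
    have "0 < 2 * \<alpha> * \<kappa>" using \<alpha>0 \<kappa> by simp
    \<comment> \<open>The other side grows only linearly in \<alpha>, so the quadratic Taylor term
      of the exponential already bounds \<alpha>.\<close>
    then have "(2 * \<alpha> * \<kappa>)^2 / 2 \<le> exp (2 * \<alpha> * \<kappa>)"
      using exp_lower_Taylor_quadratic[of "2 * \<alpha> * \<kappa>"] by linarith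
    then have "c * ((2 * \<alpha> * \<kappa>)^2 / 2) \<le> c * exp (2 * \<alpha> * \<kappa>)" using c by (intro mult_left_mono) auto
    with * have "2 * \<alpha> * (\<alpha> * (c * \<kappa>^2)) \<le> 2 * \<alpha> * J" by (simp add: power2_eq_square algebra_simps)
    then have "\<alpha> * (c * \<kappa>^2) \<le> J" using \<alpha>0 by simp
    then show ?thesis using c \<kappa> by (simp add: pos_le_divide_eq)
  qed
  from this[of "max \<alpha>0 (J / (c * \<kappa>^2) + 1)"] show False by linarith
qed

theorem vanishes:
  assumes t: "t < T" and h: "h \<in> {0..2*pi}"
  shows "W t h = 0"
proof -
  have "((\<lambda>h. (W t h)^2) has_integral 0) (cbox 0 (2*pi))"
    using y_eq_0[OF t] integrable_slice[of "\<lambda>h. (W t h)^2"] cont_slice(1)[OF t]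
    by (auto simp: y_def intro!: continuous_intros simp: has_integral_iff)
  moreover have "continuous_on (cbox 0 (2*pi)) (\<lambda>h. (W t h)^2)"
    by (intro continuous_intros cont_slice[OF t])
  moreover have "box 0 (2*pi) \<noteq> {}" using pi_gt_zero by (simp add: not_le)
  ultimately have "(W t h)^2 = 0"
    using h by (intro has_integral_0_cbox_imp_0[of 0 "2*pi" "\<lambda>h. (W t h)^2" h]) auto
  then show ?thesis by simp
qed

end

section \<open>Uniqueness\<close>

lemma has_derivative_complex_plane:
  fixes f :: "complex \<Rightarrow> real"
  assumes "f differentiable (at z)"
  shows "(f has_derivative (\<lambda>v. Re v * frechet_derivative f (at z) 1
    + Im v * frechet_derivative f (at z) \<i>)) (at z)"
proof -
  have D: "(f has_derivative frechet_derivative f (at z)) (at z)"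
    using assms by (simp add: frechet_derivative_works)
  interpret linear "frechet_derivative f (at z)" using D by (rule has_derivative_linear)
  have "frechet_derivative f (at z) v = Re v * frechet_derivative f (at z) 1
    + Im v * frechet_derivative f (at z) \<i>" for v
  proof -
    have "v = Re v *\<^sub>R 1 + Im v *\<^sub>R \<i>" by (simp add: complex_eq_iff)
    then show ?thesis by (metis add scale real_scaleR_def)
  qed
  with D show ?thesis by (metis (no_types, lifting) ext)
qed

lemma laplacian_complex:
  "laplacian f z = frechet_derivative (\<lambda>y. frechet_derivative f (at y) 1) (at z) 1
    + frechet_derivative (\<lambda>y. frechet_derivative f (at y) \<i>) (at z) \<i>"
  unfolding laplacian_def by (simp add: Basis_complex_def)

lemma has_real_derivative_along_curve:
  fixes f :: "complex \<Rightarrow> real"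
  assumes "(f has_derivative (\<lambda>v. Re v * p + Im v * q)) (at (c t))"
    and "(c has_vector_derivative c') (at t)"
  shows "((\<lambda>t. f (c t)) has_real_derivative Re c' * p + Im c' * q) (at t)"
proof -
  have "((\<lambda>t. f (c t)) has_derivative (\<lambda>x. Re (x *\<^sub>R c') * p + Im (x *\<^sub>R c') * q)) (at t)"
    using has_derivative_compose[OF assms(2)[unfolded has_vector_derivative_def] assms(1)] by simp
  then show ?thesis
    unfolding has_field_derivative_def by (rule has_derivative_eq_rhs) (auto simp: algebra_simps)
qed

theorem strong_unique_continuation:
  fixes w p q px py qx qy :: "complex \<Rightarrow> real" and r K \<tau> :: real
  defines "S \<equiv> ball 0 r - {0}"
  assumes w: "\<And>z. z \<in> S \<Longrightarrow> (w has_derivative (\<lambda>v. Re v * p z + Im v * q z)) (at z)"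
    and p: "\<And>z. z \<in> S \<Longrightarrow> (p has_derivative (\<lambda>v. Re v * px z + Im v * py z)) (at z)"
    and q: "\<And>z. z \<in> S \<Longrightarrow> (q has_derivative (\<lambda>v. Re v * qx z + Im v * qy z)) (at z)"
    and c: "continuous_on S px" "continuous_on S py" "continuous_on S qx" "continuous_on S qy"
    and ineq: "\<And>z. z \<in> S \<Longrightarrow> \<bar>px z + qy z\<bar> \<le> K * norm z powr (\<tau> - 2) * \<bar>w z\<bar>"
    and K: "0 \<le> K" and tau: "0 < \<tau>"
    and decay: "\<And>N::nat. \<exists>C. \<forall>z\<in>S. \<bar>w z\<bar> \<le> C * norm z ^ N"
    and z: "z \<in> S"
  shows "w z = 0"
proof -
  define Z where "Z t h = of_real (exp t) * cis h" for t h
  have r: "0 < r" using z norm_ge_zero[of z] unfolding S_def mem_ball_0 Diff_iff by linarith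
  have ZS: "Z t h \<in> S" if "t < ln r" for t h
  proof -
    have "exp t < r" using that r by (metis exp_less_cancel_iff exp_ln)
    then show ?thesis by (simp add: Z_def S_def norm_mult)
  qed
  have Z_t: "((\<lambda>t. Z t h) has_vector_derivative Z t h) (at t)" for t h
    unfolding Z_def by (auto intro!: derivative_eq_intros has_vector_derivative_real_field simp: scaleR_conv_of_real)
  have Z_h: "(Z t has_vector_derivative \<i> * Z t h) (at h)" for t h
    unfolding Z_def cis_conv_exp
    by (auto intro!: derivative_eq_intros has_vector_derivative_real_field)
  define X Y where "X t h = Re (Z t h)" and "Y t h = Im (Z t h)" for t h
  have X_t: "((\<lambda>t. X t h) has_real_derivative X t h) (at t)"
    and Y_t: "((\<lambda>t. Y t h) has_real_derivative Y t h) (at t)"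
    and X_h: "((\<lambda>h. X t h) has_real_derivative - Y t h) (at h)"
    and Y_h: "((\<lambda>h. Y t h) has_real_derivative X t h) (at h)" for t h
    unfolding X_def Y_def Z_def by (auto intro!: derivative_eq_intros)
  have along_t: "((\<lambda>t. f (Z t h)) has_real_derivative X t h * f1 (Z t h) + Y t h * f2 (Z t h)) (at t)"
    and along_h: "((\<lambda>h. f (Z t h)) has_real_derivative - Y t h * f1 (Z t h) + X t h * f2 (Z t h)) (at h)"
    if "\<And>z. z \<in> S \<Longrightarrow> (f has_derivative (\<lambda>v. Re v * f1 z + Im v * f2 z)) (at z)" "t < ln r"
    for f f1 f2 :: "complex \<Rightarrow> real" and t h
    using has_real_derivative_along_curve[OF that(1)[OF ZS[OF that(2)]] Z_t]
      has_real_derivative_along_curve[OF that(1)[OF ZS[OF that(2)]] Z_h] by (simp_all add: X_def Y_def)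
  have contw: "continuous_on S w" "continuous_on S p" "continuous_on S q"
    by (meson w p q has_derivative_continuous continuous_at_imp_continuous_on)+
  have contZ: "continuous_on A (\<lambda>x. Z (fst x) (snd x))" for A
    unfolding Z_def by (intro continuous_intros)
  have cont: "continuous_on ({..<ln r} \<times> UNIV) (\<lambda>x. f (Z (fst x) (snd x)))"
    if "continuous_on S f" for f :: "complex \<Rightarrow> real"
    by (rule continuous_on_compose2[OF that contZ]) (use ZS in auto)
  define W where "W t h = w (Z t h)" for t h
  define Wt where "Wt t h = X t h * p (Z t h) + Y t h * q (Z t h)" for t h
  define Wh where "Wh t h = - Y t h * p (Z t h) + X t h * q (Z t h)" for t h
  define Wtt where "Wtt t h = Wt t h + X t h * (X t h * px (Z t h) + Y t h * py (Z t h))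
     + Y t h * (X t h * qx (Z t h) + Y t h * qy (Z t h))" for t h
  define Wht where "Wht t h = Wh t h - Y t h * (X t h * px (Z t h) + Y t h * py (Z t h))
     + X t h * (X t h * qx (Z t h) + Y t h * qy (Z t h))" for t h
  define Whh where "Whh t h = - Wt t h - Y t h * (- Y t h * px (Z t h) + X t h * py (Z t h))
     + X t h * (- Y t h * qx (Z t h) + X t h * qy (Z t h))" for t h
  have Z2pi: "Z t (2 * pi) = Z t 0" for t by (simp add: Z_def)
  interpret cylinder_inequality W Wt Wh Wtt Wht Whh "ln r" K \<tau>
  proof
    fix t h :: real assume t: "t < ln r"
    note d = along_t[OF w t] along_t[OF p t] along_t[OF q t] along_h[OF w t] along_h[OF p t] along_h[OF q t]
    show "((\<lambda>t. W t h) has_real_derivative Wt t h) (at t)"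
      "(W t has_real_derivative Wh t h) (at h)"
      unfolding W_def[abs_def] Wt_def Wh_def using d(1)[of h] d(4)[of h] by blast+
    show "((\<lambda>t. Wt t h) has_real_derivative Wtt t h) (at t)"
      "((\<lambda>t. Wh t h) has_real_derivative Wht t h) (at t)"
      "(Wh t has_real_derivative Whh t h) (at h)"
      unfolding W_def Wt_def Wh_def Wtt_def Wht_def Whh_def
      by (auto intro!: derivative_eq_intros d X_t Y_t X_h Y_h simp: algebra_simps)
    have "Wtt t h + Whh t h = ((X t h)^2 + (Y t h)^2) * (px (Z t h) + qy (Z t h))"
      by (simp add: Wtt_def Whh_def power2_eq_square algebra_simps)
    also have "(X t h)^2 + (Y t h)^2 = exp (2 * t)"
      unfolding X_def Y_def cmod_power2[symmetric] by (simp add: Z_def norm_mult exp_double)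
    finally have "\<bar>Wtt t h + Whh t h\<bar> = exp (2 * t) * \<bar>px (Z t h) + qy (Z t h)\<bar>"
      by (simp add: abs_mult)
    also have "\<dots> \<le> exp (2 * t) * (K * norm (Z t h) powr (\<tau> - 2) * \<bar>w (Z t h)\<bar>)"
      by (intro mult_left_mono ineq ZS t) auto
    also have "norm (Z t h) powr (\<tau> - 2) = exp ((\<tau> - 2) * t)"
      by (simp add: Z_def norm_mult powr_def)
    also have "exp (2 * t) * (K * exp ((\<tau> - 2) * t) * \<bar>w (Z t h)\<bar>)
        = K * (exp (2 * t) * exp ((\<tau> - 2) * t)) * \<bar>W t h\<bar>" by (simp add: W_def)
    also have "exp (2 * t) * exp ((\<tau> - 2) * t) = exp (\<tau> * t)"
      unfolding exp_add[symmetric] by (simp add: algebra_simps)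
    finally show "\<bar>Wtt t h + Whh t h\<bar> \<le> K * exp (\<tau> * t) * \<bar>W t h\<bar>" .
  next
    fix N :: nat
    obtain C where C: "\<And>z. z \<in> S \<Longrightarrow> \<bar>w z\<bar> \<le> C * norm z ^ N" using decay by blast
    have "\<bar>W t h\<bar> \<le> C * exp (real N * t)" if "t < ln r" for t h
      using C[OF ZS[OF that, of h]] by (simp add: W_def Z_def norm_mult exp_of_nat_mult)
    then show "\<exists>C. \<forall>t<ln r. \<forall>h. \<bar>W t h\<bar> \<le> C * exp (real N * t)" by blast
  qed (auto simp: W_def Wt_def Wh_def Wtt_def Wht_def Whh_def X_def Y_def case_prod_unfold Z2pi K tau
      intro!: continuous_intros cont contw c contZ)
  have "cmod z < r" "z \<noteq> 0" using z by (auto simp: S_def)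
  then have "ln (cmod z) < ln r" "exp (ln (cmod z)) = cmod z" using r by auto
  \<comment> \<open>\<open>Arg2pi\<close> rather than \<open>Arg\<close>, because
    \<open>vanishes\<close> speaks of angles between 0 and 2 pi.\<close>
  moreover have "Z (ln (cmod z)) (Arg2pi z) = z"
    using Arg2pi[of z] \<open>z \<noteq> 0\<close> by (simp add: Z_def is_Arg_def cis_conv_exp)
  moreover have "Arg2pi z \<in> {0..2*pi}" using Arg2pi[of z] by auto
  ultimately show ?thesis
    using vanishes[of "ln (cmod z)" "Arg2pi z"] by (simp add: W_def)
qed

section \<open>Comparison of two singular solutions\<close>

lemma index_seq_unbounded:
  assumes "\<tau> > 0"
  shows "\<exists>l\<ge>1. b \<le> index_seq \<tau> (Suc l)"
proof -
  obtain n :: nat where n: "b < real n" using reals_Archimedean2 by blast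
  have "real (Suc n) \<in> index_seq \<tau> ` {1..}"
    unfolding index_seq_image[OF assms] by (rule of_nat_in_index_set) simp
  then obtain l where "l \<ge> 1" "real (Suc n) = index_seq \<tau> l" by auto
  then show ?thesis using index_seq_Suc(2)[OF assms, of l] n by (intro exI[of _ l]) auto
qed

lemma abs_exp_diff_le: "\<bar>exp x - exp y\<bar> \<le> exp (max x y) * \<bar>x - y\<bar>" for x y :: real
proof -
  have *: "exp x - exp y \<le> exp x * (x - y)" for x y :: real
  proof -
    have "exp x * (1 + (y - x)) \<le> exp x * exp (y - x)" by (intro mult_left_mono exp_ge_add_one_self) auto
    then show ?thesis by (simp add: exp_add[symmetric] algebra_simps)
  qed
  show ?thesis
    using *[of x y] *[of y x] by (cases "x \<le> y") (auto simp: max_def abs_if algebra_simps)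
qed

text \<open>The point is the last argument, so that \<open>dderiv v\<close> acts on functions and
  can be iterated.\<close>

definition dderiv :: "complex \<Rightarrow> (complex \<Rightarrow> real) \<Rightarrow> complex \<Rightarrow> real" where
  "dderiv v f z = frechet_derivative f (at z) v"

lemma smooth_on_imp_C2:
  assumes "smooth_on u S"
  shows "z \<in> S \<Longrightarrow> (u has_derivative (\<lambda>v. Re v * dderiv 1 u z + Im v * dderiv \<i> u z)) (at z)"
    and "z \<in> S \<Longrightarrow> (dderiv b u has_derivative
      (\<lambda>v. Re v * dderiv 1 (dderiv b u) z + Im v * dderiv \<i> (dderiv b u) z)) (at z)"
    and "continuous_on S (dderiv c (dderiv b u))"
proof -
  have "Ck_on (Suc (Suc 0)) u S" using assms(1) by (auto simp: smooth_on_def)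
  then have *: "\<forall>x\<in>S. u differentiable (at x)" "\<forall>x\<in>S. dderiv b u differentiable (at x)"
    "continuous_on S (dderiv c (dderiv b u))" for b c
    unfolding dderiv_def[abs_def] by auto
  show "continuous_on S (dderiv c (dderiv b u))" by (rule *)
  show "z \<in> S \<Longrightarrow> (u has_derivative (\<lambda>v. Re v * dderiv 1 u z + Im v * dderiv \<i> u z)) (at z)"
    using has_derivative_complex_plane *(1) by (simp only: dderiv_def)
  show "z \<in> S \<Longrightarrow> (dderiv b u has_derivative
      (\<lambda>v. Re v * dderiv 1 (dderiv b u) z + Im v * dderiv \<i> (dderiv b u) z)) (at z)"
    using has_derivative_complex_plane[of "dderiv b u" z] *(2) by (simp only: dderiv_def)
qed

text \<open>Together with \<open>abs_exp_diff_le\<close> this bounds the Laplacian of u - v by a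
  multiple of |x|^\<nu> |u - v|, where \<nu> = \<tau> - 2. The bound C r^\<gamma> for the error
  makes it valid on the whole punctured ball.\<close>

lemma leading_asymptotics_bound:
  assumes "leading_asymptotics \<nu> a r u"
  shows "\<exists>M. \<forall>x\<in>ball 0 r - {0}. exp (u x) \<le> exp M * norm x powr \<nu>"
proof -
  obtain C \<gamma> where C: "C > 0" "\<gamma> > 0"
    "\<And>x. x \<in> ball 0 r - {0} \<Longrightarrow> \<bar>u x - \<nu> * ln (norm x) - a\<bar> \<le> C * norm x powr \<gamma>"
    using assms unfolding leading_asymptotics_def by blast
  have "exp (u x) \<le> exp (a + C * r powr \<gamma>) * norm x powr \<nu>" if x: "x \<in> ball 0 r - {0}" for x
  proof -
    have "C * norm x powr \<gamma> \<le> C * r powr \<gamma>" using C x by (intro mult_left_mono powr_mono2) auto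
    then have "u x \<le> (a + C * r powr \<gamma>) + \<nu> * ln (norm x)" using C(3)[OF x] by linarith
    then have "exp (u x) \<le> exp ((a + C * r powr \<gamma>) + \<nu> * ln (norm x))" by simp
    also have "\<dots> = exp (a + C * r powr \<gamma>) * norm x powr \<nu>"
      using x by (simp add: exp_add powr_def)
    finally show ?thesis .
  qed
  then show ?thesis by blast
qed

theorem singular_solution_unique:
  assumes nu: "\<nu> > -2"
    and u: "liouville_solution r1 u" "leading_asymptotics \<nu> a r1 u"
      "full_asymptotics \<nu> a (index_seq (\<nu> + 2)) P r1 u"
    and v: "liouville_solution r2 v" "leading_asymptotics \<nu> a r2 v"
      "full_asymptotics \<nu> a (index_seq (\<nu> + 2)) P r2 v"
    and x: "x \<in> ball 0 (min r1 r2) - {0}"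
  shows "u x = v x"
proof -
  define r where "r = min r1 r2"
  have sub: "z \<in> ball 0 r1 - {0}" "z \<in> ball 0 r2 - {0}" if "z \<in> ball 0 r - {0}" for z :: complex
    using that by (auto simp: r_def)
  obtain M1 where M1: "\<And>x. x \<in> ball 0 r1 - {0} \<Longrightarrow> exp (u x) \<le> exp M1 * norm x powr \<nu>"
    using leading_asymptotics_bound[OF u(2)] by blast
  obtain M2 where M2: "\<And>x. x \<in> ball 0 r2 - {0} \<Longrightarrow> exp (v x) \<le> exp M2 * norm x powr \<nu>"
    using leading_asymptotics_bound[OF v(2)] by blast
  define K where "K = exp (max M1 M2)"
  note C2u = smooth_on_imp_C2[of u "ball 0 r1 - {0}"]
    and C2v = smooth_on_imp_C2[of v "ball 0 r2 - {0}"]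
  have su: "smooth_on u (ball 0 r1 - {0})" and sv: "smooth_on v (ball 0 r2 - {0})"
    using u(1) v(1) by (auto simp: liouville_solution_def)
  have cont: "continuous_on (ball 0 r - {0}) (\<lambda>z. dderiv c (dderiv b u) z - dderiv c (dderiv b v) z)" for b c
    by (intro continuous_on_diff continuous_on_subset[OF C2u(3)[OF su], of "ball 0 r - {0}"]
        continuous_on_subset[OF C2v(3)[OF sv], of "ball 0 r - {0}"])
      (auto simp: r_def)
  have "u x - v x = 0"
  proof (rule strong_unique_continuation[where K = K and \<tau> = "\<nu> + 2" and r = r and z = x
      and p = "\<lambda>z. dderiv 1 u z - dderiv 1 v z" and q = "\<lambda>z. dderiv \<i> u z - dderiv \<i> v z"
      and px = "\<lambda>z. dderiv 1 (dderiv 1 u) z - dderiv 1 (dderiv 1 v) z" and py = "\<lambda>z. dderiv \<i> (dderiv 1 u) z - dderiv \<i> (dderiv 1 v) z"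
      and qx = "\<lambda>z. dderiv 1 (dderiv \<i> u) z - dderiv 1 (dderiv \<i> v) z" and qy = "\<lambda>z. dderiv \<i> (dderiv \<i> u) z - dderiv \<i> (dderiv \<i> v) z"])
    fix z :: complex assume z: "z \<in> ball 0 r - {0}"
    note z' = sub[OF z]
    show "((\<lambda>x. u x - v x) has_derivative (\<lambda>h. Re h * (dderiv 1 u z - dderiv 1 v z) + Im h * (dderiv \<i> u z - dderiv \<i> v z))) (at z)"
      by (rule has_derivative_eq_rhs[OF has_derivative_diff[OF C2u(1)[OF su z'(1)] C2v(1)[OF sv z'(2)]]])
        (auto simp: algebra_simps)
    show "((\<lambda>z. dderiv 1 u z - dderiv 1 v z) has_derivative (\<lambda>h. Re h * (dderiv 1 (dderiv 1 u) z - dderiv 1 (dderiv 1 v) z)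
        + Im h * (dderiv \<i> (dderiv 1 u) z - dderiv \<i> (dderiv 1 v) z))) (at z)"
      "((\<lambda>z. dderiv \<i> u z - dderiv \<i> v z) has_derivative (\<lambda>h. Re h * (dderiv 1 (dderiv \<i> u) z - dderiv 1 (dderiv \<i> v) z)
        + Im h * (dderiv \<i> (dderiv \<i> u) z - dderiv \<i> (dderiv \<i> v) z))) (at z)"
      by (rule has_derivative_eq_rhs[OF has_derivative_diff[OF C2u(2)[OF su z'(1)] C2v(2)[OF sv z'(2)]]],
          auto simp: algebra_simps)+
    have "dderiv 1 (dderiv 1 u) z - dderiv 1 (dderiv 1 v) z + (dderiv \<i> (dderiv \<i> u) z - dderiv \<i> (dderiv \<i> v) z) = laplacian u z - laplacian v z"
      by (simp add: laplacian_complex dderiv_def[abs_def])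
    also have "\<dots> = exp (v z) - exp (u z)"
    proof -
      have "laplacian u z + exp (u z) = 0" "laplacian v z + exp (v z) = 0"
        using u(1) v(1) z' unfolding liouville_solution_def by blast+
      then show ?thesis by linarith
    qed
    finally have "\<bar>dderiv 1 (dderiv 1 u) z - dderiv 1 (dderiv 1 v) z + (dderiv \<i> (dderiv \<i> u) z - dderiv \<i> (dderiv \<i> v) z)\<bar>
        \<le> exp (max (v z) (u z)) * \<bar>v z - u z\<bar>" using abs_exp_diff_le by simp
    also have "exp (max (v z) (u z)) \<le> K * norm z powr \<nu>"
    proof -
      have "exp M1 * norm z powr \<nu> \<le> K * norm z powr \<nu>" "exp M2 * norm z powr \<nu> \<le> K * norm z powr \<nu>"
        unfolding K_def by (intro mult_right_mono; simp)+
      then show ?thesis using M1[OF z'(1)] M2[OF z'(2)] by (auto simp: max_def)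
    qed
    finally show "\<bar>dderiv 1 (dderiv 1 u) z - dderiv 1 (dderiv 1 v) z + (dderiv \<i> (dderiv \<i> u) z - dderiv \<i> (dderiv \<i> v) z)\<bar>
        \<le> K * norm z powr (\<nu> + 2 - 2) * \<bar>u z - v z\<bar>"
      by (simp add: abs_minus_commute mult_right_mono)
  next
    fix N :: nat
    \<comment> \<open>The partial sums depend only on \<open>P\<close> and cancel in u - v. Since
      the exponents are unbounded, truncating late enough gives decay of order N.\<close>
    obtain l where l: "l \<ge> 1" "real N \<le> index_seq (\<nu> + 2) (Suc l)"
      using index_seq_unbounded[of "\<nu> + 2"] nu by auto
    obtain C1 where C1: "\<And>x. x \<in> ball 0 r1 - {0} \<Longrightarrow> \<bar>u x - \<nu> * ln (norm x) - a
        - (\<Sum>j=1..l. P j (Arg x) * norm x powr index_seq (\<nu> + 2) j)\<bar>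
        \<le> C1 * norm x powr index_seq (\<nu> + 2) (Suc l)"
      using u(3) l(1) unfolding full_asymptotics_def by blast
    obtain C2 where C2: "\<And>x. x \<in> ball 0 r2 - {0} \<Longrightarrow> \<bar>v x - \<nu> * ln (norm x) - a
        - (\<Sum>j=1..l. P j (Arg x) * norm x powr index_seq (\<nu> + 2) j)\<bar>
        \<le> C2 * norm x powr index_seq (\<nu> + 2) (Suc l)"
      using v(3) l(1) unfolding full_asymptotics_def by blast
    define m where "m = index_seq (\<nu> + 2) (Suc l)"
    have "\<bar>u z - v z\<bar> \<le> (\<bar>C1\<bar> + \<bar>C2\<bar>) * r powr (m - N) * norm z ^ N" if z: "z \<in> ball 0 r - {0}" for z
    proof -
      have "\<bar>u z - v z\<bar> \<le> C1 * norm z powr m + C2 * norm z powr m"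
        using C1[OF sub(1)[OF z]] C2[OF sub(2)[OF z]] unfolding m_def by linarith
      also have "\<dots> \<le> \<bar>C1\<bar> * norm z powr m + \<bar>C2\<bar> * norm z powr m"
        by (intro add_mono mult_right_mono) auto
      also have "\<dots> = (\<bar>C1\<bar> + \<bar>C2\<bar>) * (norm z powr (m - N) * norm z powr real N)"
        by (simp add: algebra_simps flip: powr_add)
      also have "\<dots> \<le> (\<bar>C1\<bar> + \<bar>C2\<bar>) * (r powr (m - N) * norm z powr real N)"
        using z l(2) by (intro mult_left_mono mult_right_mono powr_mono2) (auto simp: m_def)
      also have "norm z powr real N = norm z ^ N" using z by (simp add: powr_realpow)
      finally show ?thesis by (simp add: mult.assoc)
    qed
    then show "\<exists>C. \<forall>z\<in>ball 0 r - {0}. \<bar>u z - v z\<bar> \<le> C * norm z ^ N" by blast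
  qed (use x nu cont in \<open>auto simp: r_def[symmetric] K_def\<close>)
  then show ?thesis by simp
qed

section \<open>Smoothness\<close>

lemma Ck_on_cong:
  assumes "open S"
  shows "(\<And>z. z \<in> S \<Longrightarrow> f z = g z) \<Longrightarrow> Ck_on k f S \<Longrightarrow> Ck_on k g S"
proof (induction k arbitrary: f g)
  case 0
  then show ?case using continuous_on_cong by force
next
  case (Suc k)
  have g: "(g has_derivative frechet_derivative f (at z)) (at z)" if "z \<in> S" for z
  proof (rule has_derivative_transform_within_open[OF _ assms that])
    show "(f has_derivative frechet_derivative f (at z)) (at z)"
      using Suc.prems(2) that by (simp add: frechet_derivative_works)
  qed (rule Suc.prems(1))
  have "Ck_on k (\<lambda>z. frechet_derivative g (at z) v) S" for v
  proof (rule Suc.IH)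
    show "Ck_on k (\<lambda>z. frechet_derivative f (at z) v) S" using Suc.prems(2) by simp
    show "frechet_derivative f (at z) v = frechet_derivative g (at z) v" if "z \<in> S" for z
      using frechet_derivative_at[OF g[OF that]] by simp
  qed
  then show ?case using g unfolding Ck_on.simps differentiable_def by blast
qed

text \<open>A class of functions closed under directional derivatives, hence consisting of smooth
  functions; it contains every \<open>g - 2 ln (1 + e\<^sup>f)\<close> with \<open>f\<close>, \<open>g\<close> locally real parts of
  holomorphic functions.\<close>

inductive tame :: "complex set \<Rightarrow> (complex \<Rightarrow> real) \<Rightarrow> bool" for S where
  gradient: "\<lbrakk>G holomorphic_on S; \<And>z. z \<in> S \<Longrightarrow> (f has_derivative (\<lambda>v. Re (G z * v))) (at z)\<rbrakk> \<Longrightarrow> tame S f"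
| add: "\<lbrakk>tame S f; tame S g\<rbrakk> \<Longrightarrow> tame S (\<lambda>z. f z + g z)"
| mult: "\<lbrakk>tame S f; tame S g\<rbrakk> \<Longrightarrow> tame S (\<lambda>z. f z * g z)"
| softplus: "tame S f \<Longrightarrow> tame S (\<lambda>z. ln (1 + exp (f z)))"
| sigmoid: "tame S f \<Longrightarrow> tame S (\<lambda>z. 1 / (1 + exp (- f z)))"

lemma tame_const: "tame S (\<lambda>z. c)"
  by (rule gradient[of "\<lambda>z. 0"]) auto

lemma softplus_derivative:
  fixes f :: "'a::real_normed_vector \<Rightarrow> real"
  assumes "(f has_derivative D) (at z)"
  shows "((\<lambda>z. ln (1 + exp (f z))) has_derivative (\<lambda>v. (1 / (1 + exp (- f z))) * D v)) (at z)"
proof -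
  have "1 + exp (f z) > 0" by (simp add: add_pos_pos)
  then show ?thesis
    by (auto intro!: derivative_eq_intros assms simp: exp_minus field_simps)
qed

lemma sigmoid_derivative:
  fixes f :: "'a::real_normed_vector \<Rightarrow> real"
  assumes "(f has_derivative D) (at z)"
  defines "s \<equiv> \<lambda>z. 1 / (1 + exp (- f z))"
  shows "(s has_derivative (\<lambda>v. s z * (1 - s z) * D v)) (at z)"
proof -
  have "1 + exp (- f z) > 0" by (simp add: add_pos_pos)
  then show ?thesis unfolding s_def
    by (auto intro!: derivative_eq_intros assms simp: field_simps power2_eq_square)
qed

lemma tame_derivative:
  assumes "open S" "tame S f"
  shows "\<exists>D. (\<forall>z\<in>S. (f has_derivative D z) (at z)) \<and> (\<forall>v. tame S (\<lambda>z. D z v))"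
  using assms(2)
proof induction
  case (gradient G f)
  have "tame S (\<lambda>z. Re (G z * v))" for v
  proof (rule tame.gradient[of "\<lambda>z. v * deriv G z"])
    show "(\<lambda>z. v * deriv G z) holomorphic_on S"
      by (intro holomorphic_intros gradient assms)
    fix z assume "z \<in> S"
    then have "(G has_field_derivative deriv G z) (at z)"
      using gradient(1) assms(1) holomorphic_derivI by blast
    then have "((\<lambda>z. G z * v) has_derivative (\<lambda>h. v * deriv G z * h)) (at z)"
      unfolding has_field_derivative_def
      by (rule has_derivative_eq_rhs[OF has_derivative_mult_left]) (auto simp: mult_ac)
    then show "((\<lambda>z. Re (G z * v)) has_derivative (\<lambda>h. Re (v * deriv G z * h))) (at z)"
      by (rule bounded_linear.has_derivative[OF bounded_linear_Re])
  qed
  then show ?case using gradient(2) by (intro exI[of _ "\<lambda>z v. Re (G z * v)"]) blast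
next
  case (add f g)
  then obtain D E where "\<forall>z\<in>S. (f has_derivative D z) (at z)" "\<forall>v. tame S (\<lambda>z. D z v)"
    "\<forall>z\<in>S. (g has_derivative E z) (at z)" "\<forall>v. tame S (\<lambda>z. E z v)" by blast
  moreover from this have "tame S (\<lambda>z. D z v + E z v)" for v
    by (intro tame.add) auto
  ultimately show ?case
    by (intro exI[of _ "\<lambda>z v. D z v + E z v"]) (auto intro: has_derivative_add)
next
  case (mult f g)
  then obtain D E where "\<forall>z\<in>S. (f has_derivative D z) (at z)" "\<forall>v. tame S (\<lambda>z. D z v)"
    "\<forall>z\<in>S. (g has_derivative E z) (at z)" "\<forall>v. tame S (\<lambda>z. E z v)" by blast
  moreover from this mult.hyps have "tame S (\<lambda>z. f z * E z v + D z v * g z)" for v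
    by (intro tame.add tame.mult) auto
  ultimately show ?case
    by (intro exI[of _ "\<lambda>z v. f z * E z v + D z v * g z"]) (auto intro: has_derivative_mult)
next
  case (softplus f)
  then obtain D where "\<forall>z\<in>S. (f has_derivative D z) (at z)" "\<forall>v. tame S (\<lambda>z. D z v)" by blast
  moreover from this softplus.hyps have "tame S (\<lambda>z. 1 / (1 + exp (- f z)) * D z v)" for v
    by (intro tame.mult tame.sigmoid) auto
  ultimately show ?case
    by (intro exI[of _ "\<lambda>z v. 1 / (1 + exp (- f z)) * D z v"]) (blast intro: softplus_derivative)
next
  case (sigmoid f)
  then obtain D where D: "\<forall>z\<in>S. (f has_derivative D z) (at z)" "\<forall>v. tame S (\<lambda>z. D z v)" by blast
  define s where "s = (\<lambda>z. 1 / (1 + exp (- f z)))"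
  have s: "tame S s" unfolding s_def by (rule tame.sigmoid) (rule sigmoid.hyps)
  \<comment> \<open>The class is generated with sums and products, so 1 - s is written as a
    sum.\<close>
  have "tame S (\<lambda>z. s z * (1 + (- 1) * s z) * D z v)" for v
    using D by (intro tame.mult tame.add tame_const s) auto
  then have "tame S (\<lambda>z. s z * (1 - s z) * D z v)" for v by simp
  moreover have "(s has_derivative (\<lambda>v. s z * (1 - s z) * D z v)) (at z)" if "z \<in> S" for z
    unfolding s_def by (rule sigmoid_derivative) (use D that in blast)
  ultimately show ?case
    unfolding s_def[symmetric] by (intro exI[of _ "\<lambda>z v. s z * (1 - s z) * D z v"]) blast
qed

lemma tame_imp_smooth_on:
  assumes "open S" "tame S f"
  shows "smooth_on f S"
proof -
  have "Ck_on k f S" for k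
    using assms(2)
  proof (induction k arbitrary: f)
    case 0
    then show ?case
      using tame_derivative[OF assms(1), of f]
      by (auto intro!: continuous_at_imp_continuous_on dest: has_derivative_continuous)
  next
    case (Suc k)
    obtain D where D: "\<And>z. z \<in> S \<Longrightarrow> (f has_derivative D z) (at z)" "\<And>v. tame S (\<lambda>z. D z v)"
      using tame_derivative[OF assms(1) Suc.prems] by blast
    have "D z = frechet_derivative f (at z)" if "z \<in> S" for z
      using D(1)[OF that] frechet_derivative_at by blast
    then have "Ck_on k (\<lambda>z. frechet_derivative f (at z) v) S" for v
      by (intro Ck_on_cong[OF assms(1) _ Suc.IH[OF D(2)[of v]]]) auto
    then show ?case using D(1) by (auto simp: differentiable_def)
  qed
  then show ?thesis by (simp add: smooth_on_def)
qed

text \<open>Functions with gradient Re (G v) are harmonic: over the directions 1 and i the terms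
  with b^2 cancel, and only the derivative s (1 - s) of the sigmoid times |F|^2 survives.
  Prescribing gradients admits \<tau> ln |z|, which is only locally the real part of a holomorphic
  function.\<close>

lemma laplacian_softplus:
  fixes f g :: "complex \<Rightarrow> real"
  assumes S: "open S" and G: "G holomorphic_on S" "F holomorphic_on S"
    and g: "\<And>z. z \<in> S \<Longrightarrow> (g has_derivative (\<lambda>v. Re (G z * v))) (at z)"
    and f: "\<And>z. z \<in> S \<Longrightarrow> (f has_derivative (\<lambda>v. Re (F z * v))) (at z)"
    and z: "z \<in> S"
  defines "u \<equiv> \<lambda>z. g z - 2 * ln (1 + exp (f z))"
  shows "smooth_on u S"
    and "laplacian u z = - 2 * exp (f z) * (norm (F z))^2 / (1 + exp (f z))^2"
proof -
  have tg: "tame S g" by (rule tame.gradient[OF G(1)]) (rule g)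
  have tf: "tame S f" by (rule tame.gradient[OF G(2)]) (rule f)
  have "u = (\<lambda>z. g z + (- 2) * ln (1 + exp (f z)))" by (simp add: u_def)
  then show "smooth_on u S"
    using tame_imp_smooth_on[OF S tame.add[OF tg tame.mult[OF tame_const[of S "- 2"] tame.softplus[OF tf]]]]
    by simp
  define s where "s = (\<lambda>z. 1 / (1 + exp (- f z)))"
  have fr: "frechet_derivative u (at y) v = Re (G y * v) - 2 * (s y * Re (F y * v))" if "y \<in> S" for y v
  proof -
    have "(u has_derivative (\<lambda>v. Re (G y * v) - 2 * (s y * Re (F y * v)))) (at y)"
      unfolding u_def s_def
      by (intro has_derivative_diff g[OF that] has_derivative_mult_right softplus_derivative f[OF that])
    from frechet_derivative_at[OF this, symmetric] show ?thesis by simp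
  qed
  have sd: "(s has_derivative (\<lambda>v. s z * (1 - s z) * Re (F z * v))) (at z)"
    unfolding s_def by (rule sigmoid_derivative) (rule f[OF z])
  have d2: "frechet_derivative (\<lambda>y. frechet_derivative u (at y) b) (at z) b
     = Re (deriv G z * b * b) - 2 * (s z * (1 - s z) * (Re (F z * b))^2 + s z * Re (deriv F z * b * b))" for b
  proof -
    have h: "((\<lambda>z. Re (H z * b)) has_derivative (\<lambda>v. Re (deriv H z * v * b))) (at z)"
      if "H holomorphic_on S" for H
    proof -
      have "(H has_derivative (\<lambda>v. deriv H z * v)) (at z)"
        using holomorphic_derivI[OF that S z] by (simp add: has_field_derivative_def)
      then show ?thesis
        by (intro bounded_linear.has_derivative[OF bounded_linear_Re] has_derivative_mult_left)
    qed
    have "((\<lambda>y. Re (G y * b) - 2 * (s y * Re (F y * b))) has_derivative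
       (\<lambda>v. Re (deriv G z * v * b) - 2 * (s z * Re (deriv F z * v * b)
          + (s z * (1 - s z) * Re (F z * v)) * Re (F z * b)))) (at z)"
      by (rule has_derivative_diff[OF h[OF G(1)] has_derivative_mult_right[OF
            has_derivative_mult[OF sd h[OF G(2)]]]])
    then have "((\<lambda>y. frechet_derivative u (at y) b) has_derivative
       (\<lambda>v. Re (deriv G z * v * b) - 2 * (s z * Re (deriv F z * v * b)
          + (s z * (1 - s z) * Re (F z * v)) * Re (F z * b)))) (at z)"
      by (rule has_derivative_transform_within_open[OF _ S z]) (simp add: fr)
    from frechet_derivative_at[OF this, symmetric] show ?thesis
      by (simp add: power2_eq_square mult_ac)
  qed
  have pos: "1 + exp (f z) > 0" by (simp add: add_pos_pos)
  have "laplacian u z = - 2 * (s z * (1 - s z) * ((Re (F z))^2 + (Im (F z))^2))"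
    unfolding laplacian_complex d2 by (simp add: algebra_simps)
  also have "s z * (1 - s z) = exp (f z) / (1 + exp (f z))^2"
  proof -
    have "s z = exp (f z) / (1 + exp (f z))" "1 - s z = 1 / (1 + exp (f z))"
      using pos by (simp_all add: s_def exp_minus field_simps)
    then show ?thesis by (simp only: power2_eq_square times_divide_times_eq mult_1_right)
  qed
  also have "(Re (F z))^2 + (Im (F z))^2 = (norm (F z))^2" by (simp only: cmod_power2)
  also have "- 2 * (exp (f z) / (1 + exp (f z))^2 * (norm (F z))^2)
      = - 2 * exp (f z) * (norm (F z))^2 / (1 + exp (f z))^2"
    by (simp only: times_divide_eq_right times_divide_eq_left mult.assoc)
  finally show "laplacian u z = - 2 * exp (f z) * (norm (F z))^2 / (1 + exp (f z))^2" .
qed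

section \<open>The equation on the circle\<close>

abbreviation trig_sum :: "'q set \<Rightarrow> ('q \<Rightarrow> real) \<Rightarrow> ('q \<Rightarrow> real) \<Rightarrow> ('q \<Rightarrow> real) \<Rightarrow> real \<Rightarrow> real" where
  "trig_sum A n \<alpha> \<beta> \<equiv> \<lambda>x. \<Sum>q\<in>A. \<alpha> q * cos (n q * x) + \<beta> q * sin (n q * x)"

lemma trig_sum_has_derivative:
  "((trig_sum A n \<alpha> \<beta>) has_real_derivative
    trig_sum A n (\<lambda>q. n q * \<beta> q) (\<lambda>q. - n q * \<alpha> q) x) (at x)"
proof (rule DERIV_sum)
  show "((\<lambda>x. \<alpha> q * cos (n q * x) + \<beta> q * sin (n q * x)) has_real_derivative
    (n q * \<beta> q) * cos (n q * x) + (- n q * \<alpha> q) * sin (n q * x)) (at x)" for q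
    by (auto intro!: derivative_eq_intros simp: algebra_simps)
qed

lemma smooth_on_trig_sum:
  fixes n \<alpha> \<beta> :: "'q \<Rightarrow> real"
  shows "smooth_on (trig_sum A n \<alpha> \<beta>) UNIV"
proof -
  have "Ck_on k (trig_sum A n \<alpha> \<beta>) UNIV" for k
  proof (induction k arbitrary: \<alpha> \<beta>)
    case 0
    then show ?case by (auto intro!: continuous_intros)
  next
    case (Suc k)
    let ?f = "trig_sum A n \<alpha> \<beta>"
    let ?f' = "trig_sum A n (\<lambda>q. n q * \<beta> q) (\<lambda>q. - n q * \<alpha> q)"
    have d: "(?f has_derivative (\<lambda>v. ?f' x * v)) (at x)" for x
      using trig_sum_has_derivative unfolding has_field_derivative_def by blast
    have fr: "frechet_derivative ?f (at x) v = ?f' x * v" for x v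
      using frechet_derivative_at[OF d] by metis
    have "?f' x * v = (\<Sum>q\<in>A. (v * (n q * \<beta> q)) * cos (n q * x) + (v * (- n q * \<alpha> q)) * sin (n q * x))" for x v
      by (simp add: sum_distrib_left sum_distrib_right algebra_simps)
    then have "Ck_on k (\<lambda>x. ?f' x * v) UNIV" for v
      using Suc.IH[of "\<lambda>q. v * (n q * \<beta> q)" "\<lambda>q. v * (- n q * \<alpha> q)"] by simp
    moreover have "\<forall>x. ?f differentiable (at x)" using d unfolding differentiable_def by blast
    ultimately show ?case unfolding Ck_on.simps fr by blast
  qed
  then show ?thesis by (simp add: smooth_on_def)
qed

lemma circle_solution_trig_sum:
  fixes n \<alpha> \<beta> :: "'q \<Rightarrow> real"
  assumes n: "\<And>q. q \<in> A \<Longrightarrow> n q \<in> \<int>"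
    and F: "\<And>x. F x = (\<Sum>q\<in>A. (\<mu>^2 - (n q)^2) * (\<alpha> q * cos (n q * x) + \<beta> q * sin (n q * x)))"
  shows "circle_solution \<mu> F (trig_sum A n \<alpha> \<beta>)" (is "circle_solution \<mu> F ?Q")
  unfolding circle_solution_def
proof (intro conjI allI)
  show "smooth_on ?Q UNIV" by (rule smooth_on_trig_sum)
  fix x
  show "?Q (x + 2 * pi) = ?Q x"
  proof (rule sum.cong[OF refl])
    fix q assume "q \<in> A"
    then obtain m where m: "n q = of_int m" using n by (auto elim: Ints_cases)
    have "sin (2 * pi * of_int m) = 0" "cos (2 * pi * of_int m) = 1"
      by (simp_all add: sin_int_2pin cos_int_2pin)
    then show "\<alpha> q * cos (n q * (x + 2 * pi)) + \<beta> q * sin (n q * (x + 2 * pi))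
        = \<alpha> q * cos (n q * x) + \<beta> q * sin (n q * x)"
      by (simp add: m algebra_simps cos_add sin_add)
  qed
  have "deriv ?Q = (trig_sum A n (\<lambda>q. n q * \<beta> q) (\<lambda>q. - n q * \<alpha> q))"
    using trig_sum_has_derivative by (intro ext DERIV_imp_deriv)
  moreover have "deriv (trig_sum A n (\<lambda>q. n q * \<beta> q) (\<lambda>q. - n q * \<alpha> q)) x
     = (\<Sum>q\<in>A. (n q * (- n q * \<alpha> q)) * cos (n q * x) + (- n q * (n q * \<beta> q)) * sin (n q * x))"
    using trig_sum_has_derivative by (intro DERIV_imp_deriv)
  ultimately have "deriv (deriv ?Q) x
     = (\<Sum>q\<in>A. (n q * (- n q * \<alpha> q)) * cos (n q * x) + (- n q * (n q * \<beta> q)) * sin (n q * x))"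
    by simp
  then show "deriv (deriv ?Q) x + \<mu>^2 * ?Q x = F x"
    by (simp add: F sum_distrib_left sum.distrib[symmetric] algebra_simps power2_eq_square)
qed

section \<open>Uniqueness of periodic solutions\<close>

lemma circle_solution_DERIV:
  assumes "circle_solution \<mu> F Q"
  shows "(Q has_real_derivative deriv Q x) (at x)"
    and "(deriv Q has_real_derivative F x - \<mu>^2 * Q x) (at x)"
proof -
  have "Ck_on (Suc (Suc 0)) Q UNIV" using assms by (auto simp: circle_solution_def smooth_on_def)
  then have 1: "\<forall>x. Q differentiable (at x)" "\<forall>x. (\<lambda>x. frechet_derivative Q (at x) 1) differentiable (at x)"
    by auto
  then have d: "(Q has_real_derivative deriv Q x) (at x)" for x
    using DERIV_deriv_iff_real_differentiable by blast
  then show "(Q has_real_derivative deriv Q x) (at x)" .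
  have "frechet_derivative Q (at x) 1 = deriv Q x" for x
    using frechet_derivative_at[OF d[of x, unfolded has_field_derivative_def]] by (metis mult.right_neutral)
  then have "deriv Q differentiable (at x)" using 1(2) by simp
  then have "(deriv Q has_real_derivative deriv (deriv Q) x) (at x)"
    using DERIV_deriv_iff_real_differentiable by blast
  moreover have "deriv (deriv Q) x = F x - \<mu>^2 * Q x"
    using assms by (simp add: circle_solution_def eq_diff_eq)
  ultimately show "(deriv Q has_real_derivative F x - \<mu>^2 * Q x) (at x)" by simp
qed

lemma circle_solution_diff:
  assumes Q: "circle_solution \<mu> F Q1" "circle_solution \<mu> F Q2" and mu: "\<mu> \<noteq> 0"
  obtains \<alpha> \<beta> where "\<And>x. Q1 x - Q2 x = \<alpha> * cos (\<mu> * x) + \<beta> * sin (\<mu> * x)"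
proof -
  define D D' where "D x = Q1 x - Q2 x" and "D' x = deriv Q1 x - deriv Q2 x" for x
  have D: "(D has_real_derivative D' x) (at x)" for x
    unfolding D_def[abs_def] D'_def by (intro DERIV_diff circle_solution_DERIV(1)[OF Q(1)] circle_solution_DERIV(1)[OF Q(2)])
  have D': "(D' has_real_derivative - (\<mu>^2 * D x)) (at x)" for x
    unfolding D'_def[abs_def] D_def
    by (rule DERIV_cong[OF DERIV_diff[OF circle_solution_DERIV(2)[OF Q(1)] circle_solution_DERIV(2)[OF Q(2)]]])
      (simp add: algebra_simps)
  \<comment> \<open>The two first integrals of D'' = -\<mu>^2 D. They are constant, and
    \<open>D\<close> is recovered from them by cos^2 + sin^2 = 1.\<close>
  define a b where "a x = D x * cos (\<mu> * x) - D' x * sin (\<mu> * x) / \<mu>"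
    and "b x = D x * sin (\<mu> * x) + D' x * cos (\<mu> * x) / \<mu>" for x
  have "(a has_real_derivative 0) (at x)" "(b has_real_derivative 0) (at x)" for x
    unfolding a_def[abs_def] b_def[abs_def] using mu
    by (auto intro!: derivative_eq_intros D D' simp: field_simps power2_eq_square)
  then have ab: "a x = a 0" "b x = b 0" for x using DERIV_isconst_all by blast+
  have "D x = a 0 * cos (\<mu> * x) + b 0 * sin (\<mu> * x)" for x
  proof -
    have "a x * cos (\<mu> * x) + b x * sin (\<mu> * x)
        = D x * (cos (\<mu> * x) * cos (\<mu> * x) + sin (\<mu> * x) * sin (\<mu> * x))"
      unfolding a_def b_def by (simp add: algebra_simps del: sin_cos_squared_add3)
    also have "\<dots> = D x" by (simp only: sin_cos_squared_add3 mult_1_right)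
    finally show ?thesis unfolding ab(1)[of x] ab(2)[of x] by (rule sym)
  qed
  then show ?thesis using that unfolding D_def by blast
qed

text \<open>Translation by 2 pi rotates the pair (\<alpha>, \<beta>) of the difference by the angle
  2 pi \<mu>, as seen at x = 0 and x = pi / (2\<mu>). For nonintegral \<mu> this rotation fixes only
  the zero vector.\<close>

lemma circle_solution_unique_nonint:
  assumes Q: "circle_solution \<mu> F Q1" "circle_solution \<mu> F Q2" and mu: "\<mu> \<notin> \<int>"
  shows "Q1 = Q2"
proof -
  have "\<mu> \<noteq> 0" using mu by auto
  then obtain \<alpha> \<beta> where ab: "\<And>x. Q1 x - Q2 x = \<alpha> * cos (\<mu> * x) + \<beta> * sin (\<mu> * x)"
    using circle_solution_diff[OF Q] by blast
  have per: "Q1 (x + 2 * pi) - Q2 (x + 2 * pi) = Q1 x - Q2 x" for x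
    using Q by (simp add: circle_solution_def)
  define c s where "c = cos (\<mu> * (2 * pi))" and "s = sin (\<mu> * (2 * pi))"
  have 1: "\<alpha> * c + \<beta> * s = \<alpha>" using per[of 0] unfolding ab c_def s_def by simp
  have "\<mu> * (pi / (2 * \<mu>) + 2 * pi) = pi / 2 + \<mu> * (2 * pi)" "\<mu> * (pi / (2 * \<mu>)) = pi / 2"
    using \<open>\<mu> \<noteq> 0\<close> by (simp_all add: field_simps)
  then have 2: "- \<alpha> * s + \<beta> * c = \<beta>"
    using per[of "pi / (2 * \<mu>)"] unfolding ab c_def s_def by (simp only: cos_add sin_add) simp
  have "c \<noteq> 1"
  proof
    assume "c = 1"
    then obtain m where "\<mu> * (2 * pi) = of_int m * 2 * pi" unfolding c_def cos_one_2pi_int by blast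
    then have "\<mu> = of_int m" by simp
    then show False using mu by auto
  qed
  have "(1 - c) * (\<alpha>^2 + \<beta>^2) = \<alpha> * (\<alpha> - \<alpha> * c - \<beta> * s) + \<beta> * (\<beta> - (- \<alpha> * s + \<beta> * c))"
    by (simp add: algebra_simps power2_eq_square)
  also have "\<dots> = 0" using 1 2 by simp
  finally have "\<alpha> = 0 \<and> \<beta> = 0" using \<open>c \<noteq> 1\<close> by (simp add: sum_power2_eq_zero_iff)
  then show ?thesis using ab by (intro ext) simp
qed

text \<open>The difference lies in the harmonics of degree i and is orthogonal to them, hence to
  itself.\<close>

lemma circle_solution_unique_int:
  assumes Q: "circle_solution (real i) F Q1" "circle_solution (real i) F Q2" and i: "i \<ge> 1"
    and orth: "circle_orthogonal Q1 (spherical_harmonics i)" "circle_orthogonal Q2 (spherical_harmonics i)"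
  shows "Q1 = Q2"
proof -
  have i0: "real i \<noteq> 0" using i by simp
  then obtain \<alpha> \<beta> where ab: "\<And>x. Q1 x - Q2 x = \<alpha> * cos (real i * x) + \<beta> * sin (real i * x)"
    using circle_solution_diff[OF Q] by blast
  define Y where "Y x = \<alpha> * cos (real i * x) + \<beta> * sin (real i * x)" for x
  have Y: "Y \<in> spherical_harmonics i" by (auto simp: spherical_harmonics_def Y_def[abs_def])
  have cont: "continuous_on {0..2*pi} Q1" "continuous_on {0..2*pi} Q2" "continuous_on {0..2*pi} Y"
    unfolding Y_def
    by (intro continuous_at_imp_continuous_on ballI DERIV_isCont[OF circle_solution_DERIV(1)[OF Q(1)]]
        DERIV_isCont[OF circle_solution_DERIV(1)[OF Q(2)]] continuous_intros)+
  have "integral {0..2*pi} (\<lambda>x. Y x * Y x) = integral {0..2*pi} (\<lambda>x. Q1 x * Y x - Q2 x * Y x)"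
    by (intro integral_cong) (simp add: ab Y_def flip: left_diff_distrib)
  also have "\<dots> = 0"
    using orth Y cont
    by (subst integral_diff)
      (auto simp: circle_orthogonal_def intro!: integrable_continuous_interval continuous_intros)
  finally have "((\<lambda>x. Y x * Y x) has_integral 0) (cbox 0 (2 * pi))"
    using cont by (auto simp: has_integral_iff intro!: integrable_continuous_interval continuous_intros)
  moreover have "box 0 (2*pi) \<noteq> {}" using pi_gt_zero by (simp add: not_le)
  moreover have "continuous_on (cbox 0 (2*pi)) (\<lambda>x. Y x * Y x)" using cont by (auto intro!: continuous_intros)
  ultimately have Y0: "Y x * Y x = 0" if "x \<in> cbox 0 (2*pi)" for x
    using that by (intro has_integral_0_cbox_imp_0[of 0 "2*pi" "\<lambda>x. Y x * Y x" x]) auto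
  have "\<alpha> = 0" using Y0[of 0] by (simp add: Y_def)
  moreover have "\<beta> = 0"
  proof -
    have "pi / (2 * real i) \<in> cbox 0 (2*pi)" using i by (simp add: divide_le_eq)
    moreover have "real i * (pi / (2 * real i)) = pi / 2" using i0 by simp
    moreover from this i have "Y (pi / (2 * real i)) = \<beta>" by (auto simp: Y_def)
    ultimately show ?thesis using Y0 by fastforce
  qed
  ultimately show ?thesis using ab by (intro ext) simp
qed

text \<open>Eigenfunctions for different eigenvalues: the Wronskian y Y' - y' Y is periodic and has
  derivative (n^2 - i^2) y Y.\<close>

lemma circle_orthogonal_trig_sum:
  fixes n :: "'q \<Rightarrow> int" and \<alpha> \<beta> :: "'q \<Rightarrow> real"
  assumes "finite A" and n: "\<And>q. q \<in> A \<Longrightarrow> \<bar>n q\<bar> \<noteq> int i"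
  shows "circle_orthogonal (trig_sum A n \<alpha> \<beta>) (spherical_harmonics i)"
  unfolding circle_orthogonal_def
proof
  fix Y assume "Y \<in> spherical_harmonics i"
  then obtain a b where Y: "Y = (\<lambda>x. a * cos (real i * x) + b * sin (real i * x))"
    by (auto simp: spherical_harmonics_def)
  define y where "y q x = \<alpha> q * cos (n q * x) + \<beta> q * sin (n q * x)" for q and x :: real
  have 0: "((\<lambda>x. y q x * Y x) has_integral 0) {0..2*pi}" if q: "q \<in> A" for q
  proof -
    define y' where "y' x = n q * (\<beta> q * cos (n q * x) - \<alpha> q * sin (n q * x))" for x :: real
    define Y' where "Y' x = real i * (b * cos (real i * x) - a * sin (real i * x))" for x :: real
    have dy: "(y q has_real_derivative y' x) (at x)" "(y' has_real_derivative - ((n q)^2 * y q x)) (at x)" 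
      "(Y has_real_derivative Y' x) (at x)" "(Y' has_real_derivative - ((real i)^2 * Y x)) (at x)" for x
      unfolding y_def[abs_def] y'_def[abs_def] Y Y'_def[abs_def]
      by (auto intro!: derivative_eq_intros simp: algebra_simps power2_eq_square)
    have per: "cos (n q * (2 * pi)) = 1" "sin (n q * (2 * pi)) = 0"
      "cos (real i * (2 * pi)) = 1" "sin (real i * (2 * pi)) = 0"
      using cos_int_2pin[of "n q"] sin_int_2pin[of "n q"] cos_int_2pin[of "int i"] sin_int_2pin[of "int i"]
      by (simp_all add: mult_ac)
    define d where "d = (real_of_int (n q))^2 - (real i)^2"
    have int: "((\<lambda>x. d * (y q x * Y x)) has_integral 0) {0..2*pi}"
    proof (rule integral_periodic_derivative[where f = "\<lambda>x. y q x * Y' x - y' x * Y x"])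
      show "((\<lambda>x. y q x * Y' x - y' x * Y x) has_real_derivative
          d * (y q x * Y x)) (at x)" for x
        by (rule DERIV_cong[OF DERIV_diff[OF DERIV_mult[OF dy(1) dy(4)] DERIV_mult[OF dy(2) dy(3)]]])
          (simp add: d_def algebra_simps)
    qed (simp_all add: y_def y'_def Y Y'_def per)
    have "d \<noteq> 0"
    proof
      assume "d = 0"
      then have "\<bar>real_of_int (n q)\<bar> = real i" by (simp add: d_def power2_eq_iff abs_if) auto
      then show False using n[OF q] by linarith
    qed
    then show ?thesis using has_integral_mult_right[OF int, of "1 / d"] by simp
  qed
  have "((\<lambda>x. \<Sum>q\<in>A. y q x * Y x) has_integral (\<Sum>q\<in>A. 0)) {0..2*pi}"
    by (intro has_integral_sum assms 0)
  then show "integral {0..2*pi} (\<lambda>x. (\<Sum>q\<in>A. \<alpha> q * cos (n q * x) + \<beta> q * sin (n q * x)) * Y x) = 0"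
    by (intro integral_unique) (simp add: y_def sum_distrib_right)
qed

section \<open>The index set\<close>

text \<open>All generators other than \<tau> are multiples of the generator 1, so two multiplicities
  are enough.\<close>

lemma index_set_iff:
  assumes "\<tau> > 0"
  shows "s \<in> index_set \<tau> \<longleftrightarrow> 0 < s \<and> (\<exists>p n. s = real p * \<tau> + real n)"
proof safe
  assume s: "s \<in> index_set \<tau>"
  then show "0 < s" by (rule index_set_pos[OF assms])
  obtain m :: "nat \<Rightarrow> nat" where m: "finite {i. m i > 0}"
    "s = (\<Sum>i\<in>{i. m i > 0}. real (m i) * rho \<tau> i)"
    using s by (auto simp: index_set_def)
  define A where "A = insert 0 {i. m i > 0}"
  have A: "finite A" "0 \<in> A" using m(1) by (auto simp: A_def)
  have "s = (\<Sum>i\<in>A. real (m i) * rho \<tau> i)"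
    unfolding m(2) by (rule sum.mono_neutral_left) (use m(1) in \<open>auto simp: A_def\<close>)
  also have "\<dots> = real (m 0) * \<tau> + (\<Sum>i\<in>A - {0}. real (m i) * rho \<tau> i)"
    using A by (simp add: sum.remove rho_def)
  also have "(\<Sum>i\<in>A - {0}. real (m i) * rho \<tau> i) = real (\<Sum>i\<in>A - {0}. m i * i)"
    unfolding of_nat_sum by (rule sum.cong) (auto simp: rho_def)
  finally show "\<exists>p n. s = real p * \<tau> + real n" by blast
next
  fix p n :: nat assume pos: "0 < real p * \<tau> + real n"
  define m where "m i = (if i = 0 then p else if i = 1 then n else 0)" for i :: nat
  have sub: "{i. m i > 0} \<subseteq> {0, 1}" by (auto simp: m_def split: if_splits)
  have "(\<Sum>i\<in>{i. m i > 0}. real (m i) * rho \<tau> i) = (\<Sum>i\<in>{0, 1}. real (m i) * rho \<tau> i)"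
    by (rule sum.mono_neutral_left) (use sub in auto)
  also have "\<dots> = real p * \<tau> + real n" by (simp add: m_def rho_def)
  finally have "real p * \<tau> + real n = (\<Sum>i\<in>{i. m i > 0}. real (m i) * rho \<tau> i)" by simp
  moreover have "\<exists>i. m i > 0" using pos by (cases "p = 0") (auto simp: m_def intro: exI[of _ 0] exI[of _ 1])
  moreover have "finite {i. m i > 0}" using sub finite_subset by blast
  ultimately show "real p * \<tau> + real n \<in> index_set \<tau>" unfolding index_set_def by blast
qed

lemma index_seq_in:
  assumes "\<tau> > 0" "l \<ge> 1"
  shows "index_seq \<tau> l \<in> index_set \<tau>"
  using index_seq_image[OF assms(1)] assms(2) by auto

lemma index_seq_pos: "\<tau> > 0 \<Longrightarrow> l \<ge> 1 \<Longrightarrow> 0 < index_seq \<tau> l"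
  using index_seq_in index_set_pos by blast

lemma index_seq_less_iff: "\<tau> > 0 \<Longrightarrow> index_seq \<tau> l < index_seq \<tau> m \<longleftrightarrow> l < m"
  using strict_mono_index_seq strict_mono_less by blast

lemma index_seq_eq_iff: "\<tau> > 0 \<Longrightarrow> index_seq \<tau> l = index_seq \<tau> m \<longleftrightarrow> l = m"
  using strict_mono_index_seq strict_mono_eq by blast

lemma index_seq_less_tau:
  assumes "\<tau> > 0" "index_seq \<tau> l < \<tau>"
  shows "index_seq \<tau> l = real l"
  using assms(2)
proof (induction l)
  case (Suc l)
  have less: "index_seq \<tau> l < index_seq \<tau> (Suc l)" using index_seq_Suc(2)[OF assms(1)] .
  then have l: "index_seq \<tau> l = real l" using Suc by simp
  have "index_seq \<tau> (Suc l) \<le> real (Suc l)"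
    by (rule index_seq_Suc(3)[OF assms(1) of_nat_in_index_set]) (use l in auto)
  moreover obtain p n where "index_seq \<tau> (Suc l) = real p * \<tau> + real n"
    using index_seq_Suc(1)[OF assms(1), of l] index_set_iff[OF assms(1)] by blast
  moreover from this have "p = 0"
  proof (rule_tac ccontr)
    assume "p \<noteq> 0"
    then have "1 * \<tau> \<le> real p * \<tau>" using assms(1) by (intro mult_right_mono) auto
    then show False using Suc.prems \<open>index_seq \<tau> (Suc l) = real p * \<tau> + real n\<close> by simp
  qed
  ultimately show ?case using less l by simp
qed simp

text \<open>Multiples of the smallest exponent are exponents again. Hence a j-th power with j > m
  has order above the m-th exponent, which is why the sum over j in the recursion can stop at
  m.\<close>

lemma index_seq_le_mult:
  assumes "\<tau> > 0"
  shows "index_seq \<tau> m \<le> real m * index_seq \<tau> 1"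
proof (induction m)
  case (Suc m)
  have pos: "0 < index_seq \<tau> 1" by (rule index_seq_pos[OF assms order.refl])
  show ?case
  proof (rule index_seq_Suc(3)[OF assms])
    show "index_seq \<tau> m < real (Suc m) * index_seq \<tau> 1"
      using Suc pos by (simp add: algebra_simps del: index_seq.simps)
    obtain p n where "index_seq \<tau> 1 = real p * \<tau> + real n"
      using index_seq_in[OF assms, of 1] index_set_iff[OF assms] by blast
    then have "real (Suc m) * index_seq \<tau> 1 = real (Suc m * p) * \<tau> + real (Suc m * n)"
      by (simp add: algebra_simps)
    moreover have "0 < real (Suc m) * index_seq \<tau> 1" using pos by simp
    ultimately show "real (Suc m) * index_seq \<tau> 1 \<in> index_set \<tau>"
      unfolding index_set_iff[OF assms] by blast
  qed
qed simp

section \<open>Comparison of coefficients\<close>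

text \<open>Terms with equal exponents are grouped. If a total coefficient below E were nonzero,
  dividing by the power of the smallest such exponent and letting t tend to 0 would give both that
  coefficient and 0 as limit.\<close>

lemma powr_sum_coeff_eq_0:
  fixes c e :: "'q \<Rightarrow> real"
  assumes fin: "finite A" and \<rho>: "0 < \<rho>"
    and bound: "\<And>t. 0 < t \<Longrightarrow> t \<le> \<rho> \<Longrightarrow> \<bar>\<Sum>q\<in>A. c q * t powr e q\<bar> \<le> K * t powr E"
    and x: "x < E"
  shows "(\<Sum>q\<in>{q\<in>A. e q = x}. c q) = 0"
proof (rule ccontr)
  define D where "D y = (\<Sum>q\<in>{q\<in>A. e q = y}. c q)" for y
  define Z where "Z = {y \<in> e ` A. D y \<noteq> 0}"
  assume "(\<Sum>q\<in>{q\<in>A. e q = x}. c q) \<noteq> 0"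
  then have "D x \<noteq> 0" by (simp add: D_def)
  moreover from this have "{q\<in>A. e q = x} \<noteq> {}" unfolding D_def by (metis sum.empty)
  ultimately have xZ: "x \<in> Z" by (auto simp: Z_def)
  have finZ: "finite Z" using fin by (simp add: Z_def)
  define x0 where "x0 = Min Z"
  have x0: "x0 \<in> Z" "x0 \<le> x"
    unfolding x0_def using finZ xZ by (auto intro: Min_in Min_le simp del: Min_in)
  have ge: "x0 \<le> y" if "y \<in> Z" for y using that finZ by (simp add: x0_def)
  have sum: "(\<Sum>q\<in>A. c q * t powr e q) = (\<Sum>y\<in>e ` A. D y * t powr y)" for t
  proof -
    have "(\<Sum>q\<in>A. c q * t powr e q) = (\<Sum>y\<in>e ` A. \<Sum>q\<in>{q\<in>A. e q = y}. c q * t powr e q)"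
      by (rule sum.image_gen[OF fin])
    also have "\<dots> = (\<Sum>y\<in>e ` A. D y * t powr y)"
      unfolding D_def sum_distrib_right by (intro sum.cong) auto
    finally show ?thesis .
  qed
  have pow: "((\<lambda>t. t powr b) \<longlongrightarrow> 0) (at_right (0::real))" if "0 < b" for b
    by (rule tendsto_zero_powrI[OF tendsto_ident_at tendsto_const])
      (use that in \<open>auto simp: eventually_at_right_less intro: eventually_mono[OF eventually_at_right_less]\<close>)
  have "((\<lambda>t. \<Sum>y\<in>e ` A. D y * t powr (y - x0)) \<longlongrightarrow> (\<Sum>y\<in>e ` A. if y = x0 then D y else 0)) (at_right 0)"
  proof (rule tendsto_sum)
    fix y assume "y \<in> e ` A"
    show "((\<lambda>t. D y * t powr (y - x0)) \<longlongrightarrow> (if y = x0 then D y else 0)) (at_right 0)"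
    proof (cases "D y = 0 \<or> y = x0")
      case True
      have "\<forall>\<^sub>F t in at_right 0. (if y = x0 then D y else 0) = D y * t powr (y - x0)"
        using eventually_at_right_less[of "0::real"] by eventually_elim (use True in auto)
      then show ?thesis by (rule Lim_transform_eventually[OF tendsto_const])
    next
      case False
      then have "0 < y - x0" using ge[of y] \<open>y \<in> e ` A\<close> by (auto simp: Z_def less_le)
      then show ?thesis using tendsto_mult[OF tendsto_const[of "D y"] pow[of "y - x0"]] False by simp
    qed
  qed
  moreover have "(\<Sum>y\<in>e ` A. if y = x0 then D y else 0) = D x0"
    using fin x0(1) by (simp add: Z_def sum.delta)
  ultimately have lim: "((\<lambda>t. \<Sum>y\<in>e ` A. D y * t powr (y - x0)) \<longlongrightarrow> D x0) (at_right 0)" by simp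
  have lim0: "((\<lambda>t. \<Sum>y\<in>e ` A. D y * t powr (y - x0)) \<longlongrightarrow> 0) (at_right 0)"
  proof (rule Lim_null_comparison)
    show "((\<lambda>t. K * t powr (E - x0)) \<longlongrightarrow> 0) (at_right 0)"
      using tendsto_mult[OF tendsto_const[of K] pow[of "E - x0"]] x x0 by simp
    have "\<forall>\<^sub>F t in at_right 0. 0 < t \<and> t \<le> \<rho>"
      using eventually_at_right_less[of "0::real"] eventually_at_right_real[OF \<rho>]
      by eventually_elim auto
    then show "\<forall>\<^sub>F t in at_right 0. norm (\<Sum>y\<in>e ` A. D y * t powr (y - x0)) \<le> K * t powr (E - x0)"
    proof eventually_elim
      case (elim t)
      have "(\<Sum>y\<in>e ` A. D y * t powr (y - x0)) = (\<Sum>q\<in>A. c q * t powr e q) * t powr (- x0)"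
        unfolding sum sum_distrib_right using elim
        by (intro sum.cong) (auto simp: powr_add[symmetric] mult.assoc)
      then have "norm (\<Sum>y\<in>e ` A. D y * t powr (y - x0)) = \<bar>\<Sum>q\<in>A. c q * t powr e q\<bar> * t powr (- x0)"
        by (simp add: abs_mult)
      also have "\<dots> \<le> K * t powr E * t powr (- x0)" using elim by (intro mult_right_mono bound) auto
      also have "\<dots> = K * t powr (E - x0)" by (simp add: powr_add[symmetric] mult.assoc)
      finally show ?case .
    qed
  qed
  have "D x0 = 0" by (rule tendsto_unique[OF _ lim lim0]) simp
  then show False using x0 by (simp add: Z_def)
qed

lemma power_sum_lists:
  fixes x :: "'k \<Rightarrow> 'a::comm_semiring_1"
  assumes "finite L"
  shows "(\<Sum>k\<in>L. x k) ^ j = (\<Sum>ks\<in>{ks. length ks = j \<and> set ks \<subseteq> L}. prod_list (map x ks))"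
proof (induction j)
  case 0
  have "{ks. length ks = 0 \<and> set ks \<subseteq> L} = {[]}" by auto
  then show ?case by simp
next
  case (Suc j)
  let ?A = "{ks. length ks = j \<and> set ks \<subseteq> L}"
  have eq: "{ks. length ks = Suc j \<and> set ks \<subseteq> L} = (\<lambda>(k, ks). k # ks) ` (L \<times> ?A)"
    by (auto simp: length_Suc_conv image_iff)
  have "(\<Sum>ks\<in>{ks. length ks = Suc j \<and> set ks \<subseteq> L}. prod_list (map x ks))
      = (\<Sum>(k, ks)\<in>L \<times> ?A. x k * prod_list (map x ks))"
    unfolding eq by (subst sum.reindex) (auto simp: inj_on_def case_prod_unfold)
  also have "\<dots> = (\<Sum>k\<in>L. x k) * (\<Sum>ks\<in>?A. prod_list (map x ks))"
    by (simp add: sum_product sum.cartesian_product)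
  finally show ?case using Suc by simp
qed

lemma prod_list_powr:
  fixes r m :: "'k \<Rightarrow> real" and t :: real
  assumes "0 < t"
  shows "prod_list (map (\<lambda>k. r k * t powr m k) ks) = prod_list (map r ks) * t powr sum_list (map m ks)"
proof (induction ks)
  case (Cons k ks)
  have "t powr (m k + sum_list (map m ks)) = t powr m k * t powr sum_list (map m ks)"
    by (rule powr_add)
  then show ?case using Cons by simp
qed (use assms in simp)

lemma exp_Taylor_bound:
  fixes x :: real
  assumes "\<bar>x\<bar> \<le> b"
  shows "\<bar>exp x - (\<Sum>j\<le>m. x ^ j / fact j)\<bar> \<le> exp b * \<bar>x\<bar> ^ Suc m"
proof -
  obtain s where s: "\<bar>s\<bar> \<le> \<bar>x\<bar>" "exp x = (\<Sum>j<Suc m. x ^ j / fact j) + exp s / fact (Suc m) * x ^ Suc m"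
    using Maclaurin_exp_le[of x "Suc m"] by blast
  have "\<bar>exp x - (\<Sum>j\<le>m. x ^ j / fact j)\<bar> = exp s / fact (Suc m) * \<bar>x\<bar> ^ Suc m"
    using s(2) by (simp add: lessThan_Suc_atMost abs_mult power_abs del: fact_Suc)
  also have "\<dots> \<le> exp b * \<bar>x\<bar> ^ Suc m"
  proof (intro mult_right_mono)
    have "exp s / fact (Suc m) \<le> exp s / 1" by (intro divide_left_mono fact_ge_1) auto
    also have "\<dots> \<le> exp b" using s(1) assms by simp
    finally show "exp s / fact (Suc m) \<le> exp b" .
  qed auto
  finally show ?thesis .
qed

text \<open>The right-hand side in \<open>P_seq\<close> at one fixed angle, with numbers
  \<open>R k\<close> in place of the earlier functions.\<close>

definition rec_rhs :: "real \<Rightarrow> real \<Rightarrow> (nat \<Rightarrow> real) \<Rightarrow> nat \<Rightarrow> nat \<Rightarrow> real" where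
  "rec_rhs \<tau> a R l m = (\<Sum>j=1..m. - exp a / fact j *
     (\<Sum>ks\<in>{ks. length ks = j \<and> set ks \<subseteq> {1..<l} \<and> sum_list (map (index_seq \<tau>) ks) = index_seq \<tau> m}.
       prod_list (map R ks)))"

text \<open>For a fixed angle, if \<open>V\<close> and \<open>G\<close> have coefficients \<open>R\<close> and \<open>S\<close>, then
  \<open>G = - e\<^sup>a t\<^sup>\<tau> e\<^sup>V\<close> expresses \<open>S\<close> through \<open>R\<close> as in the recursion for \<open>P_seq\<close>.\<close>

theorem expansion_coefficients:
  fixes V G :: "real \<Rightarrow> real" and R S :: "nat \<Rightarrow> real" and \<tau> \<rho> a :: real
  defines "\<mu> \<equiv> index_seq \<tau>"
  assumes tau: "\<tau> > 0" and \<rho>: "0 < \<rho>" "\<rho> \<le> 1"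
    and V: "\<And>l. \<exists>K. \<forall>t. 0 < t \<and> t \<le> \<rho> \<longrightarrow> \<bar>V t - (\<Sum>j=1..l. R j * t powr \<mu> j)\<bar> \<le> K * t powr \<mu> (Suc l)"
    and G: "\<And>l. \<exists>K. \<forall>t. 0 < t \<and> t \<le> \<rho> \<longrightarrow> \<bar>G t - (\<Sum>j=1..l. S j * t powr \<mu> j)\<bar> \<le> K * t powr \<mu> (Suc l)"
    and eq: "\<And>t. 0 < t \<Longrightarrow> t \<le> \<rho> \<Longrightarrow> G t = - exp a * t powr \<tau> * exp (V t)"
    and m: "1 \<le> m" "\<mu> l = \<tau> + \<mu> m"
  shows "S l = rec_rhs \<tau> a R l m"
proof -
  have mono: "\<mu> i < \<mu> j \<longleftrightarrow> i < j" for i j unfolding \<mu>_def by (rule index_seq_less_iff[OF tau])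
  have "m < l" using m tau mono[of m l] by simp
  define L where "L = {1..<l}"
  define Tr where "Tr t = (\<Sum>k\<in>L. R k * t powr \<mu> k)" for t
  have L: "L = {1..l - 1}" "Suc (l - 1) = l" using \<open>m < l\<close> by (auto simp: L_def)
  obtain K1 where K1: "\<And>t. 0 < t \<Longrightarrow> t \<le> \<rho> \<Longrightarrow> \<bar>V t - Tr t\<bar> \<le> K1 * t powr \<mu> l"
    using V[of "l - 1"] unfolding Tr_def L by (auto simp: L)
  obtain K2 where K2: "\<And>t. 0 < t \<Longrightarrow> t \<le> \<rho> \<Longrightarrow> \<bar>G t - (\<Sum>j=1..l. S j * t powr \<mu> j)\<bar> \<le> K2 * t powr \<mu> (Suc l)"
    using G[of l] by blast
  define M where "M = (\<Sum>k\<in>L. \<bar>R k\<bar>)"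
  have "0 \<le> M" by (simp add: M_def sum_nonneg)
  have pos: "0 < \<mu> j" if "j \<ge> 1" for j unfolding \<mu>_def by (rule index_seq_pos[OF tau that])
  have Tr: "\<bar>Tr t\<bar> \<le> M * t powr \<mu> 1" "\<bar>Tr t\<bar> \<le> M" if "0 < t" "t \<le> \<rho>" for t
  proof -
    have "\<bar>Tr t\<bar> \<le> (\<Sum>k\<in>L. \<bar>R k * t powr \<mu> k\<bar>)" unfolding Tr_def by (rule sum_abs)
    also have "\<dots> \<le> (\<Sum>k\<in>L. \<bar>R k\<bar> * t powr \<mu> 1)"
    proof (rule sum_mono)
      fix k assume "k \<in> L"
      then have "\<mu> 1 \<le> \<mu> k" using mono[of k 1] by (auto simp: L_def not_less[symmetric])
      then have "t powr \<mu> k \<le> t powr \<mu> 1" using that \<rho> by (intro powr_mono') auto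
      then show "\<bar>R k * t powr \<mu> k\<bar> \<le> \<bar>R k\<bar> * t powr \<mu> 1" by (simp add: abs_mult mult_left_mono)
    qed
    finally show 1: "\<bar>Tr t\<bar> \<le> M * t powr \<mu> 1" by (simp add: M_def sum_distrib_right)
    also have "\<dots> \<le> M * 1"
      using that \<rho> pos[of 1] \<open>0 \<le> M\<close> by (intro mult_left_mono powr_le1) auto
    finally show "\<bar>Tr t\<bar> \<le> M" by simp
  qed
  have bV: "\<bar>V t - Tr t\<bar> \<le> \<bar>K1\<bar>" if "0 < t" "t \<le> \<rho>" for t
  proof -
    have "\<bar>V t - Tr t\<bar> \<le> K1 * t powr \<mu> l" by (rule K1[OF that])
    also have "\<dots> \<le> \<bar>K1\<bar> * 1"
      using that \<rho> pos[of l] \<open>m < l\<close> by (intro mult_mono powr_le1) auto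
    finally show ?thesis by simp
  qed
  \<comment> \<open>The orders of the three errors: the remainder of \<open>G\<close>, the remainder
    of \<open>V\<close> times t^\<tau>, and the Taylor remainder of exp at degree m.
    \<open>index_seq_le_mult\<close> puts the last one above \<open>\<mu> l\<close>.\<close>
  define E where "E = Min {\<mu> (Suc l), \<tau> + \<mu> l, \<tau> + real (Suc m) * \<mu> 1}"
  have E: "E \<le> \<mu> (Suc l)" "E \<le> \<tau> + \<mu> l" "E \<le> \<tau> + real (Suc m) * \<mu> 1"
    unfolding E_def by (auto intro: Min_le)
  have "\<mu> m \<le> real m * \<mu> 1" unfolding \<mu>_def by (rule index_seq_le_mult[OF tau])
  then have "\<mu> l < E" unfolding E_def using mono[of l "Suc l"] tau m pos[of 1]
    by (simp add: algebra_simps)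
  \<comment> \<open>One finite family of powers of t: the left summand holds the terms of
    \<open>G\<close>, the right one the tuples obtained by multiplying out the powers of
    \<open>Tr\<close>.\<close>
  define A where "A = {1..l} <+> (SIGMA j:{..m}. {ks. length ks = j \<and> set ks \<subseteq> L})"
  define c where "c = case_sum S (\<lambda>(j, ks). exp a / fact j * prod_list (map R ks))"
  define e where "e = case_sum \<mu> (\<lambda>(j::nat, ks). \<tau> + sum_list (map \<mu> ks))"
  have finL: "finite {ks. length ks = j \<and> set ks \<subseteq> L}" for j
    using finite_lists_length_eq[of L j] by (simp add: L_def conj_commute)
  have finA: "finite A" unfolding A_def by (intro finite_Plus finite_SigmaI finL) auto
  have "(\<Sum>q\<in>{q\<in>A. e q = \<mu> l}. c q) = 0"
  proof (rule powr_sum_coeff_eq_0[OF finA \<rho>(1) _ \<open>\<mu> l < E\<close>])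
    fix t assume t: "0 < t" "t \<le> \<rho>"
    have t1: "t \<le> 1" using t \<rho> by simp
    have "(\<Sum>q\<in>A. c q * t powr e q) = (\<Sum>j=1..l. S j * t powr \<mu> j)
      + (\<Sum>j\<le>m. \<Sum>ks\<in>{ks. length ks = j \<and> set ks \<subseteq> L}.
          exp a / fact j * prod_list (map R ks) * t powr (\<tau> + sum_list (map \<mu> ks)))"
      unfolding A_def by (subst sum.Plus) (auto simp: c_def e_def finL sum.Sigma case_prod_unfold)
    also have "(\<Sum>j\<le>m. \<Sum>ks\<in>{ks. length ks = j \<and> set ks \<subseteq> L}.
          exp a / fact j * prod_list (map R ks) * t powr (\<tau> + sum_list (map \<mu> ks)))
       = exp a * t powr \<tau> * (\<Sum>j\<le>m. Tr t ^ j / fact j)"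
      unfolding sum_distrib_left
    proof (rule sum.cong[OF refl])
      fix j
      have "Tr t ^ j = (\<Sum>ks\<in>{ks. length ks = j \<and> set ks \<subseteq> L}. prod_list (map R ks) * t powr sum_list (map \<mu> ks))"
        unfolding Tr_def by (subst power_sum_lists) (simp_all add: L_def prod_list_powr[OF t(1)])
      then show "(\<Sum>ks\<in>{ks. length ks = j \<and> set ks \<subseteq> L}.
          exp a / fact j * prod_list (map R ks) * t powr (\<tau> + sum_list (map \<mu> ks)))
          = exp a * t powr \<tau> * (Tr t ^ j / fact j)"
        using t by (simp add: sum_distrib_left sum_divide_distrib powr_add mult_ac)
    qed
    also have "(\<Sum>j=1..l. S j * t powr \<mu> j) + exp a * t powr \<tau> * (\<Sum>j\<le>m. Tr t ^ j / fact j)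
       = - (G t - (\<Sum>j=1..l. S j * t powr \<mu> j)) - exp a * t powr \<tau> * (exp (V t) - exp (Tr t))
         - exp a * t powr \<tau> * (exp (Tr t) - (\<Sum>j\<le>m. Tr t ^ j / fact j))"
      unfolding eq[OF t] by (simp add: algebra_simps)
    also have "\<bar>\<dots>\<bar> \<le> \<bar>G t - (\<Sum>j=1..l. S j * t powr \<mu> j)\<bar> + exp a * t powr \<tau> * \<bar>exp (V t) - exp (Tr t)\<bar>
         + exp a * t powr \<tau> * \<bar>exp (Tr t) - (\<Sum>j\<le>m. Tr t ^ j / fact j)\<bar>"
    proof -
      have *: "\<bar>- x - y - z\<bar> \<le> \<bar>x\<bar> + \<bar>y\<bar> + \<bar>z\<bar>" for x y z :: real by linarith
      show ?thesis by (rule order.trans[OF *]) (simp add: abs_mult)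
    qed
    also have "\<dots> \<le> \<bar>K2\<bar> * t powr E + exp a * exp (M + \<bar>K1\<bar>) * \<bar>K1\<bar> * t powr E
        + exp a * exp M * M ^ Suc m * t powr E"
    proof (intro add_mono)
      have "K2 * t powr \<mu> (Suc l) \<le> \<bar>K2\<bar> * t powr E"
        using t t1 E by (intro mult_mono powr_mono') auto
      then show "\<bar>G t - (\<Sum>j=1..l. S j * t powr \<mu> j)\<bar> \<le> \<bar>K2\<bar> * t powr E" using K2[OF t] by linarith
      have "\<bar>exp (V t) - exp (Tr t)\<bar> \<le> exp (max (V t) (Tr t)) * \<bar>V t - Tr t\<bar>" by (rule abs_exp_diff_le)
      also have "\<dots> \<le> exp (M + \<bar>K1\<bar>) * (\<bar>K1\<bar> * t powr \<mu> l)"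
      proof (intro mult_mono)
        show "exp (max (V t) (Tr t)) \<le> exp (M + \<bar>K1\<bar>)" using bV[OF t] Tr(2)[OF t] by simp linarith
        have "K1 * t powr \<mu> l \<le> \<bar>K1\<bar> * t powr \<mu> l" by (intro mult_right_mono) auto
        then show "\<bar>V t - Tr t\<bar> \<le> \<bar>K1\<bar> * t powr \<mu> l" using K1[OF t] by linarith
      qed auto
      finally have "exp a * t powr \<tau> * \<bar>exp (V t) - exp (Tr t)\<bar>
          \<le> exp a * t powr \<tau> * (exp (M + \<bar>K1\<bar>) * (\<bar>K1\<bar> * t powr \<mu> l))" by (intro mult_left_mono) auto
      also have "\<dots> = exp a * exp (M + \<bar>K1\<bar>) * \<bar>K1\<bar> * t powr (\<tau> + \<mu> l)" by (simp add: powr_add mult_ac)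
      also have "\<dots> \<le> exp a * exp (M + \<bar>K1\<bar>) * \<bar>K1\<bar> * t powr E"
        using t t1 E by (intro mult_left_mono powr_mono') auto
      finally show "exp a * t powr \<tau> * \<bar>exp (V t) - exp (Tr t)\<bar> \<le> exp a * exp (M + \<bar>K1\<bar>) * \<bar>K1\<bar> * t powr E" .
      have "\<bar>exp (Tr t) - (\<Sum>j\<le>m. Tr t ^ j / fact j)\<bar> \<le> exp M * \<bar>Tr t\<bar> ^ Suc m"
        by (rule exp_Taylor_bound[OF Tr(2)[OF t]])
      also have "\<dots> \<le> exp M * (M * t powr \<mu> 1) ^ Suc m"
        by (intro mult_left_mono power_mono Tr(1)[OF t]) auto
      also have "(M * t powr \<mu> 1) ^ Suc m = M ^ Suc m * t powr (real (Suc m) * \<mu> 1)"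
        using t by (simp only: power_mult_distrib powr_power mult.commute)
      finally have "exp a * t powr \<tau> * \<bar>exp (Tr t) - (\<Sum>j\<le>m. Tr t ^ j / fact j)\<bar>
          \<le> exp a * t powr \<tau> * (exp M * (M ^ Suc m * t powr (real (Suc m) * \<mu> 1)))"
        by (intro mult_left_mono) auto
      also have "\<dots> = exp a * exp M * M ^ Suc m * t powr (\<tau> + real (Suc m) * \<mu> 1)" by (simp add: powr_add mult_ac)
      also have "\<dots> \<le> exp a * exp M * M ^ Suc m * t powr E"
        using t t1 E \<open>0 \<le> M\<close> by (intro mult_left_mono powr_mono') auto
      finally show "exp a * t powr \<tau> * \<bar>exp (Tr t) - (\<Sum>j\<le>m. Tr t ^ j / fact j)\<bar>
          \<le> exp a * exp M * M ^ Suc m * t powr E" .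
    qed
    finally show "\<bar>\<Sum>q\<in>A. c q * t powr e q\<bar>
        \<le> (\<bar>K2\<bar> + exp a * exp (M + \<bar>K1\<bar>) * \<bar>K1\<bar> + exp a * exp M * M ^ Suc m) * t powr E"
      by (simp only: distrib_right)
  qed
  \<comment> \<open>The empty tuple has exponent \<tau>, which differs from \<open>\<mu> l\<close>
    because \<open>\<mu> m\<close> is nonzero; so j starts at 1.\<close>
  moreover have "{q\<in>A. e q = \<mu> l} = {l} <+> (SIGMA j:{1..m}. {ks. length ks = j \<and> set ks \<subseteq> L \<and> sum_list (map \<mu> ks) = \<mu> m})"
  proof -
    have inj: "\<mu> j = \<mu> l \<longleftrightarrow> j = l" for j unfolding \<mu>_def by (rule index_seq_eq_iff[OF tau])
    have "\<mu> m \<noteq> 0" using pos[of m] m by simp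
    show ?thesis
    proof (rule set_eqI)
      fix q show "q \<in> {q\<in>A. e q = \<mu> l} \<longleftrightarrow> q \<in> {l} <+> (SIGMA j:{1..m}.
          {ks. length ks = j \<and> set ks \<subseteq> L \<and> sum_list (map \<mu> ks) = \<mu> m})"
      proof (cases q)
        case (Inl j)
        then show ?thesis using inj[of j] \<open>m < l\<close> by (auto simp: A_def e_def)
      next
        case (Inr p)
        obtain j ks where p: "p = (j, ks)" by (cases p)
        have "\<tau> + sum_list (map \<mu> ks) = \<mu> l \<longleftrightarrow> sum_list (map \<mu> ks) = \<mu> m" using m by simp
        moreover have "ks \<noteq> []" if "sum_list (map \<mu> ks) = \<mu> m" using that \<open>\<mu> m \<noteq> 0\<close> by auto
        ultimately show ?thesis unfolding Inr p A_def e_def by (auto simp: Suc_le_eq)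
      qed
    qed
  qed
  moreover have "(\<Sum>q\<in>{l} <+> (SIGMA j:{1..m}. {ks. length ks = j \<and> set ks \<subseteq> L \<and> sum_list (map \<mu> ks) = \<mu> m}). c q)
     = S l + (\<Sum>j=1..m. \<Sum>ks\<in>{ks. length ks = j \<and> set ks \<subseteq> L \<and> sum_list (map \<mu> ks) = \<mu> m}.
          exp a / fact j * prod_list (map R ks))"
  proof -
    have "finite {ks. length ks = j \<and> set ks \<subseteq> L \<and> sum_list (map \<mu> ks) = \<mu> m}" for j
      by (rule finite_subset[OF _ finL[of j]]) auto
    then show ?thesis
      by (subst sum.Plus) (auto simp: c_def sum.Sigma case_prod_unfold)
  qed
  ultimately have "S l = - (\<Sum>j=1..m. \<Sum>ks\<in>{ks. length ks = j \<and> set ks \<subseteq> L \<and> sum_list (map \<mu> ks) = \<mu> m}.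
          exp a / fact j * prod_list (map R ks))" by simp
  then show ?thesis by (simp add: rec_rhs_def \<mu>_def L_def sum_negf[symmetric] sum_distrib_left)
qed

lemma index_seq_le_iff: "\<tau> > 0 \<Longrightarrow> index_seq \<tau> l \<le> index_seq \<tau> m \<longleftrightarrow> l \<le> m"
  using strict_mono_index_seq strict_mono_less_eq by blast

section \<open>Coefficients of the harmonic function\<close>

text \<open>The angle with cosine \<open>3/5\<close> and sine \<open>4/5\<close> satisfies \<open>\<bar>sin (n\<theta>)\<bar> \<ge> 5\<^sup>-\<^sup>n\<close> because
  \<open>(3 + 4i)\<^sup>n\<close> is a Gaussian integer congruent to \<open>3 + 4i\<close> modulo 5. Along this ray
  convergence controls the sine coefficients.\<close>

lemma power_3_4i:
  assumes "n \<ge> 1"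
  shows "\<exists>a b :: int. Complex 3 4 ^ n = Complex (of_int a) (of_int b) \<and> a mod 5 = 3 \<and> b mod 5 = 4"
  using assms
proof (induction n rule: dec_induct)
  case base
  show ?case by (intro exI[of _ 3] exI[of _ 4]) simp
next
  case (step n)
  then obtain a b :: int where ab: "Complex 3 4 ^ n = Complex (of_int a) (of_int b)" "a mod 5 = 3" "b mod 5 = 4"
    by blast
  have "Complex 3 4 ^ Suc n = Complex (of_int (3 * a - 4 * b)) (of_int (4 * a + 3 * b))"
    by (simp add: ab(1) complex_eq_iff)
  moreover have "(3 * a - 4 * b) mod 5 = 3" "(4 * a + 3 * b) mod 5 = 4" using ab(2,3) by presburger+
  ultimately show ?case by blast
qed

lemma Complex_3_4: "Complex 3 4 = 5 * cis (Arg (Complex 3 4))"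
proof -
  have "norm (Complex 3 4) = 5" by (simp add: cmod_def)
  then show ?thesis using rcis_cmod_Arg[of "Complex 3 4"] by (simp add: rcis_def)
qed

lemma abs_sin_3_4_ge:
  assumes "n \<ge> 1"
  shows "1 / 5 ^ n \<le> \<bar>sin (real n * Arg (Complex 3 4))\<bar>"
proof -
  obtain a b :: int where ab: "Complex 3 4 ^ n = Complex (of_int a) (of_int b)" "b mod 5 = 4"
    using power_3_4i[OF assms] by blast
  have "Complex 3 4 ^ n = 5 ^ n * cis (real n * Arg (Complex 3 4))"
    by (subst Complex_3_4) (simp only: power_mult_distrib Complex.DeMoivre)
  then have "of_int b = Im (of_real (5 ^ n) * cis (real n * Arg (Complex 3 4)))" using ab(1) by (metis complex.sel(2) of_real_numeral of_real_power)
  moreover have "Im (of_real x * z) = x * Im z" for x z by simp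
  ultimately have "of_int b = 5 ^ n * sin (real n * Arg (Complex 3 4))" by (simp only: cis.sel)
  moreover have "1 \<le> \<bar>b\<bar>" using ab(2) by (cases "b = 0") auto
  ultimately have "1 \<le> \<bar>5 ^ n * sin (real n * Arg (Complex 3 4))\<bar>" by linarith
  then show ?thesis by (simp add: abs_mult field_simps)
qed

text \<open>The terms of a convergent series are bounded. At angle 0 this controls the cosine
  coefficients, at the angle of 3 + 4i the sine coefficients up to a factor 5^i, which the smaller
  radius r / 5 absorbs.\<close>

lemma spherical_harmonics_coefficients:
  fixes X :: "nat \<Rightarrow> real \<Rightarrow> real" and H :: "complex \<Rightarrow> real"
  assumes X: "\<forall>i\<ge>1. X i \<in> spherical_harmonics i"
    and H: "\<forall>\<^sub>F x in nhds 0. (\<lambda>i. norm x ^ Suc i * X (Suc i) (Arg x)) sums H x"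
  obtains \<gamma> C \<rho> where "\<gamma> 0 = 0" "\<And>i h. i \<ge> 1 \<Longrightarrow> X i h = Re (\<gamma> i * cis (real i * h))"
    "\<rho> > 0" "\<And>i. norm (\<gamma> i) * \<rho> ^ i \<le> C"
proof -
  have "\<forall>i. \<exists>\<alpha> \<beta>. i \<ge> 1 \<longrightarrow> X i = (\<lambda>h. \<alpha> * cos (real i * h) + \<beta> * sin (real i * h))"
    using X by (auto simp: spherical_harmonics_def)
  then obtain \<alpha> \<beta> where ab: "\<And>i h. i \<ge> 1 \<Longrightarrow> X i h = \<alpha> i * cos (real i * h) + \<beta> i * sin (real i * h)"
    by metis
  obtain \<delta> where \<delta>: "\<delta> > 0" "\<And>x. norm x < \<delta> \<Longrightarrow> (\<lambda>i. norm x ^ Suc i * X (Suc i) (Arg x)) sums H x"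
    using H unfolding eventually_nhds_metric by auto
  define r where "r = \<delta> / 2"
  have r: "0 < r" "r < \<delta>" using \<delta>(1) by (auto simp: r_def)
  have bounded: "\<exists>C. \<forall>i\<ge>1. \<bar>r ^ i * X i (Arg x)\<bar> \<le> C" if x: "norm x = r" for x :: complex
  proof -
    have "Bseq (\<lambda>i. r ^ Suc i * X (Suc i) (Arg x))"
      using \<delta>(2)[of x] x r sums_summable summable_LIMSEQ_zero convergent_imp_Bseq convergentI by metis
    then obtain C where C: "\<And>i. norm (r ^ Suc i * X (Suc i) (Arg x)) \<le> C" unfolding Bseq_def by blast
    have "\<bar>r ^ i * X i (Arg x)\<bar> \<le> C" if "i \<ge> 1" for i using C[of "i - 1"] that by simp
    then show ?thesis by blast
  qed
  obtain C1 where C1: "\<And>i. i \<ge> 1 \<Longrightarrow> \<bar>r ^ i * X i (Arg (complex_of_real r))\<bar> \<le> C1"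
    using bounded[of "of_real r"] r by auto
  define w where "w = of_real (r / 5) * Complex 3 4"
  have "norm (Complex 3 4) = 5" by (simp add: cmod_def)
  then have "norm w = r" using r unfolding w_def norm_mult by simp
  moreover have "Arg w = Arg (Complex 3 4)" unfolding w_def using r by (intro Arg_times_of_real) simp
  ultimately obtain C2 where C2: "\<And>i. i \<ge> 1 \<Longrightarrow> \<bar>r ^ i * X i (Arg (Complex 3 4))\<bar> \<le> C2"
    using bounded[of w] by auto
  \<comment> \<open>Re ((\<alpha> - i\<beta>) e^(inh)) = \<alpha> cos (nh) + \<beta> sin (nh),
    whence the sign. The degree 0 coefficient is zero because H(0) = 0.\<close>
  define \<gamma> where "\<gamma> i = (if i = 0 then 0 else Complex (\<alpha> i) (- \<beta> i))" for i
  show ?thesis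
  proof (rule that[of \<gamma> "r / 5" "2 * C1 + C2"])
    show "\<gamma> 0 = 0" "r / 5 > 0" using r by (simp_all add: \<gamma>_def)
    show "X i h = Re (\<gamma> i * cis (real i * h))" if "i \<ge> 1" for i h
      using that by (simp add: ab \<gamma>_def)
    fix i
    show "norm (\<gamma> i) * (r / 5) ^ i \<le> 2 * C1 + C2"
    proof (cases "i = 0")
      case True
      then show ?thesis using C1[of 1] C2[of 1] by (simp add: \<gamma>_def) 
    next
      case False
      then have i: "i \<ge> 1" by simp
      define s c where "s = sin (real i * Arg (Complex 3 4))" and "c = cos (real i * Arg (Complex 3 4))"
      have "\<bar>r ^ i * \<alpha> i\<bar> \<le> C1" using C1[OF i] r by (simp add: ab[OF i])
      then have a: "r ^ i * \<bar>\<alpha> i\<bar> \<le> C1" using r by (simp add: abs_mult)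
      have "r ^ i * (\<bar>\<beta> i\<bar> * \<bar>s\<bar>) = \<bar>r ^ i * (\<alpha> i * c + \<beta> i * s) - r ^ i * (\<alpha> i * c)\<bar>"
        using r by (simp add: algebra_simps abs_mult)
      also have "\<dots> \<le> \<bar>r ^ i * (\<alpha> i * c + \<beta> i * s)\<bar> + \<bar>r ^ i * (\<alpha> i * c)\<bar>" by (rule abs_triangle_ineq4)
      also have "\<bar>r ^ i * (\<alpha> i * c + \<beta> i * s)\<bar> \<le> C2" using C2[OF i] by (simp add: ab[OF i] s_def c_def)
      also have "\<bar>r ^ i * (\<alpha> i * c)\<bar> \<le> C1"
      proof -
        have "\<bar>r ^ i * (\<alpha> i * c)\<bar> = r ^ i * \<bar>\<alpha> i\<bar> * \<bar>c\<bar>" using r by (simp add: abs_mult)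
        also have "\<dots> \<le> r ^ i * \<bar>\<alpha> i\<bar> * 1" using r by (intro mult_left_mono) (auto simp: c_def)
        finally show ?thesis using a by simp
      qed
      finally have b: "r ^ i * (\<bar>\<beta> i\<bar> * \<bar>s\<bar>) \<le> C2 + C1" by simp
      have "\<bar>\<beta> i\<bar> * (r / 5) ^ i = r ^ i * (\<bar>\<beta> i\<bar> * (1 / 5 ^ i))" by (simp add: power_divide)
      also have "\<dots> \<le> r ^ i * (\<bar>\<beta> i\<bar> * \<bar>s\<bar>)"
        using abs_sin_3_4_ge[OF i] r unfolding s_def by (intro mult_left_mono) auto
      finally have b': "\<bar>\<beta> i\<bar> * (r / 5) ^ i \<le> C2 + C1" using b by simp
      have "\<bar>\<alpha> i\<bar> * (r / 5) ^ i \<le> \<bar>\<alpha> i\<bar> * r ^ i" using r by (intro mult_left_mono power_mono) auto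
      then have a': "\<bar>\<alpha> i\<bar> * (r / 5) ^ i \<le> C1" using a by (simp add: mult.commute)
      have "norm (\<gamma> i) \<le> \<bar>\<alpha> i\<bar> + \<bar>\<beta> i\<bar>" using False cmod_le[of "\<gamma> i"] by (simp add: \<gamma>_def)
      then have "norm (\<gamma> i) * (r / 5) ^ i \<le> (\<bar>\<alpha> i\<bar> + \<bar>\<beta> i\<bar>) * (r / 5) ^ i"
        using r by (intro mult_right_mono) auto
      then show ?thesis using a' b' by (simp add: distrib_right)
    qed
  qed
qed

section \<open>Triple series\<close>

text \<open>The index \<open>(p, i, k)\<close> stands for the term \<open>|z|\<^sup>p\<^sup>\<tau> z\<^sup>i cnj z\<^sup>k\<close>.\<close>

definition expo :: "real \<Rightarrow> nat \<times> nat \<times> nat \<Rightarrow> real" where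
  "expo \<tau> = (\<lambda>(p, i, k). real p * \<tau> + real i + real k)"

definition freq :: "nat \<times> nat \<times> nat \<Rightarrow> int" where
  "freq = (\<lambda>(p, i, k). int i - int k)"

text \<open>The common majorant of the triple series; the radius in \<open>expansion\<close> is
  chosen to make each of the three ratios at most 1/2.\<close>

definition geom :: "nat \<times> nat \<times> nat \<Rightarrow> real" where
  "geom = (\<lambda>(p, i, k). (1/2) ^ p * ((1/2) ^ i * (1/2) ^ k))"

lemma summable_geom: "geom summable_on UNIV"
proof -
  have half: "((\<lambda>n. (1/2) ^ n) has_sum (2::real)) UNIV"
    using geometric_sums[of "1/2 :: real"] by (intro sums_nonneg_imp_has_sum) auto
  have pair: "((\<lambda>(i, k). (1/2) ^ i * (1/2) ^ k) has_sum (2 * 2 :: real)) (UNIV \<times> UNIV)"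
  proof (rule has_sum_SigmaI)
    show "((\<lambda>k. (\<lambda>(i, k). (1/2) ^ i * (1/2) ^ k) (i, k)) has_sum ((1/2) ^ i * 2 :: real)) UNIV" for i
      using has_sum_cmult_right[OF half, of "(1/2) ^ i"] by simp
    show "((\<lambda>i. (1/2) ^ i * 2) has_sum (2 * 2 :: real)) UNIV"
      by (rule has_sum_cmult_left[OF half])
    show "(\<lambda>(i, k). (1/2) ^ i * (1/2) ^ k :: real) summable_on UNIV \<times> UNIV"
    proof (rule summable_on_SigmaI)
      show "((\<lambda>k. (\<lambda>(i, k). (1/2) ^ i * (1/2) ^ k) (i, k)) has_sum ((1/2) ^ i * 2 :: real)) UNIV" for i
        using has_sum_cmult_right[OF half, of "(1/2) ^ i"] by simp
      show "(\<lambda>i. (1/2) ^ i * 2 :: real) summable_on UNIV"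
        using has_sum_cmult_left[OF half, of 2] unfolding summable_on_def by blast
    qed auto
  qed
  have "geom summable_on UNIV \<times> (UNIV \<times> UNIV)"
  proof (rule summable_on_SigmaI)
    show "((\<lambda>ik. geom (p, ik)) has_sum ((1/2) ^ p * 4)) (UNIV \<times> UNIV)" for p
      using has_sum_cmult_right[OF pair, of "(1/2) ^ p"] by (simp add: geom_def case_prod_unfold)
    show "(\<lambda>p. (1/2) ^ p * 4 :: real) summable_on UNIV"
      using has_sum_cmult_left[OF half, of 4] unfolding summable_on_def by blast
  qed (auto simp: geom_def)
  then show ?thesis by simp
qed

text \<open>Unconditional summability is given and only the value is in question. Summing over k,
  then i, leaves the series over p, whose ordered sum is known.\<close>

lemma has_sum_triple_product:
  fixes u :: "nat \<Rightarrow> complex" and x :: "nat \<Rightarrow> nat \<Rightarrow> complex"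
  assumes x: "\<And>p. (x p has_sum P p) UNIV"
    and u: "(\<lambda>p. u p * (P p * cnj (P p))) sums S"
    and sum: "(\<lambda>(p, i, k). u p * (x p i * cnj (x p k))) summable_on UNIV"
  shows "((\<lambda>(p, i, k). u p * (x p i * cnj (x p k))) has_sum S) UNIV"
proof -
  let ?f = "\<lambda>(p, i, k). u p * (x p i * cnj (x p k))"
  obtain S' where S': "(?f has_sum S') UNIV" using sum unfolding summable_on_def by blast
  have sum': "(\<lambda>ik. ?f (p, ik)) summable_on UNIV" for p
    using summable_on_SigmaD1[of "\<lambda>p ik. ?f (p, ik)" UNIV "\<lambda>_. UNIV" p] sum by (simp add: case_prod_unfold)
  have inner: "((\<lambda>ik. ?f (p, ik)) has_sum u p * (P p * cnj (P p))) (UNIV \<times> UNIV)" for p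
  proof (rule has_sum_SigmaI)
    have "((\<lambda>k. (u p * x p i) * cnj (x p k)) has_sum ((u p * x p i) * cnj (P p))) UNIV" for i
      by (intro has_sum_cmult_right) (use x in simp)
    then show "((\<lambda>k. ?f (p, i, k)) has_sum (u p * cnj (P p)) * x p i) UNIV" for i
      by (simp add: mult_ac)
    have "((\<lambda>i. (u p * cnj (P p)) * x p i) has_sum ((u p * cnj (P p)) * P p)) UNIV"
      by (intro has_sum_cmult_right x)
    then show "((\<lambda>i. (u p * cnj (P p)) * x p i) has_sum (u p * (P p * cnj (P p)))) UNIV"
      by (simp add: mult_ac)
    show "(\<lambda>ik. ?f (p, ik)) summable_on UNIV \<times> UNIV" using sum' by simp
  qed
  have "((\<lambda>p. u p * (P p * cnj (P p))) has_sum S') UNIV"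
  proof (rule has_sum_SigmaD)
    show "(?f has_sum S') (UNIV \<times> UNIV)" using S' by simp
    show "((\<lambda>ik. ?f (p, ik)) has_sum u p * (P p * cnj (P p))) UNIV" for p using inner by simp
  qed
  then have "S' = S" using has_sum_imp_sums u sums_unique2 by blast
  then show ?thesis using S' by simp
qed

lemma expo_in_index_set: "\<tau> > 0 \<Longrightarrow> q \<noteq> (0, 0, 0) \<Longrightarrow> expo \<tau> q \<in> index_set \<tau>"
proof -
  assume tau: "\<tau> > 0" and q: "q \<noteq> (0, 0, 0)"
  obtain p i k where pik: "q = (p, i, k)" by (cases q)
  have "expo \<tau> q = real p * \<tau> + real (i + k)" by (simp add: expo_def pik)
  moreover have "0 < real p * \<tau> + real (i + k)"
    using q tau unfolding pik by (cases "p = 0") (auto intro: add_pos_nonneg)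
  ultimately show ?thesis unfolding index_set_iff[OF tau] by metis
qed

lemma finite_expo_le:
  assumes "\<tau> > 0"
  shows "finite {q. expo \<tau> q \<le> b}"
proof (rule finite_subset)
  show "{q. expo \<tau> q \<le> b} \<subseteq> {..nat \<lfloor>b / \<tau>\<rfloor>} \<times> {..nat \<lfloor>b\<rfloor>} \<times> {..nat \<lfloor>b\<rfloor>}"
  proof
    fix q assume q: "q \<in> {q. expo \<tau> q \<le> b}"
    obtain p i k where pik: "q = (p, i, k)" by (cases q)
    have "real p * \<tau> + real i + real k \<le> b" using q by (simp add: expo_def pik)
    moreover have "0 \<le> real p * \<tau>" using assms by simp
    ultimately have "real p * \<tau> \<le> b" "real i \<le> b" "real k \<le> b" by linarith+
    then show "q \<in> {..nat \<lfloor>b / \<tau>\<rfloor>} \<times> {..nat \<lfloor>b\<rfloor>} \<times> {..nat \<lfloor>b\<rfloor>}"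
      using assms by (simp add: pik le_nat_floor field_simps)
  qed
qed auto

text \<open>The finitely many triples of exponent at most \<open>index_seq \<tau> l\<close> form the
  partial sum. The others are dominated at radius \<rho> by \<open>geom\<close> and gain the factor
  (t / \<rho>) to the next exponent on passing from \<rho> to t.\<close>

theorem triple_series_remainder:
  fixes C :: "nat \<times> nat \<times> nat \<Rightarrow> real" and V :: real
  assumes tau: "\<tau> > 0" and \<rho>: "0 < \<rho>"
    and C: "\<And>q. \<bar>C q\<bar> * \<rho> powr expo \<tau> q \<le> K * geom q" "C (0, 0, 0) = 0"
    and V: "((\<lambda>q. C q * t powr expo \<tau> q) has_sum V) UNIV"
    and t: "0 < t" "t \<le> \<rho>"
  shows "\<bar>V - (\<Sum>j=1..l. (\<Sum>q\<in>{q. expo \<tau> q = index_seq \<tau> j}. C q) * t powr index_seq \<tau> j)\<bar>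
    \<le> K * infsum geom UNIV * \<rho> powr - index_seq \<tau> (Suc l) * t powr index_seq \<tau> (Suc l)"
proof -
  define \<mu> where "\<mu> = index_seq \<tau>"
  define f where "f = (\<lambda>q. C q * t powr expo \<tau> q)"
  define A where "A = {q. expo \<tau> q \<le> \<mu> l}"
  have finA: "finite A" unfolding A_def by (rule finite_expo_le[OF tau])
  define B where "B j = {q. expo \<tau> q = \<mu> j}" for j
  have finB: "finite (B j)" for j
    unfolding B_def by (rule finite_subset[OF _ finite_expo_le[OF tau, of "\<mu> j"]]) auto
  have zero: "q = (0, 0, 0)" if "expo \<tau> q \<le> 0" for q
    using index_set_pos[OF tau expo_in_index_set[OF tau, of q]] that by (meson not_less)
  have AB: "A - {(0, 0, 0)} = (\<Union>j\<in>{1..l}. B j)"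
  proof (intro equalityI subsetI)
    fix q assume q: "q \<in> A - {(0, 0, 0)}"
    then have "expo \<tau> q \<in> \<mu> ` {1..}"
      unfolding \<mu>_def index_seq_image[OF tau] using expo_in_index_set[OF tau] by auto
    then obtain j where j: "j \<ge> 1" "expo \<tau> q = \<mu> j" by auto
    then have "\<mu> j \<le> \<mu> l" using q by (simp add: A_def)
    then have "j \<le> l" using index_seq_le_iff[OF tau, of j l] by (auto simp: \<mu>_def)
    then show "q \<in> (\<Union>j\<in>{1..l}. B j)" using j by (auto simp: B_def)
  next
    fix q assume "q \<in> (\<Union>j\<in>{1..l}. B j)"
    then obtain j where j: "1 \<le> j" "j \<le> l" "expo \<tau> q = \<mu> j" by (auto simp: B_def)
    have "\<mu> j \<le> \<mu> l" using j index_seq_le_iff[OF tau, of j l] by (auto simp: \<mu>_def)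
    moreover have "0 < \<mu> j" unfolding \<mu>_def by (rule index_seq_pos[OF tau j(1)])
    moreover have "expo \<tau> (0, 0, 0) = 0" by (simp add: expo_def)
    ultimately show "q \<in> A - {(0, 0, 0)}" using j by (auto simp: A_def)
  qed
  have "sum f A = sum f (A - {(0, 0, 0)})"
    by (rule sum.mono_neutral_right) (use finA C(2) in \<open>auto simp: f_def\<close>)
  also have "\<dots> = (\<Sum>j\<in>{1..l}. sum f (B j))"
    unfolding AB
    by (rule sum.UNION_disjoint) (use finB index_seq_eq_iff[OF tau] in \<open>auto simp: B_def \<mu>_def\<close>)
  also have "\<dots> = (\<Sum>j=1..l. (\<Sum>q\<in>B j. C q) * t powr \<mu> j)"
    unfolding sum_distrib_right by (intro sum.cong) (auto simp: f_def B_def)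
  finally have sumA: "sum f A = (\<Sum>j=1..l. (\<Sum>q\<in>B j. C q) * t powr \<mu> j)" .
  have rest: "(f has_sum (V - sum f A)) (UNIV - A)"
    by (rule has_sum_Diff) (use V finA in \<open>auto simp: f_def\<close>)
  define c where "c = K * (t / \<rho>) powr \<mu> (Suc l)"
  have fle: "\<bar>f q\<bar> \<le> c * geom q" if q: "q \<in> UNIV - A" for q
  proof -
    have e: "\<mu> (Suc l) \<le> expo \<tau> q"
    proof -
      have "\<mu> l < expo \<tau> q" using q by (simp add: A_def)
      moreover have "0 \<le> \<mu> l" using index_seq_le_iff[OF tau, of 0 l] by (simp add: \<mu>_def)
      ultimately have "q \<noteq> (0, 0, 0)" by (auto simp: expo_def)
      then show ?thesis
        unfolding \<mu>_def using \<open>\<mu> l < expo \<tau> q\<close>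
        by (intro index_seq_Suc(3)[OF tau] expo_in_index_set[OF tau]) (auto simp: \<mu>_def)
    qed
    have "\<bar>f q\<bar> = \<bar>C q\<bar> * \<rho> powr expo \<tau> q * (t / \<rho>) powr expo \<tau> q"
      using t \<rho> by (simp add: f_def abs_mult powr_divide)
    also have "\<dots> \<le> (K * geom q) * (t / \<rho>) powr \<mu> (Suc l)"
    proof (rule mult_mono)
      show "\<bar>C q\<bar> * \<rho> powr expo \<tau> q \<le> K * geom q" by (rule C(1))
      show "(t / \<rho>) powr expo \<tau> q \<le> (t / \<rho>) powr \<mu> (Suc l)"
        using t \<rho> e by (intro powr_mono') auto
      have "0 \<le> \<bar>C q\<bar> * \<rho> powr expo \<tau> q" by simp
      then show "0 \<le> K * geom q" using C(1) by (rule order.trans)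
    qed simp
    finally show ?thesis by (simp add: c_def mult_ac)
  qed
  have sg: "geom summable_on (UNIV - A)" by (rule summable_on_subset[OF summable_geom]) auto
  have norm_sum: "(\<lambda>q. norm (f q)) summable_on (UNIV - A)"
    by (rule Infinite_Sum.abs_summable_on_comparison_test'[OF summable_on_cmult_right[OF sg, of c]]) (use fle in auto)
  have "\<bar>V - sum f A\<bar> \<le> infsum (\<lambda>q. norm (f q)) (UNIV - A)"
    using norm_has_sum_bound[OF has_sum_infsum[OF norm_sum] rest] by simp
  also have "\<dots> \<le> infsum (\<lambda>q. c * geom q) (UNIV - A)"
    by (rule infsum_mono[OF norm_sum summable_on_cmult_right[OF sg]]) (use fle in auto)
  also have "\<dots> = c * infsum geom (UNIV - A)" by (rule infsum_cmult_right) (rule sg)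
  also have "\<dots> \<le> c * infsum geom UNIV"
  proof (rule mult_left_mono)
    show "infsum geom (UNIV - A) \<le> infsum geom UNIV"
      by (rule infsum_mono2[OF sg summable_geom]) (auto simp: geom_def)
    have "0 \<le> \<bar>C (0, 0, 0)\<bar> * \<rho> powr expo \<tau> (0, 0, 0)" by simp
    also have "\<dots> \<le> K * geom (0, 0, 0)" by (rule C(1))
    finally have "0 \<le> K" by (simp add: geom_def)
    then show "0 \<le> c" by (simp add: c_def)
  qed
  also have "\<dots> = K * infsum geom UNIV * \<rho> powr - \<mu> (Suc l) * t powr \<mu> (Suc l)"
    using t \<rho> by (simp add: c_def powr_divide powr_minus field_simps)
  finally show ?thesis unfolding sumA B_def \<mu>_def .
qed

section \<open>The explicit solution\<close>

lemma sums_times_deriv: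
  fixes c :: "nat \<Rightarrow> complex"
  assumes f: "\<And>z. norm z < r \<Longrightarrow> (\<lambda>n. c n * z ^ n) sums f z" and z: "norm z < r"
  shows "(\<lambda>n. of_nat n * c n * z ^ n) sums (z * deriv f z)"
proof -
  have "f holomorphic_on ball 0 r"
    by (rule power_series_holomorphic[of 0 r c]) (use f in simp)
  then have "(f has_field_derivative deriv f z) (at z)"
    using z by (intro holomorphic_derivI[of f "ball 0 r"]) auto
  from sums_mult[OF termdiffs_sums_strong[OF f this z]] have "(\<lambda>n. z * (diffs c n * z ^ n)) sums (z * deriv f z)" .
  then have "(\<lambda>n. of_nat (Suc n) * c (Suc n) * z ^ Suc n) sums (z * deriv f z)"
    by (simp add: diffs_def mult_ac)
  then show ?thesis using sums_Suc_iff[of "\<lambda>n. of_nat n * c n * z ^ n" "z * deriv f z"] by simp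
qed

lemma powser_norm_summable:
  fixes c :: "nat \<Rightarrow> complex"
  assumes f: "\<And>z. norm z < r \<Longrightarrow> (\<lambda>n. c n * z ^ n) sums f z" and z: "norm z < r"
  shows "summable (\<lambda>n. norm (c n * z ^ n))"
proof -
  define w where "w = complex_of_real ((norm z + r) / 2)"
  have "0 \<le> r" using z norm_ge_zero[of z] by linarith
  then have "norm w = (norm z + r) / 2" unfolding w_def norm_of_real by simp
  then have w: "norm z < norm w" "norm w < r" using z by auto
  show ?thesis by (rule powser_insidea[OF sums_summable[OF f[OF w(2)]] w(1)])
qed

text \<open>The derivative of ln |g| comes from the logarithmic derivative of g, without choosing a
  branch of the logarithm.\<close>

lemma ln_norm_has_derivative:
  assumes "(g has_field_derivative g') (at z)" "g z \<noteq> 0"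
  shows "((\<lambda>z. ln (norm (g z))) has_derivative (\<lambda>v. Re (g' / g z * v))) (at z)"
proof -
  have "((\<lambda>z. norm (g z)) has_derivative (\<lambda>v. inner (g' * v) (sgn (g z)))) (at z)"
    using has_derivative_compose[OF assms(1)[unfolded has_field_derivative_def] has_derivative_norm[OF assms(2)]]
    by simp
  then have "((\<lambda>z. ln (norm (g z))) has_derivative (\<lambda>v. inner (g' * v) (sgn (g z)) / norm (g z))) (at z)"
    using assms(2) by (auto intro!: derivative_eq_intros simp: divide_inverse mult.commute)
  moreover have "inner (g' * v) (sgn (g z)) / norm (g z) = Re (g' / g z * v)" for v
  proof -
    have "inner (g' * v) (sgn (g z)) / norm (g z) = inner (g' * v) (g z) / (norm (g z))^2"
      by (simp add: sgn_div_norm power2_eq_square divide_inverse)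
    also have "inner (g' * v) (g z) = Re (g' * v * cnj (g z))" by (simp add: inner_complex_def)
    also have "Re (g' * v * cnj (g z)) / (norm (g z))^2 = Re (g' * v * cnj (g z) / of_real ((norm (g z))^2))"
      by (simp only: Re_divide_of_real)
    also have "g' * v * cnj (g z) / of_real ((norm (g z))^2) = g' / g z * v"
      unfolding complex_norm_square using assms(2) by (simp add: field_simps)
    finally show ?thesis .
  qed
  ultimately show ?thesis by simp
qed

text \<open>In the following \<open>f\<close> and \<open>g\<close> are such that \<open>F = z\<^bsup>\<tau>/2\<^esup> g\<close> is the multivalued developing map with
  \<open>F' = z\<^bsup>\<tau>/2 - 1\<^esup> f\<close>, and \<open>u = ln (8 \<bar>F'\<bar>\<^sup>2 / (1 + \<bar>F\<bar>\<^sup>2)\<^sup>2)\<close> is Liouville's formula; only the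
  single-valued \<open>\<bar>F\<bar>\<^sup>2 = \<bar>z\<bar>\<^sup>\<tau> \<bar>g\<bar>\<^sup>2\<close> occurs.\<close>

locale liouville_data =
  fixes \<tau> a \<rho> C :: real and \<gamma> :: "nat \<Rightarrow> complex"
  assumes tau: "\<tau> > 0" and rho: "\<rho> > 0" and gamma_0: "\<gamma> 0 = 0"
    and gamma_bound: "\<And>i. norm (\<gamma> i) * \<rho> ^ i \<le> C"
begin

definition L where "L z = (\<Sum>n. \<gamma> n * z ^ n)"

text \<open>Normalised so that 8 |f|^2 = e^a e^(Re L), the numerator in Liouville's formula without
  its power of |z|.\<close>

definition f where "f z = of_real (exp (a / 2) / sqrt 8) * exp (L z / 2)"

definition e where "e n = (deriv ^^ n) f 0 / fact n"

text \<open>The termwise solution of (\<tau>/2) g + z g' = f; the denominators are positive because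
  \<tau> > 0.\<close>

definition g where "g z = (\<Sum>n. e n / of_real (\<tau> / 2 + n) * z ^ n)"

lemma L_sums:
  assumes z: "norm z < \<rho>"
  shows "(\<lambda>n. \<gamma> n * z ^ n) sums L z"
  unfolding L_def
proof (rule summable_sums, rule summable_comparison_test')
  show "summable (\<lambda>n. C * (norm z / \<rho>) ^ n)"
    using z rho by (intro summable_mult summable_geometric) auto
  fix n
  have "norm (\<gamma> n * z ^ n) = norm (\<gamma> n) * \<rho> ^ n * (norm z / \<rho>) ^ n"
    using rho by (simp add: norm_mult norm_power power_divide)
  also have "\<dots> \<le> C * (norm z / \<rho>) ^ n" using gamma_bound rho by (intro mult_right_mono) auto
  finally show "norm (\<gamma> n * z ^ n) \<le> C * (norm z / \<rho>) ^ n" .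
qed

lemma L_holomorphic: "L holomorphic_on ball 0 \<rho>"
  by (rule power_series_holomorphic[of 0 \<rho> \<gamma>]) (use L_sums in simp)

lemma f_holomorphic: "f holomorphic_on ball 0 \<rho>"
  unfolding f_def by (intro holomorphic_intros L_holomorphic) auto

lemma norm_f: "(norm (f z))^2 = exp a * exp (Re (L z)) / 8"
proof -
  have "norm (f z) = exp (a / 2) / sqrt 8 * exp (Re (L z) / 2)"
    unfolding f_def norm_mult norm_of_real by simp
  then have "(norm (f z))^2 = (exp (a / 2))^2 / 8 * (exp (Re (L z) / 2))^2"
    by (simp add: power_mult_distrib power_divide)
  then show ?thesis by (simp add: exp_double[symmetric])
qed

lemma f_sums:
  assumes "norm z < \<rho>"
  shows "(\<lambda>n. e n * z ^ n) sums f z"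
  using holomorphic_power_series[OF f_holomorphic, of z] assms by (simp add: e_def)

lemma g_sums:
  assumes z: "norm z < \<rho>"
  shows "(\<lambda>n. e n / of_real (\<tau> / 2 + n) * z ^ n) sums g z"
  unfolding g_def
proof (rule summable_sums, rule summable_comparison_test')
  show "summable (\<lambda>n. norm (e n * z ^ n) * (2 / \<tau>))"
    by (intro summable_mult2 powser_norm_summable[OF f_sums z])
  fix n
  have "norm (e n / of_real (\<tau> / 2 + n) * z ^ n) = norm (e n * z ^ n) * (1 / (\<tau> / 2 + n))"
  proof -
    have "norm (complex_of_real (\<tau> / 2 + n)) = \<tau> / 2 + n"
      unfolding norm_of_real using tau by (intro abs_of_nonneg) auto
    then show ?thesis unfolding norm_mult norm_divide by simp
  qed
  also have "\<dots> \<le> norm (e n * z ^ n) * (2 / \<tau>)"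
    using tau by (intro mult_left_mono) (auto simp: field_simps)
  finally show "norm (e n / of_real (\<tau> / 2 + n) * z ^ n) \<le> norm (e n * z ^ n) * (2 / \<tau>)" .
qed

lemma g_holomorphic: "g holomorphic_on ball 0 \<rho>"
  by (rule power_series_holomorphic[of 0 \<rho> "\<lambda>n. e n / of_real (\<tau> / 2 + n)"]) (use g_sums in simp)

lemma g_ode:
  assumes z: "norm z < \<rho>"
  shows "of_real (\<tau> / 2) * g z + z * deriv g z = f z"
proof -
  have "(\<lambda>n. of_real (\<tau> / 2) * (e n / of_real (\<tau> / 2 + n) * z ^ n)
      + of_nat n * (e n / of_real (\<tau> / 2 + n)) * z ^ n) sums (of_real (\<tau> / 2) * g z + z * deriv g z)"
    by (intro sums_add sums_mult g_sums[OF z] sums_times_deriv[OF g_sums z])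
  moreover have "of_real (\<tau> / 2) * (e n / of_real (\<tau> / 2 + n) * z ^ n)
      + of_nat n * (e n / of_real (\<tau> / 2 + n)) * z ^ n = e n * z ^ n" for n
  proof -
    define m where "m = complex_of_real (\<tau> / 2 + n)"
    have "0 < \<tau> / 2 + real n" using tau by (intro add_pos_nonneg) auto
    then have "m \<noteq> 0" unfolding m_def of_real_eq_0_iff by simp
    have "of_real (\<tau> / 2) * (e n / m * z ^ n) + of_nat n * (e n / m) * z ^ n
       = (of_real (\<tau> / 2) + of_nat n) * (e n / m * z ^ n)" by (simp only: distrib_right mult.assoc)
    also have "of_real (\<tau> / 2) + of_nat n = m" by (simp add: m_def)
    finally show ?thesis unfolding m_def[symmetric] using \<open>m \<noteq> 0\<close> by simp
  qed
  ultimately have "(\<lambda>n. e n * z ^ n) sums (of_real (\<tau> / 2) * g z + z * deriv g z)" by simp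
  then show ?thesis using f_sums[OF z] sums_unique2 by blast
qed

lemma g_0: "g 0 \<noteq> 0"
proof -
  have "f 0 \<noteq> 0" by (simp add: f_def)
  then show ?thesis using g_ode[of 0] rho tau by auto
qed

text \<open>The argument of the logarithm is written as 1 plus an exponential to fit
  \<open>laplacian_softplus\<close>. Where z and \<open>g z\<close> are nonzero the exponential is
  |z|^\<tau> |g|^2, the form used in \<open>v\<close>.\<close>

definition u where "u z = ((\<tau> - 2) * ln (norm z) + a + Re (L z))
  - 2 * ln (1 + exp (\<tau> * ln (norm z) + 2 * ln (norm (g z))))"

definition v where "v z = Re (L z) - 2 * ln (1 + norm z powr \<tau> * (norm (g z))^2)"

lemma u_eq:
  assumes "z \<noteq> 0" "g z \<noteq> 0"
  shows "exp (\<tau> * ln (norm z) + 2 * ln (norm (g z))) = norm z powr \<tau> * (norm (g z))^2"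
    and "u z = (\<tau> - 2) * ln (norm z) + a + v z"
proof -
  have "exp (2 * ln (norm (g z))) = (norm (g z))^2" using assms by (simp add: exp_double)
  then show 1: "exp (\<tau> * ln (norm z) + 2 * ln (norm (g z))) = norm z powr \<tau> * (norm (g z))^2"
    using assms by (simp add: exp_add powr_def)
  show "u z = (\<tau> - 2) * ln (norm z) + a + v z" by (simp add: u_def v_def 1)
qed

lemma exp_v: "exp (v z) = exp (Re (L z)) / (1 + norm z powr \<tau> * (norm (g z))^2)^2"
proof -
  have pos: "0 < 1 + norm z powr \<tau> * (norm (g z))^2" by (intro add_pos_nonneg) auto
  have "exp (v z) = exp (Re (L z)) / exp (2 * ln (1 + norm z powr \<tau> * (norm (g z))^2))"
    by (simp add: v_def exp_diff)
  then show ?thesis unfolding exp_double using pos by simp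
qed

text \<open>Here \<open>F\<close> is twice the logarithmic derivative of the developing map: the
  equation for \<open>g\<close> collapses \<tau>/z + 2 g'/g to 2 f / (z g). With x = |z|^\<tau>
  |g|^2, the product x |F|^2 equals 4 |z|^(\<tau> - 2) |f|^2, in which \<open>g\<close> no longer
  occurs.\<close>

lemma liouville_solution_u:
  assumes r: "0 < r" "r \<le> \<rho>" and g: "\<And>z. norm z < r \<Longrightarrow> g z \<noteq> 0"
  shows "liouville_solution r u"
proof -
  define S where "S = ball (0::complex) r - {0}"
  have S: "open S" "\<And>z. z \<in> S \<Longrightarrow> norm z < \<rho> \<and> z \<noteq> 0 \<and> g z \<noteq> 0"
    using r g by (auto simp: S_def)
  have holo: "L holomorphic_on S" "f holomorphic_on S" "g holomorphic_on S"
    by (rule holomorphic_on_subset[OF L_holomorphic] holomorphic_on_subset[OF f_holomorphic]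
        holomorphic_on_subset[OF g_holomorphic]; use S in auto)+
  define G where "G z = of_real (\<tau> - 2) / z + deriv L z" for z
  define F where "F z = 2 * f z / (z * g z)" for z
  have G: "G holomorphic_on S" unfolding G_def
    by (intro holomorphic_intros holo S) (use S in auto)
  have F: "F holomorphic_on S" unfolding F_def
    by (intro holomorphic_intros holo S) (use S in auto)
  have ln_norm: "((\<lambda>z. ln (norm z)) has_derivative (\<lambda>h. Re (1 / z * h))) (at z)" if "z \<noteq> 0" for z :: complex
    using ln_norm_has_derivative[of "\<lambda>z. z" 1 z] that by simp
  have d1: "((\<lambda>z. (\<tau> - 2) * ln (norm z) + a + Re (L z)) has_derivative (\<lambda>h. Re (G z * h))) (at z)"
    if z: "z \<in> S" for z
  proof -
    have "(L has_derivative (\<lambda>h. deriv L z * h)) (at z)"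
      using holomorphic_derivI[OF holo(1) S(1) z] by (simp add: has_field_derivative_def)
    then have "((\<lambda>z. Re (L z)) has_derivative (\<lambda>h. Re (deriv L z * h))) (at z)"
      by (rule bounded_linear.has_derivative[OF bounded_linear_Re])
    then have "((\<lambda>z. (\<tau> - 2) * ln (norm z) + a + Re (L z)) has_derivative
        (\<lambda>h. (\<tau> - 2) * Re (1 / z * h) + 0 + Re (deriv L z * h))) (at z)"
      using S(2)[OF z] by (intro has_derivative_add has_derivative_mult_right has_derivative_const ln_norm) auto
    moreover have "(\<tau> - 2) * Re (1 / z * h) + 0 + Re (deriv L z * h) = Re (G z * h)" for h
    proof -
      have "G z * h = of_real (\<tau> - 2) * (1 / z * h) + deriv L z * h" by (simp add: G_def distrib_right)
      moreover have "Re (of_real x * w) = x * Re w" for x w by simp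
      ultimately show ?thesis by (simp only: plus_complex.sel add_0_right)
    qed
    ultimately show ?thesis by (simp only:)
  qed
  have d2: "((\<lambda>z. \<tau> * ln (norm z) + 2 * ln (norm (g z))) has_derivative (\<lambda>h. Re (F z * h))) (at z)"
    if z: "z \<in> S" for z
  proof -
    have nz: "z \<noteq> 0" "g z \<noteq> 0" "norm z < \<rho>" using S(2)[OF z] by auto
    have "((\<lambda>z. \<tau> * ln (norm z) + 2 * ln (norm (g z))) has_derivative
        (\<lambda>h. \<tau> * Re (1 / z * h) + 2 * Re (deriv g z / g z * h))) (at z)"
      using nz holomorphic_derivI[OF holo(3) S(1) z]
      by (intro has_derivative_add has_derivative_mult_right ln_norm ln_norm_has_derivative) auto
    moreover have "\<tau> * Re (1 / z * h) + 2 * Re (deriv g z / g z * h) = Re (F z * h)" for h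
    proof -
      have "F z = 2 * (of_real (\<tau> / 2) * g z + z * deriv g z) / (z * g z)"
        unfolding F_def g_ode[OF nz(3)] by simp
      also have "\<dots> = of_real \<tau> * (1 / z) + of_real 2 * (deriv g z / g z)"
        using nz by (simp add: field_simps)
      finally have "F z * h = of_real \<tau> * (1 / z * h) + of_real 2 * (deriv g z / g z * h)"
        by (simp only: distrib_right mult.assoc)
      moreover have "Re (of_real x * w) = x * Re w" for x w by simp
      ultimately show ?thesis by (simp only: plus_complex.sel)
    qed
    ultimately show ?thesis by (simp only:)
  qed
  have u: "u = (\<lambda>z. ((\<tau> - 2) * ln (norm z) + a + Re (L z))
      - 2 * ln (1 + exp (\<tau> * ln (norm z) + 2 * ln (norm (g z)))))" by (simp add: u_def fun_eq_iff)
  show ?thesis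
    unfolding liouville_solution_def S_def[symmetric]
  proof (intro conjI ballI)
    show "laplacian u z + exp (u z) = 0" if z: "z \<in> S" for z
    proof -
      have nz: "z \<noteq> 0" "g z \<noteq> 0" using S(2)[OF z] by auto
      define x where "x = norm z powr \<tau> * (norm (g z))^2"
      have "laplacian u z = - 2 * x * (norm (F z))^2 / (1 + x)^2"
        unfolding u x_def u_eq(1)[OF nz, symmetric] by (rule laplacian_softplus(2)[OF S(1) G F d1 d2 z])
      also have "- 2 * x * (norm (F z))^2 = - 8 * norm z powr (\<tau> - 2) * (norm (f z))^2"
      proof -
        have "norm z powr \<tau> = norm z powr (\<tau> - 2) * (norm z)^2"
          using nz by (simp add: powr_diff powr_realpow[of _ 2, simplified])
        then show ?thesis using nz
          by (simp add: x_def F_def norm_divide norm_mult power_divide power_mult_distrib)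
      qed
      also have "\<dots> / (1 + x)^2 = - (norm z powr (\<tau> - 2) * exp a * (exp (Re (L z)) / (1 + x)^2))"
        by (simp add: norm_f)
      also have "norm z powr (\<tau> - 2) * exp a * (exp (Re (L z)) / (1 + x)^2) = exp (u z)"
        unfolding u_eq(2)[OF nz] exp_add exp_v x_def[symmetric] using nz by (simp add: powr_def)
      finally show ?thesis by simp
    qed
    show "smooth_on u S"
    proof -
      have S': "of_real (r / 2) \<in> S" using r by (simp add: S_def)
      show ?thesis unfolding u by (rule laplacian_softplus(1)[OF S(1) G F d1 d2 S'])
    qed
  qed
qed

end

section \<open>Triple series of the explicit solution\<close>

context liouville_data
begin

abbreviation "mu \<equiv> index_seq \<tau>"

abbreviation "deg \<equiv> expo \<tau>"

abbreviation "pt t h \<equiv> complex_of_real t * cis h"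

abbreviation "mode t h q \<equiv> complex_of_real (t powr deg q) * cis (h * of_int (freq q))"

definition b where "b p n = (deriv ^^ n) (\<lambda>z. g z ^ p) 0 / fact n"

text \<open>The Taylor coefficients of p g^(p-1) f, because the equation for \<open>g\<close> gives
  (p\<tau>/2 + z d/dz) g^p = p g^(p-1) f. The same factors split deg^2 - freq^2 = 4 (p\<tau>/2 +
  i)(p\<tau>/2 + k), so multiplying a nonharmonic coefficient by it replaces \<open>b\<close> by
  \<open>d\<close>.\<close>

definition d where "d p n = of_real (real p * \<tau> / 2 + real n) * b p n"

text \<open>For \<open>p = 0\<close> the factor \<open>2 / p\<close> is \<open>0\<close>, so only the harmonic part is left.\<close>

definition c :: "nat \<times> nat \<times> nat \<Rightarrow> complex" where
  "c = (\<lambda>(p, i, k). (if p = 0 \<and> k = 0 then \<gamma> i else 0)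
    + of_real (2 * (- 1) ^ p / real p) * (b p i * cnj (b p k)))"

definition T where "T q h = Re (c q * cis (h * of_int (freq q)))"

lemma b_sums:
  assumes "norm z < \<rho>"
  shows "(\<lambda>n. b p n * z ^ n) sums (g z ^ p)"
proof -
  have "(\<lambda>z. g z ^ p) holomorphic_on ball 0 \<rho>" by (intro holomorphic_intros g_holomorphic)
  from holomorphic_power_series[OF this, of z] show ?thesis using assms by (simp add: b_def)
qed

lemma d_sums:
  assumes z: "norm z < \<rho>"
  shows "(\<lambda>n. d p n * z ^ n) sums (of_nat p * g z ^ (p - 1) * f z)"
proof -
  have "(g has_field_derivative deriv g z) (at z)"
    using z by (intro holomorphic_derivI[OF g_holomorphic]) auto
  then have "((\<lambda>z. g z ^ p) has_field_derivative of_nat p * g z ^ (p - 1) * deriv g z) (at z)"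
    by (auto intro!: derivative_eq_intros)
  then have dg: "deriv (\<lambda>z. g z ^ p) z = of_nat p * g z ^ (p - 1) * deriv g z"
    by (rule DERIV_imp_deriv)
  have "(\<lambda>n. of_real (real p * \<tau> / 2) * (b p n * z ^ n) + of_nat n * b p n * z ^ n) sums
      (of_real (real p * \<tau> / 2) * g z ^ p + z * deriv (\<lambda>z. g z ^ p) z)"
    by (intro sums_add sums_mult b_sums z sums_times_deriv[OF b_sums z])
  moreover have "of_real (real p * \<tau> / 2) * (b p n * z ^ n) + of_nat n * b p n * z ^ n = d p n * z ^ n" for n
    by (simp add: d_def algebra_simps)
  moreover have "of_real (real p * \<tau> / 2) * g z ^ p + z * deriv (\<lambda>z. g z ^ p) z
     = of_nat p * g z ^ (p - 1) * (of_real (\<tau> / 2) * g z + z * deriv g z)"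
    unfolding dg by (cases p) (simp_all add: algebra_simps)
  ultimately show ?thesis unfolding g_ode[OF z] by simp
qed

text \<open>Cauchy's inequality for g^p on the radius \<open>R\<close>. The extra factor in
  \<open>d\<close> is at most (1 + \<tau>/2)^p 2^n by Bernoulli and n + 1 \<le> 2^n; enlarging
  \<open>M\<close> to \<open>B\<close> and halving the radius pays for it.\<close>

lemma coefficient_bounds:
  obtains \<sigma> B where "0 < \<sigma>" "\<sigma> < \<rho>" "0 < B"
    "\<And>p n. norm (b p n) \<le> B ^ p / \<sigma> ^ n" "\<And>p n. norm (d p n) \<le> B ^ p / \<sigma> ^ n"
    "\<And>n. norm (\<gamma> n) \<le> C / \<sigma> ^ n" "\<And>z. norm z \<le> \<sigma> \<Longrightarrow> norm (g z) \<le> B"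
    "\<And>z. norm z < \<sigma> \<Longrightarrow> g z \<noteq> 0"
proof -
  have gc: "continuous_on (ball 0 \<rho>) g" by (rule holomorphic_on_imp_continuous_on[OF g_holomorphic])
  then have "isCont g 0" using rho by (simp add: continuous_on_eq_continuous_at)
  then have "\<forall>\<^sub>F z in nhds 0. g z \<noteq> 0"
    using g_0 by (intro tendsto_imp_eventually_ne[of g "g 0"]) (auto simp: isCont_def tendsto_at_iff_tendsto_nhds)
  then obtain \<delta> where \<delta>: "\<delta> > 0" "\<And>z. norm z < \<delta> \<Longrightarrow> g z \<noteq> 0"
    unfolding eventually_nhds_metric by auto
  define R where "R = \<rho> / 2"
  have R: "0 < R" "R < \<rho>" using rho by (auto simp: R_def)
  have cb: "cball 0 R \<subseteq> ball (0::complex) \<rho>" using R by auto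
  have "compact (g ` cball 0 R)"
    by (intro compact_continuous_image continuous_on_subset[OF gc cb]) simp
  then obtain M where M: "\<And>z. norm z \<le> R \<Longrightarrow> norm (g z) \<le> M" "M > 0"
    using compact_imp_bounded bounded_pos by (metis (no_types, lifting) image_eqI mem_cball_0)
  have b: "norm (b p n) \<le> M ^ p / R ^ n" for p n
  proof -
    have "norm ((deriv ^^ n) (\<lambda>z. g z ^ p) 0) \<le> fact n * M ^ p / R ^ n"
    proof (rule Cauchy_inequality)
      show "(\<lambda>z. g z ^ p) holomorphic_on ball 0 R"
        using R by (intro holomorphic_intros holomorphic_on_subset[OF g_holomorphic]) auto
      show "continuous_on (cball 0 R) (\<lambda>z. g z ^ p)"
        by (intro continuous_intros continuous_on_subset[OF gc cb])
      show "norm (g x ^ p) \<le> M ^ p" if "norm (0 - x) = R" for x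
        unfolding norm_power using that by (intro power_mono M) auto
    qed (use R in auto)
    then show ?thesis by (simp add: b_def norm_divide field_simps)
  qed
  define B where "B = (1 + \<tau> / 2) * M"
  define \<sigma> where "\<sigma> = min (R / 2) \<delta>"
  have \<sigma>: "0 < \<sigma>" "\<sigma> \<le> R / 2" "\<sigma> \<le> \<delta>" "\<sigma> < \<rho>" using R \<delta> by (auto simp: \<sigma>_def)
  have "M * 1 \<le> M * (1 + \<tau> / 2)" using tau M(2) by (intro mult_left_mono) auto
  then have B: "M \<le> B" "0 < B" using M(2) by (auto simp: B_def mult.commute)
  show ?thesis
  proof (rule that[of \<sigma> B])
    show "0 < \<sigma>" "\<sigma> < \<rho>" "0 < B" by fact+
    have inv: "1 / R ^ n \<le> 1 / \<sigma> ^ n" "2 ^ n / R ^ n \<le> 1 / \<sigma> ^ n" for n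
    proof -
      have "\<sigma> ^ n \<le> R ^ n" "\<sigma> ^ n \<le> (R / 2) ^ n" using \<sigma> R by (auto intro!: power_mono)
      then have "1 / R ^ n \<le> 1 / \<sigma> ^ n" "1 / (R / 2) ^ n \<le> 1 / \<sigma> ^ n"
        using \<sigma> R by (auto intro!: divide_left_mono)
      then show "1 / R ^ n \<le> 1 / \<sigma> ^ n" "2 ^ n / R ^ n \<le> 1 / \<sigma> ^ n" by (simp_all add: power_divide)
    qed
    fix p n
    have "norm (b p n) \<le> M ^ p * (1 / R ^ n)" using b by simp
    also have "\<dots> \<le> B ^ p * (1 / \<sigma> ^ n)" using B M(2) R inv by (intro mult_mono power_mono) auto
    finally show "norm (b p n) \<le> B ^ p / \<sigma> ^ n" by simp
    have "norm (d p n) = (real p * \<tau> / 2 + real n) * norm (b p n)"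
      unfolding d_def norm_mult norm_of_real using tau by (intro arg_cong2[where f = "(*)"] abs_of_nonneg) auto
    also have "\<dots> \<le> ((1 + \<tau> / 2) ^ p * 2 ^ n) * (M ^ p / R ^ n)"
    proof (intro mult_mono b)
      have "real p * \<tau> / 2 + real n \<le> (1 + real p * (\<tau> / 2)) * (1 + real n)"
      proof -
        define w where "w = real p * \<tau> / 2"
        have "0 \<le> w" using tau by (simp add: w_def)
        then have "w + real n \<le> (1 + w) * (1 + real n)" by (simp add: algebra_simps)
        then show ?thesis by (simp add: w_def)
      qed
      also have "\<dots> \<le> (1 + \<tau> / 2) ^ p * 2 ^ n"
      proof (intro mult_mono)
        show "1 + real p * (\<tau> / 2) \<le> (1 + \<tau> / 2) ^ p" using tau by (intro Bernoulli_inequality) auto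
        have "Suc n \<le> 2 ^ n" by (rule Suc_leI) (rule less_exp)
        then show "1 + real n \<le> 2 ^ n" by (metis of_nat_Suc of_nat_le_iff of_nat_numeral of_nat_power)
      qed (use tau in auto)
      finally show "real p * \<tau> / 2 + real n \<le> (1 + \<tau> / 2) ^ p * 2 ^ n" .
    qed (use tau in auto)
    also have "\<dots> = B ^ p * (2 ^ n / R ^ n)" by (simp add: B_def power_mult_distrib)
    also have "\<dots> \<le> B ^ p * (1 / \<sigma> ^ n)" using B inv by (intro mult_left_mono) auto
    finally show "norm (d p n) \<le> B ^ p / \<sigma> ^ n" by simp
    have "norm (\<gamma> n) * \<sigma> ^ n \<le> norm (\<gamma> n) * \<rho> ^ n" using \<sigma> by (intro mult_left_mono power_mono) auto
    also have "\<dots> \<le> C" by (rule gamma_bound)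
    finally show "norm (\<gamma> n) \<le> C / \<sigma> ^ n" using \<sigma> by (simp add: pos_le_divide_eq)
  next
    fix z :: complex
    show "norm (g z) \<le> B" if "norm z \<le> \<sigma>" using M(1)[of z] that \<sigma> R B by linarith
    show "g z \<noteq> 0" if "norm z < \<sigma>" using \<delta>(2)[of z] that \<sigma> by simp
  qed
qed

lemma C_nonneg: "0 \<le> C"
  using gamma_bound[of 0] by (simp add: gamma_0)

lemma term_eq:
  fixes t h :: real
  assumes "0 < t"
  defines "z \<equiv> of_real t * cis h"
  shows "of_real (t powr (real p * \<tau>)) * (z ^ i * cnj (z ^ k))
    = mode t h (p, i, k)"
proof -
  have "z ^ i * cnj (z ^ k) = of_real (t ^ i * t ^ k) * (cis (real i * h) * cis (- (real k * h)))"
    by (simp add: z_def power_mult_distrib Complex.DeMoivre cis_cnj mult_ac)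
  also have "cis (real i * h) * cis (- (real k * h)) = cis (h * of_int (freq (p, i, k)))"
    unfolding cis_mult by (simp add: freq_def algebra_simps)
  finally have "of_real (t powr (real p * \<tau>)) * (z ^ i * cnj (z ^ k))
     = of_real (t powr (real p * \<tau>) * (t ^ i * t ^ k)) * cis (h * of_int (freq (p, i, k)))" by simp
  also have "t powr (real p * \<tau>) * (t ^ i * t ^ k) = t powr deg (p, i, k)"
    using assms by (simp add: expo_def powr_add powr_realpow)
  finally show ?thesis .
qed

lemma Ln_series_real:
  fixes x :: real
  assumes "\<bar>x\<bar> < 1"
  shows "(\<lambda>n. - ((- x) ^ n) / real n) sums ln (1 + x)"
proof -
  have "(\<lambda>n. - ((- complex_of_real x) ^ n) / of_nat n) sums ln (1 + complex_of_real x)"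
    using assms by (intro Ln_series') simp
  also have "ln (1 + complex_of_real x) = of_real (ln (1 + x))"
    using assms Ln_of_real[of "1 + x"] by simp
  also have "(\<lambda>n. - ((- complex_of_real x) ^ n) / of_nat n) = (\<lambda>n. of_real (- ((- x) ^ n) / real n))"
    by simp
  finally show ?thesis unfolding sums_of_real_iff .
qed

text \<open>With x = |z|^\<tau> |g|^2, the series of \<open>v\<close> comes from that of -2 ln (1 +
  x). The second series comes from -8 t^\<tau> |f|^2 / (1 + x)^2, expanded independently;
  \<open>s_eq\<close> identifies its coefficients with those expected from the Laplacian.\<close>

theorem expansion:
  obtains r K where "0 < r" "r \<le> 1" "liouville_solution r u"
    "\<And>q. norm (c q) * r powr deg q \<le> K * geom q"
    "\<And>q. \<bar>(deg q)^2 - (of_int (freq q))^2\<bar> * norm (c q) * r powr deg q \<le> K * geom q"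
    "\<And>t h. 0 < t \<Longrightarrow> t \<le> r \<Longrightarrow>
      ((\<lambda>q. T q h * t powr deg q) has_sum v (pt t h)) UNIV"
    "\<And>t h. 0 < t \<Longrightarrow> t \<le> r \<Longrightarrow>
      ((\<lambda>q. ((deg q)^2 - (of_int (freq q))^2) * T q h * t powr deg q)
        has_sum (- exp a * t powr \<tau> * exp (v (pt t h)))) UNIV"
    "\<And>z. z \<in> ball 0 r - {0} \<Longrightarrow> u z = (\<tau> - 2) * ln (norm z) + a + v z"
proof -
  obtain \<sigma> B where \<sigma>: "0 < \<sigma>" "\<sigma> < \<rho>" and B: "0 < B"
    and bb: "\<And>p n. norm (b p n) \<le> B ^ p / \<sigma> ^ n" and db: "\<And>p n. norm (d p n) \<le> B ^ p / \<sigma> ^ n"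
    and \<gamma>b: "\<And>n. norm (\<gamma> n) \<le> C / \<sigma> ^ n" and gb: "\<And>z. norm z \<le> \<sigma> \<Longrightarrow> norm (g z) \<le> B"
    and g0: "\<And>z. norm z < \<sigma> \<Longrightarrow> g z \<noteq> 0" using coefficient_bounds by metis
  \<comment> \<open>The last two bounds make r / \<sigma> and B^2 r^\<tau> at most 1/2, the ratios
    of \<open>geom\<close>; r \<le> 1 is required by \<open>expansion_coefficients\<close>.\<close>
  define r where "r = Min {1, \<sigma> / 2, (1 / (2 * B^2)) powr (1 / \<tau>)}"
  have r: "0 < r" "r \<le> 1" "r \<le> \<sigma> / 2" "r \<le> (1 / (2 * B^2)) powr (1 / \<tau>)"
    using \<sigma> B unfolding r_def by (auto intro: Min_le)
  have "r powr \<tau> \<le> ((1 / (2 * B^2)) powr (1 / \<tau>)) powr \<tau>" using r tau by (intro powr_mono2) auto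
  also have "\<dots> = 1 / (2 * B^2)" using tau B by (simp add: powr_powr)
  finally have rB: "B^2 * r powr \<tau> \<le> 1 / 2" using B by (simp add: field_simps)
  have general: "x * t powr deg (p, i, k) \<le> M * geom (p, i, k)"
    if x: "x \<le> M * ((B^2) ^ p / (\<sigma> ^ i * \<sigma> ^ k))" and M: "0 \<le> M" and t: "0 < t" "t \<le> r"
    for x M t p i k
  proof -
    have "x * t powr deg (p, i, k) \<le> M * ((B^2) ^ p / (\<sigma> ^ i * \<sigma> ^ k)) * t powr deg (p, i, k)"
      using x by (intro mult_right_mono) auto
    also have te: "t powr deg (p, i, k) = (t powr \<tau>) ^ p * (t ^ i * t ^ k)"
      using t by (simp add: expo_def powr_add powr_realpow powr_power)
    also have "M * ((B^2) ^ p / (\<sigma> ^ i * \<sigma> ^ k)) * ((t powr \<tau>) ^ p * (t ^ i * t ^ k))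
       = M * ((B^2 * t powr \<tau>) ^ p * ((t / \<sigma>) ^ i * (t / \<sigma>) ^ k))"
      by (simp add: power_mult_distrib power_divide)
    also have "\<dots> \<le> M * ((1/2) ^ p * ((1/2) ^ i * (1/2) ^ k))"
    proof (intro mult_left_mono mult_mono power_mono M)
      have "B^2 * t powr \<tau> \<le> B^2 * r powr \<tau>" using t tau by (intro mult_left_mono powr_mono2) auto
      then show "B^2 * t powr \<tau> \<le> 1 / 2" using rB by simp
      show "t / \<sigma> \<le> 1 / 2" "t / \<sigma> \<le> 1 / 2" using t r \<sigma> by (simp_all add: field_simps)
    qed (use t \<sigma> in auto)
    finally show ?thesis by (simp add: geom_def te)
  qed
  \<comment> \<open>\<open>C\<close> accounts for the harmonic part; 8 bounds the scalar factors of
    both the logarithmic and the differentiated series.\<close>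
  define K where "K = C + 8"
  have K: "0 \<le> C" "0 \<le> K" using C_nonneg by (auto simp: K_def)
  have pair: "norm (of_real y * (x i * cnj (x k))) \<le> M * ((B^2) ^ p / (\<sigma> ^ i * \<sigma> ^ k))"
    if "\<And>n. norm (x n) \<le> B ^ p / \<sigma> ^ n" "\<bar>y\<bar> \<le> M" for x :: "nat \<Rightarrow> complex" and y M p i k
  proof -
    have "norm (of_real y * (x i * cnj (x k))) = \<bar>y\<bar> * (norm (x i) * norm (x k))"
      by (simp add: norm_mult)
    also have "\<dots> \<le> M * (B ^ p / \<sigma> ^ i * (B ^ p / \<sigma> ^ k))"
      using that \<sigma> B by (intro mult_mono) auto
    also have "\<dots> = M * ((B^2) ^ p / (\<sigma> ^ i * \<sigma> ^ k))"
      by (simp add: power2_eq_square power_mult_distrib)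
    finally show ?thesis .
  qed
  have two: "\<bar>2 * (- 1) ^ p / real p\<bar> \<le> 2" "\<bar>8 * (- 1) ^ p / real p\<bar> \<le> 8" for p
    by (cases "p = 0"; simp add: abs_mult divide_le_eq)+
  have cb: "norm (c (p, i, k)) \<le> K * ((B^2) ^ p / (\<sigma> ^ i * \<sigma> ^ k))" for p i k
  proof -
    have "norm (if p = 0 \<and> k = 0 then \<gamma> i else 0) \<le> C * ((B^2) ^ p / (\<sigma> ^ i * \<sigma> ^ k))"
      using \<gamma>b[of i] K \<sigma> B by (auto intro!: mult_nonneg_nonneg divide_nonneg_nonneg)
    moreover have "norm (of_real (2 * (- 1) ^ p / real p) * (b p i * cnj (b p k)))
        \<le> 8 * ((B^2) ^ p / (\<sigma> ^ i * \<sigma> ^ k))" using two[of p] by (intro pair bb) linarith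
    ultimately have "norm (c (p, i, k)) \<le> C * ((B^2) ^ p / (\<sigma> ^ i * \<sigma> ^ k)) + 8 * ((B^2) ^ p / (\<sigma> ^ i * \<sigma> ^ k))"
      unfolding c_def prod.case by (rule norm_triangle_mono)
    then show ?thesis by (simp only: K_def distrib_right)
  qed
  \<comment> \<open>For p = 0 both sides vanish: either k = 0 and the degree equals the frequency (a
    harmonic term), or the coefficient itself is zero.\<close>
  have s_eq: "of_real ((deg (p, i, k))^2 - (of_int (freq (p, i, k)))^2) * c (p, i, k)
      = of_real (8 * (- 1) ^ p / real p) * (d p i * cnj (d p k))" for p i k
  proof (cases "p = 0")
    case True
    then show ?thesis by (cases "k = 0") (simp_all add: c_def expo_def freq_def)
  next
    case False
    define m n where "m = real p * \<tau> / 2 + real i" and "n = real p * \<tau> / 2 + real k"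
    have mn: "(deg (p, i, k))^2 - (of_int (freq (p, i, k)))^2 = 4 * (m * n)"
      by (simp add: expo_def freq_def m_def n_def power2_eq_square algebra_simps)
    have "c (p, i, k) = of_real (2 * (- 1) ^ p / real p) * (b p i * cnj (b p k))"
      using False by (simp add: c_def)
    moreover have "8 * (- 1) ^ p / real p = 4 * (2 * (- 1) ^ p / real p)" by simp
    ultimately show ?thesis
      unfolding mn d_def m_def[symmetric] n_def[symmetric]
      by (simp only: of_real_mult complex_cnj_mult complex_cnj_complex_of_real mult_ac)
  qed
  have s_norm: "norm (of_real (8 * (- 1) ^ p / real p) * (d p i * cnj (d p k)))
      \<le> K * ((B^2) ^ p / (\<sigma> ^ i * \<sigma> ^ k))" for p i k
    using two[of p] K by (intro pair db) (simp add: K_def)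
  have sb: "\<bar>(deg q)^2 - (of_int (freq q))^2\<bar> * norm (c q) \<le> K * ((B^2) ^ p / (\<sigma> ^ i * \<sigma> ^ k))"
    if "q = (p, i, k)" for q p i k
    using s_norm[of p i k] unfolding s_eq[symmetric] that by (simp only: norm_mult norm_of_real)
  have sum_geom: "F summable_on UNIV" if "\<And>q. norm (F q) \<le> K * geom q" for F :: "nat \<times> nat \<times> nat \<Rightarrow> complex"
    by (rule abs_summable_summable, rule Infinite_Sum.abs_summable_on_comparison_test'[OF summable_on_cmult_right[OF summable_geom]])
      (use that in blast)
  have point: "norm (pt t h) = t" "norm (pt t h) < \<sigma>" "norm (pt t h) < \<rho>"
    if "0 < t" "t \<le> r" for t h :: real
    using that r \<sigma> by (auto simp: norm_mult)
  have x_le: "t powr \<tau> * (norm (g (pt t h)))^2 \<le> 1 / 2" if t: "0 < t" "t \<le> r" for t h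
  proof -
    have "t powr \<tau> * (norm (g (pt t h)))^2 \<le> r powr \<tau> * B^2"
      using t tau point[OF t, of h] by (intro mult_mono powr_mono2 power_mono gb) auto
    then show ?thesis using rB by (simp add: mult.commute)
  qed
  have pair_sum: "((\<lambda>(p, i, k). of_real (y p) * (x p i * cnj (x p k)) *
      mode t h (p, i, k)) has_sum S) UNIV"
    if t: "0 < t" "t \<le> r" and y: "\<And>p. \<bar>y p\<bar> \<le> 8" and x: "\<And>p n. norm (x p n) \<le> B ^ p / \<sigma> ^ n"
      and P: "\<And>p z. norm z < \<rho> \<Longrightarrow> (\<lambda>n. x p n * z ^ n) sums P p z"
      and S: "(\<lambda>p. of_real (y p * t powr (real p * \<tau>)) *
          (P p (pt t h) * cnj (P p (pt t h)))) sums S"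
    for t h S and y :: "nat \<Rightarrow> real" and x :: "nat \<Rightarrow> nat \<Rightarrow> complex" and P
  proof -
    define z where "z = pt t h"
    have nz: "norm z < \<rho>" using point[OF t] by (auto simp: z_def)
    define F where "F = (\<lambda>(p, i, k). of_real (y p * t powr (real p * \<tau>)) * ((x p i * z ^ i) * cnj (x p k * z ^ k)))"
    have F: "F (p, i, k) = of_real (y p) * (x p i * cnj (x p k)) *
      mode t h (p, i, k)" for p i k
    proof -
      have "F (p, i, k) = of_real (y p) * (x p i * cnj (x p k)) * (of_real (t powr (real p * \<tau>)) * (z ^ i * cnj (z ^ k)))"
        by (simp add: F_def mult_ac)
      then show ?thesis unfolding z_def term_eq[OF t(1)] .
    qed
    have "F summable_on UNIV"
    proof (rule sum_geom)
      fix q :: "nat \<times> nat \<times> nat"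
      obtain p i k where q: "q = (p, i, k)" by (cases q)
      have "norm (F q) = norm (of_real (y p) * (x p i * cnj (x p k))) * t powr deg (p, i, k)"
        unfolding q F norm_mult[of "of_real (y p) * (x p i * cnj (x p k))"] by (simp add: norm_mult)
      also have "\<dots> \<le> K * geom (p, i, k)"
      proof (rule general[OF _ K(2) t])
        show "norm (of_real (y p) * (x p i * cnj (x p k))) \<le> K * ((B^2) ^ p / (\<sigma> ^ i * \<sigma> ^ k))"
          using y[of p] K(1) by (intro pair x) (simp add: K_def)
      qed
      finally show "norm (F q) \<le> K * geom q" by (simp add: q)
    qed
    then have "(F has_sum S) UNIV"
      unfolding F_def
      by (intro has_sum_triple_product[where P = "\<lambda>p. P p z"] norm_summable_imp_has_sum
          powser_norm_summable[OF P nz] P nz S[folded z_def])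
    moreover have "F = (\<lambda>(p, i, k). of_real (y p) * (x p i * cnj (x p k)) *
      mode t h (p, i, k))"
      unfolding fun_eq_iff split_paired_All prod.case using F by blast
    ultimately show ?thesis by (simp only:)
  qed
  have harmonic_sum: "((\<lambda>(p, i, k). (if p = 0 \<and> k = 0 then \<gamma> i else 0) *
      mode t h (p, i, k)) has_sum L (pt t h)) UNIV"
    (is "(?G has_sum _) _") if t: "0 < t" "t \<le> r" for t h
  proof -
    define z where "z = pt t h"
    have nz: "norm z < \<rho>" using point[OF t] by (auto simp: z_def)
    define emb where "emb = (\<lambda>i::nat. (0::nat, i, 0::nat))"
    have "summable (\<lambda>i. norm (\<gamma> i * z ^ i))"
      by (rule powser_norm_summable[OF _ nz]) (rule L_sums)
    then have "((\<lambda>i. \<gamma> i * z ^ i) has_sum L z) UNIV"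
      by (rule norm_summable_imp_has_sum) (rule L_sums[OF nz])
    moreover have "?G \<circ> emb = (\<lambda>i. \<gamma> i * z ^ i)"
    proof
      fix i
      have "of_real (t powr deg (0, i, 0)) * cis (h * of_int (freq (0, i, 0))) = z ^ i"
        using term_eq[OF t(1), where p = 0 and k = 0 and i = i and h = h] t unfolding z_def by simp
      then show "(?G \<circ> emb) i = \<gamma> i * z ^ i" by (simp add: emb_def)
    qed
    ultimately have "(?G has_sum L z) (range emb)" by (subst has_sum_reindex) (simp_all only:, simp add: emb_def inj_on_def)
    then show ?thesis
      unfolding z_def by (rule has_sum_cong_neutral[THEN iffD1, rotated 3]) (auto simp: emb_def)
  qed
  have norm_sq: "w ^ p * cnj (w ^ p) = of_real (((norm w)^2) ^ p)" for w :: complex and p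
    by (simp add: power_mult_distrib[symmetric] complex_norm_square[symmetric] flip: of_real_power)
  have sum1: "((\<lambda>q. T q h * t powr deg q) has_sum v (pt t h)) UNIV"
    if t: "0 < t" "t \<le> r" for t h
  proof -
    define z where "z = pt t h"
    define x where "x = t powr \<tau> * (norm (g z))^2"
    have x: "0 \<le> x" "x \<le> 1 / 2" using x_le[OF t, of h] by (auto simp: x_def z_def)
    have nz: "norm z < \<rho>" "norm z = t" using point[OF t] by (auto simp: z_def)
    have "(\<lambda>p. - 2 * (- ((- x) ^ p) / real p)) sums (- 2 * ln (1 + x))"
      using x by (intro sums_mult Ln_series_real) auto
    then have "(\<lambda>p. complex_of_real (- 2 * (- ((- x) ^ p) / real p))) sums of_real (- 2 * ln (1 + x))"
      by (rule sums_of_real)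
    also have "(\<lambda>p. complex_of_real (- 2 * (- ((- x) ^ p) / real p)))
      = (\<lambda>p. of_real (2 * (- 1) ^ p / real p * t powr (real p * \<tau>)) * (g z ^ p * cnj (g z ^ p)))"
    proof
      fix p
      have "x ^ p = t powr (real p * \<tau>) * ((norm (g z))^2) ^ p"
        using t by (simp add: x_def power_mult_distrib powr_power)
      then have "- 2 * (- ((- x) ^ p) / real p) = 2 * (- 1) ^ p / real p * t powr (real p * \<tau>) * ((norm (g z))^2) ^ p"
        by (simp add: power_minus[of x])
      then show "complex_of_real (- 2 * (- ((- x) ^ p) / real p))
          = of_real (2 * (- 1) ^ p / real p * t powr (real p * \<tau>)) * (g z ^ p * cnj (g z ^ p))"
        unfolding norm_sq by (simp only: of_real_mult)
    qed
    finally have "((\<lambda>(p, i, k). of_real (2 * (- 1) ^ p / real p) * (b p i * cnj (b p k)) *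
      mode t h (p, i, k))
      has_sum of_real (- 2 * ln (1 + x))) UNIV"
      unfolding z_def
      by (intro pair_sum[where P = "\<lambda>p z. g z ^ p", OF t] bb b_sums order.trans[OF two(1)]) auto
    from has_sum_add[OF harmonic_sum[OF t, of h] this]
    have "((\<lambda>q. c q * mode t h q)
        has_sum (L z + of_real (- 2 * ln (1 + x)))) UNIV"
      by (simp add: c_def case_prod_unfold distrib_right z_def)
    from has_sum_Re[OF this]
    have "((\<lambda>q. Re (c q * mode t h q))
        has_sum Re (L z + of_real (- 2 * ln (1 + x)))) UNIV" .
    moreover have "Re (w * (of_real s * w')) = Re (w * w') * s" for w w' :: complex and s
      by (simp add: algebra_simps)
    moreover have "Re (L z + of_real (- 2 * ln (1 + x))) = v z" by (simp add: v_def x_def nz)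
    ultimately show ?thesis unfolding z_def T_def by (simp only:)
  qed
  have sum2: "((\<lambda>q. ((deg q)^2 - (of_int (freq q))^2) * T q h * t powr deg q)
        has_sum (- exp a * t powr \<tau> * exp (v (pt t h)))) UNIV"
    if t: "0 < t" "t \<le> r" for t h
  proof -
    define z where "z = pt t h"
    define x where "x = t powr \<tau> * (norm (g z))^2"
    have x: "0 \<le> x" "x \<le> 1 / 2" using x_le[OF t, of h] by (auto simp: x_def z_def)
    have nz: "norm z < \<rho>" "norm z = t" using point[OF t] by (auto simp: z_def)
    define N where "N = - 8 * t powr \<tau> * (norm (f z))^2"
    define P where "P p = of_nat p * g z ^ (p - 1) * f z" for p
    have "(\<lambda>n. N * (of_nat (Suc n) * (- x) ^ n)) sums (N * (1 / (1 - - x)^2))"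
      using x by (intro sums_mult geometric_deriv_sums) simp
    then have "(\<lambda>n. complex_of_real (N * (of_nat (Suc n) * (- x) ^ n))) sums of_real (N * (1 / (1 - - x)^2))"
      by (rule sums_of_real)
    also have "(\<lambda>n. complex_of_real (N * (of_nat (Suc n) * (- x) ^ n)))
       = (\<lambda>n. of_real (8 * (- 1) ^ Suc n / real (Suc n) * t powr (real (Suc n) * \<tau>)) * (P (Suc n) * cnj (P (Suc n))))"
    proof
      fix n
      have "x ^ n = t powr (real n * \<tau>) * ((norm (g z))^2) ^ n"
        using t by (simp add: x_def power_mult_distrib powr_power)
      moreover have "t powr (real (Suc n) * \<tau>) = t powr \<tau> * t powr (real n * \<tau>)"
        unfolding powr_add[symmetric] by (simp add: algebra_simps)
      ultimately have "N * (of_nat (Suc n) * (- x) ^ n)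
         = 8 * (- 1) ^ Suc n / real (Suc n) * t powr (real (Suc n) * \<tau>)
            * ((real (Suc n))^2 * ((norm (g z))^2) ^ n * (norm (f z))^2)"
        by (simp add: N_def power_minus[of x] power2_eq_square del: of_nat_Suc)
      moreover have "P (Suc n) * cnj (P (Suc n)) = of_real ((real (Suc n))^2 * ((norm (g z))^2) ^ n * (norm (f z))^2)"
      proof -
        have "P (Suc n) * cnj (P (Suc n)) = of_nat (Suc n) ^ 2 * (g z ^ n * cnj (g z ^ n)) * (f z * cnj (f z))"
          by (simp add: P_def power2_eq_square mult_ac del: of_nat_Suc)
        also have "f z * cnj (f z) = of_real ((norm (f z))^2)" by (rule complex_norm_square[symmetric])
        finally show ?thesis unfolding norm_sq by (simp del: of_nat_Suc)
      qed
      ultimately show "complex_of_real (N * (of_nat (Suc n) * (- x) ^ n))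
         = of_real (8 * (- 1) ^ Suc n / real (Suc n) * t powr (real (Suc n) * \<tau>)) * (P (Suc n) * cnj (P (Suc n)))"
        by (simp only: of_real_mult)
    qed
    \<comment> \<open>The series can be started at p = 0 because division by 0 makes that term
      0.\<close>
    finally have "(\<lambda>p. of_real (8 * (- 1) ^ p / real p * t powr (real p * \<tau>)) * (P p * cnj (P p)))
        sums of_real (N * (1 / (1 - - x)^2))"
      by (subst (asm) sums_Suc_iff) simp
    then have "((\<lambda>(p, i, k). of_real (8 * (- 1) ^ p / real p) * (d p i * cnj (d p k)) *
      mode t h (p, i, k))
      has_sum of_real (N * (1 / (1 - - x)^2))) UNIV"
      unfolding P_def z_def
      by (intro pair_sum[where P = "\<lambda>p z. of_nat p * g z ^ (p - 1) * f z", OF t] db d_sums two(2))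
    moreover have "(\<lambda>(p, i, k). of_real (8 * (- 1) ^ p / real p) * (d p i * cnj (d p k)) *
        mode t h (p, i, k))
      = (\<lambda>q. of_real ((deg q)^2 - (of_int (freq q))^2) * c q *
        mode t h q)"
      unfolding fun_eq_iff split_paired_All prod.case s_eq by blast
    ultimately have "((\<lambda>q. of_real ((deg q)^2 - (of_int (freq q))^2) * c q *
        mode t h q) has_sum of_real (N * (1 / (1 - - x)^2))) UNIV"
      by (simp only:)
    from has_sum_Re[OF this]
    have "((\<lambda>q. Re (of_real ((deg q)^2 - (of_int (freq q))^2) * c q *
        mode t h q)) has_sum Re (of_real (N * (1 / (1 - - x)^2)))) UNIV" .
    moreover have "Re (of_real s' * w * (of_real s * w')) = s' * Re (w * w') * s" for w w' :: complex and s s'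
      by (simp add: algebra_simps)
    moreover have "Re (of_real (N * (1 / (1 - - x)^2))) = - exp a * t powr \<tau> * exp (v z)"
      unfolding exp_v nz(2) x_def[symmetric] Re_complex_of_real N_def norm_f by simp
    ultimately show ?thesis unfolding z_def T_def by (simp only:)
  qed
  show ?thesis
  proof (rule that[of r K])
    show "0 < r" "r \<le> 1" by fact+
    show "liouville_solution r u" using r \<sigma> by (intro liouville_solution_u g0) auto
    fix q :: "nat \<times> nat \<times> nat"
    obtain p i k where q: "q = (p, i, k)" by (cases q)
    show "norm (c q) * r powr deg q \<le> K * geom q"
      unfolding q by (rule general[OF cb K(2) r(1) order.refl])
    show "\<bar>(deg q)^2 - (of_int (freq q))^2\<bar> * norm (c q) * r powr deg q \<le> K * geom q"
      using general[OF sb[OF q] K(2) r(1) order.refl] unfolding q .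
  next
    fix z :: complex assume "z \<in> ball 0 r - {0}"
    then have "z \<noteq> 0" "g z \<noteq> 0" using g0[of z] r \<sigma> by auto
    then show "u z = (\<tau> - 2) * ln (norm z) + a + v z" by (rule u_eq)
  qed (rule sum1 sum2; assumption)+
qed

end

section \<open>The recursive sequence\<close>

lemma Ints_pos_nat:
  assumes "x \<in> \<int>" "0 < (x::real)"
  shows "x = real (nat \<lfloor>x\<rfloor>)" "1 \<le> nat \<lfloor>x\<rfloor>"
  using assms by (auto elim!: Ints_cases)

context liouville_data
begin

definition R where "R l h = (\<Sum>q\<in>{q. deg q = mu l}. T q h)"

definition Q where "Q l = {q. deg q = mu l \<and> fst q \<noteq> 0}"

lemma finite_expo_eq: "finite {q. deg q = s}"
  by (rule finite_subset[OF _ finite_expo_le[OF tau, of s]]) auto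

lemma finite_Q: "finite (Q l)"
  unfolding Q_def by (rule finite_subset[OF _ finite_expo_eq[of "mu l"]]) auto

lemma c_0: "c (0, i, k) = (if k = 0 then \<gamma> i else 0)"
  by (simp add: c_def)

lemma T_trig: "T q h = Re (c q) * cos (real_of_int (freq q) * h) + (- Im (c q)) * sin (real_of_int (freq q) * h)"
  by (simp add: T_def mult.commute)

lemma abs_T_le: "\<bar>T q h\<bar> \<le> norm (c q)"
  unfolding T_def using abs_Re_le_cmod[of "c q * cis (h * of_int (freq q))"] by (simp add: norm_mult)

text \<open>Among the triples with p = 0 only (0, n, 0) can have a nonzero coefficient. It
  reproduces \<open>X n\<close> and occurs exactly when the exponent is the integer n.\<close>

lemma R_split:
  assumes X: "\<And>i h. i \<ge> 1 \<Longrightarrow> X i h = Re (\<gamma> i * cis (real i * h))" and l: "l \<ge> 1"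
  shows "R l h = (if mu l \<in> \<int> then X (nat \<lfloor>mu l\<rfloor>) h else 0) + (\<Sum>q\<in>Q l. T q h)"
proof -
  define \<mu> where "\<mu> = mu l"
  have pos: "0 < \<mu>" unfolding \<mu>_def by (rule index_seq_pos[OF tau l])
  define Z where "Z = {q. deg q = \<mu> \<and> fst q = 0}"
  have finZ: "finite Z" unfolding Z_def by (rule finite_subset[OF _ finite_expo_eq[of \<mu>]]) auto
  have "{q. deg q = \<mu>} = Z \<union> Q l" by (auto simp: Z_def Q_def \<mu>_def)
  then have "R l h = (\<Sum>q\<in>Z. T q h) + (\<Sum>q\<in>Q l. T q h)"
    unfolding R_def \<mu>_def[symmetric] using finZ finite_Q
    by (simp add: sum.union_disjoint Z_def Q_def disjoint_iff)
  also have "(\<Sum>q\<in>Z. T q h) = (if \<mu> \<in> \<int> then X (nat \<lfloor>\<mu>\<rfloor>) h else 0)"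
  proof (cases "\<mu> \<in> \<int>")
    case True
    define n where "n = nat \<lfloor>\<mu>\<rfloor>"
    have n: "\<mu> = real n" "1 \<le> n" using Ints_pos_nat[OF True pos] by (auto simp: n_def)
    have "(\<Sum>q\<in>Z. T q h) = (\<Sum>q\<in>{(0, n, 0)}. T q h)"
    proof (rule sum.mono_neutral_right[OF finZ])
      show "{(0, n, 0)} \<subseteq> Z" by (simp add: Z_def expo_def n)
      show "\<forall>q\<in>Z - {(0, n, 0)}. T q h = 0"
      proof
        fix q assume q: "q \<in> Z - {(0, n, 0)}"
        then obtain i k where ik: "q = (0, i, k)" by (cases q) (auto simp: Z_def)
        have "real i + real k = real n" using q by (simp add: Z_def expo_def n ik)
        then have "k \<noteq> 0" using q by (auto simp: ik)
        then show "T q h = 0" by (simp add: ik T_def c_0)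
      qed
    qed
    also have "\<dots> = X n h" by (simp add: X[OF n(2)] T_def c_0 freq_def mult.commute)
    finally show ?thesis using True by (simp add: n_def)
  next
    case False
    have "\<mu> \<in> \<int>" if "q \<in> Z" for q
    proof -
      obtain i k where "\<mu> = real (i + k)" using \<open>q \<in> Z\<close> by (cases q) (auto simp: Z_def expo_def)
      then show ?thesis by simp
    qed
    then have "Z = {}" using False by blast
    then show ?thesis using False by simp
  qed
  finally show ?thesis by (simp add: \<mu>_def)
qed

text \<open>Removing one factor |z|^\<tau> from a triple in \<open>Q l\<close> leaves the constant
  term or a triple whose exponent is again some \<open>mu m\<close>. So \<open>Q l\<close> is empty
  outside the case \<open>mu l = \<tau>\<close> and the recursive case of
  \<open>P_seq\<close>.\<close>

lemma Q_cases:
  assumes q: "q \<in> Q l"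
  obtains "q = (1, 0, 0)" "mu l = \<tau>" | m where "m \<ge> 1" "mu l = \<tau> + mu m"
proof -
  obtain p i k where pik: "q = (Suc p, i, k)" using q by (cases q) (auto simp: Q_def gr0_conv_Suc)
  have e: "mu l = \<tau> + deg (p, i, k)"
    using q unfolding pik by (simp add: Q_def expo_def algebra_simps)
  show thesis
  proof (cases "(p, i, k) = (0, 0, 0)")
    case True
    then show thesis using that(1) e pik by (simp add: expo_def)
  next
    case False
    then have "deg (p, i, k) \<in> mu ` {1..}"
      unfolding index_seq_image[OF tau] by (rule expo_in_index_set[OF tau])
    then show thesis using that(2) e by auto
  qed
qed

lemma index_seq_Ints:
  assumes l: "l \<ge> 1" and "mu l \<noteq> \<tau>" "\<forall>m\<ge>1. mu l \<noteq> \<tau> + mu m"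
  shows "mu l \<in> \<int>"
proof -
  obtain p n where pn: "mu l = real p * \<tau> + real n"
    using index_seq_in[OF tau l] index_set_iff[OF tau] by blast
  have "p = 0"
  proof (rule ccontr)
    assume "p \<noteq> 0"
    then have "(p, n, 0) \<in> Q l" by (simp add: Q_def expo_def pn)
    then show False using assms(2,3) by (elim Q_cases) auto
  qed
  then show ?thesis by (simp add: pn)
qed

text \<open>The coefficient is -2 |g(0)|^2, where (\<tau>/2) g(0) = f(0) and |f(0)|^2 = e^a / 8.
  This is the constant a_0 / \<tau>^2 of the recursion.\<close>

lemma T_1_0_0: "T (1, 0, 0) h = - exp a / \<tau>^2"
proof -
  have "L 0 = 0" using L_sums[of 0] rho powser_sums_zero_iff[of \<gamma>] by (simp add: gamma_0)
  have "of_real (\<tau> / 2) * g 0 = f 0" using g_ode[of 0] rho by simp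
  then have "(norm (of_real (\<tau> / 2) * g 0))^2 = exp a / 8" by (simp only: norm_f \<open>L 0 = 0\<close>) simp
  then have "(\<tau> / 2)^2 * (norm (g 0))^2 = exp a / 8"
    unfolding norm_mult norm_of_real power_mult_distrib power2_abs .
  then have "(norm (g 0))^2 = exp a / (2 * \<tau>^2)" using tau by (simp add: field_simps power2_eq_square)
  moreover have "c (1, 0, 0) = of_real (- 2 * (norm (g 0))^2)"
    by (simp add: c_def b_def complex_norm_square[symmetric])
  ultimately show ?thesis by (simp add: T_def freq_def)
qed

text \<open>The remainder constant is uniform in the angle because \<open>abs_T_le\<close> bounds
  \<open>T\<close> by the modulus of its coefficient. The last clause compares the two triple series
  through \<open>expansion_coefficients\<close>, one angle at a time.\<close>

theorem R_remainder:
  obtains r where "0 < r" "r \<le> 1" "liouville_solution r u"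
    "\<And>z. z \<in> ball 0 r - {0} \<Longrightarrow> u z = (\<tau> - 2) * ln (norm z) + a + v z"
    "\<And>l. \<exists>M. \<forall>t h. 0 < t \<and> t \<le> r \<longrightarrow>
      \<bar>v (pt t h) - (\<Sum>j=1..l. R j h * t powr mu j)\<bar> \<le> M * t powr mu (Suc l)"
    "\<And>l m h. m \<ge> 1 \<Longrightarrow> mu l = \<tau> + mu m \<Longrightarrow>
      (\<Sum>q\<in>Q l. ((mu l)^2 - (of_int (freq q))^2) * T q h) = rec_rhs \<tau> a (\<lambda>k. R k h) l m"
proof -
  obtain r K where r: "0 < r" "r \<le> 1" "liouville_solution r u"
    and cb: "\<And>q. norm (c q) * r powr deg q \<le> K * geom q"
    and sb: "\<And>q. \<bar>(deg q)^2 - (of_int (freq q))^2\<bar> * norm (c q) * r powr deg q \<le> K * geom q"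
    and s1: "\<And>t h. 0 < t \<Longrightarrow> t \<le> r \<Longrightarrow>
      ((\<lambda>q. T q h * t powr deg q) has_sum v (pt t h)) UNIV"
    and s2: "\<And>t h. 0 < t \<Longrightarrow> t \<le> r \<Longrightarrow>
      ((\<lambda>q. ((deg q)^2 - (of_int (freq q))^2) * T q h * t powr deg q)
        has_sum (- exp a * t powr \<tau> * exp (v (pt t h)))) UNIV"
    and u: "\<And>z. z \<in> ball 0 r - {0} \<Longrightarrow> u z = (\<tau> - 2) * ln (norm z) + a + v z"
    by (rule expansion) (rule that)
  define S where "S q h = ((deg q)^2 - (of_int (freq q))^2) * T q h" for q h
  have T0: "T (0, 0, 0) h = 0" for h by (simp add: T_def c_0 gamma_0)
  have Tb: "\<bar>T q h\<bar> * r powr deg q \<le> K * geom q" for q h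
    by (rule order.trans[OF mult_right_mono[OF abs_T_le] cb]) simp
  have Sb: "\<bar>S q h\<bar> * r powr deg q \<le> K * geom q" for q h
    unfolding S_def abs_mult
    by (rule order.trans[OF mult_right_mono[OF mult_left_mono[OF abs_T_le]] sb]) simp_all
  define M where "M l = K * infsum geom UNIV * r powr - mu (Suc l)" for l
  have V: "\<bar>v (pt t h) - (\<Sum>j=1..l. R j h * t powr mu j)\<bar> \<le> M l * t powr mu (Suc l)"
    if "0 < t" "t \<le> r" for t h l
    unfolding R_def M_def
    by (rule triple_series_remainder[OF tau r(1) Tb T0 s1[OF that] that])
  have G: "\<bar>- exp a * t powr \<tau> * exp (v (pt t h))
      - (\<Sum>j=1..l. (\<Sum>q\<in>{q. deg q = mu j}. S q h) * t powr mu j)\<bar>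
        \<le> M l * t powr mu (Suc l)" if "0 < t" "t \<le> r" for t h l
    unfolding M_def
    by (rule triple_series_remainder[OF tau r(1) Sb _ s2[OF that, folded S_def] that]) (simp add: S_def T0)
  \<comment> \<open>Terms with p = 0 drop out: they are harmonic or have coefficient zero.\<close>
  have S_sum: "(\<Sum>q\<in>{q. deg q = mu l}. S q h)
      = (\<Sum>q\<in>Q l. ((mu l)^2 - (of_int (freq q))^2) * T q h)" for l h
  proof -
    have "(\<Sum>q\<in>{q. deg q = mu l}. S q h) = (\<Sum>q\<in>Q l. S q h)"
    proof (rule sum.mono_neutral_right[OF finite_expo_eq])
      show "Q l \<subseteq> {q. deg q = mu l}" by (auto simp: Q_def)
      show "\<forall>q\<in>{q. deg q = mu l} - Q l. S q h = 0"
      proof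
        fix q assume "q \<in> {q. deg q = mu l} - Q l"
        then obtain i k where "q = (0, i, k)" by (cases q) (auto simp: Q_def)
        then show "S q h = 0" by (cases "k = 0") (auto simp: S_def expo_def freq_def T_def c_0)
      qed
    qed
    also have "\<dots> = (\<Sum>q\<in>Q l. ((mu l)^2 - (of_int (freq q))^2) * T q h)"
      by (rule sum.cong) (auto simp: S_def Q_def)
    finally show ?thesis .
  qed
  show ?thesis
  proof (rule that[OF r u])
    show "\<exists>M. \<forall>t h. 0 < t \<and> t \<le> r \<longrightarrow>
      \<bar>v (pt t h) - (\<Sum>j=1..l. R j h * t powr mu j)\<bar> \<le> M * t powr mu (Suc l)" for l
      using V by blast
    fix l m h assume m: "m \<ge> (1::nat)" "mu l = \<tau> + mu m"
    have "(\<Sum>q\<in>{q. deg q = mu l}. S q h) = rec_rhs \<tau> a (\<lambda>k. R k h) l m"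
      by (rule expansion_coefficients[where V = "\<lambda>t. v (pt t h)"
            and G = "\<lambda>t. - exp a * t powr \<tau> * exp (v (pt t h))", OF tau r(1,2) _ _ _ m])
        (use V G in blast)+
    then show "(\<Sum>q\<in>Q l. ((mu l)^2 - (of_int (freq q))^2) * T q h) = rec_rhs \<tau> a (\<lambda>k. R k h) l m" unfolding S_sum .
  qed
qed

lemma R_equation:
  assumes "m \<ge> 1" "mu l = \<tau> + mu m"
  shows "(\<Sum>q\<in>Q l. ((mu l)^2 - (of_int (freq q))^2) * T q h) = rec_rhs \<tau> a (\<lambda>k. R k h) l m"
proof (rule R_remainder)
  fix r
  assume *: "\<And>l m h. m \<ge> 1 \<Longrightarrow> mu l = \<tau> + mu m \<Longrightarrow>
      (\<Sum>q\<in>Q l. ((mu l)^2 - (of_int (freq q))^2) * T q h) = rec_rhs \<tau> a (\<lambda>k. R k h) l m"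
  show ?thesis by (rule *[OF assms])
qed

text \<open>By induction the right-hand side in \<open>P_seq\<close> is \<open>rec_rhs\<close> of
  the earlier \<open>R k\<close>, hence the left side of \<open>R_equation\<close>, which is the
  circle operator applied to the part of \<open>R l\<close> over \<open>Q l\<close>. Uniqueness on
  the circle then evaluates the \<open>THE\<close> terms.\<close>

theorem P_seq_eq_R:
  assumes X: "\<And>i h. i \<ge> 1 \<Longrightarrow> X i h = Re (\<gamma> i * cis (real i * h))" and "l \<ge> 1"
  shows "P_seq \<tau> (\<lambda>j. - exp a / fact j) X l = R l"
  using assms(2)
proof (induction l rule: less_induct)
  case (less l)
  let ?a = "\<lambda>j. - exp a / fact j :: real"
  define \<mu> where "\<mu> = mu"
  have R: "R l h = (if \<mu> l \<in> \<int> then X (nat \<lfloor>\<mu> l\<rfloor>) h else 0) + (\<Sum>q\<in>Q l. T q h)" for h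
    unfolding \<mu>_def by (rule R_split[OF _ less.prems]) (rule X)
  have pos: "0 < \<mu> l" unfolding \<mu>_def by (rule index_seq_pos[OF tau less.prems])
  note P = P_seq.simps[of \<tau> ?a X l, folded \<mu>_def, unfolded Let_def]
  consider (1) "\<mu> l < \<tau>" | (2) "\<mu> l = \<tau>" | (3) "\<mu> l > \<tau>" "\<forall>m\<ge>1. \<mu> l \<noteq> \<tau> + \<mu> m"
    | (4) m where "\<mu> l > \<tau>" "m \<ge> 1" "\<mu> l = \<tau> + \<mu> m" by (metis linorder_cases)
  then show ?case
  proof cases
    case 1
    have mu: "\<mu> l = real l" using index_seq_less_tau[OF tau] 1 unfolding \<mu>_def by blast
    have "Q l = {}"
    proof -
      have "False" if "q \<in> Q l" for q
        using that
      proof (cases rule: Q_cases)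
        case (2 m)
        then show False using 1 index_seq_pos[OF tau, of m] by (simp add: \<mu>_def)
      qed (use 1 in \<open>simp add: \<mu>_def\<close>)
      then show ?thesis by blast
    qed
    then show ?thesis unfolding P fun_eq_iff using 1 R by (simp add: mu)
  next
    case 2
    have "Q l = {(1, 0, 0)}"
    proof (intro equalityI subsetI)
      fix q assume "q \<in> Q l"
      then show "q \<in> {(1, 0, 0)}"
      proof (cases rule: Q_cases)
        case (2 m)
        then show ?thesis using \<open>\<mu> l = \<tau>\<close> index_seq_pos[OF tau, of m] by (simp add: \<mu>_def)
      qed simp
    qed (use 2 in \<open>auto simp: Q_def expo_def \<mu>_def\<close>)
    then have "R l h = (if \<tau> \<in> \<int> then X (nat \<lfloor>\<tau>\<rfloor>) h else 0) - exp a / \<tau>^2" for h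
      using T_1_0_0[of h] by (simp add: R 2)
    then show ?thesis unfolding P fun_eq_iff using 2 by simp
  next
    case 3
    have "Q l = {}"
    proof -
      have "False" if "q \<in> Q l" for q
        using that by (cases rule: Q_cases) (use 3 in \<open>auto simp: \<mu>_def\<close>)
      then show ?thesis by blast
    qed
    moreover have "\<mu> l \<in> \<int>" using index_seq_Ints[OF less.prems] 3 by (auto simp: \<mu>_def)
    ultimately have "R l h = X (nat \<lfloor>\<mu> l\<rfloor>) h" for h by (simp add: R)
    then show ?thesis unfolding P fun_eq_iff using 3 by auto
  next
    case 4
    define Rp where "Rp h = (\<Sum>q\<in>Q l. T q h)" for h
    define F where "F h = (\<Sum>q\<in>Q l. ((\<mu> l)^2 - (of_int (freq q))^2) * T q h)" for h
    have Rp_eq: "Rp = (\<lambda>h. \<Sum>q\<in>Q l. Re (c q) * cos (real_of_int (freq q) * h)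
        + (- Im (c q)) * sin (real_of_int (freq q) * h))"
      unfolding Rp_def[abs_def] T_trig ..
    have sol: "circle_solution (\<mu> l) F Rp"
      unfolding Rp_eq by (rule circle_solution_trig_sum) (simp_all add: F_def T_trig)
    have the_m: "(THE m. m \<ge> 1 \<and> \<mu> l = \<tau> + \<mu> m) = m"
      using 4 index_seq_eq_iff[OF tau] by (intro the_equality) (auto simp: \<mu>_def)
    have F_eq: "(\<lambda>h. \<Sum>j=1..m. ?a j *
        (\<Sum>ks\<in>{ks. length ks = j \<and> set ks \<subseteq> {1..<l} \<and> sum_list (map \<mu> ks) = \<mu> m}.
           prod_list (map (\<lambda>k. P_seq \<tau> ?a X k h) ks))) = F" (is "?S = F")
    proof
      fix h
      have IH: "map (\<lambda>k. P_seq \<tau> ?a X k h) ks = map (\<lambda>k. R k h) ks" if "set ks \<subseteq> {1..<l}" for ks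
        using that less.IH by (intro map_cong) auto
      have "F h = rec_rhs \<tau> a (\<lambda>k. R k h) l m"
        unfolding F_def \<mu>_def by (rule R_equation[OF 4(2,3)[unfolded \<mu>_def]])
      also have "\<dots> = ?S h"
        unfolding rec_rhs_def \<mu>_def[symmetric]
        by (intro sum.cong arg_cong2[where f = "(*)"] refl arg_cong[where f = prod_list] IH[symmetric]) auto
      finally show "?S h = F h" by simp
    qed
    have not: "\<not> \<mu> l < \<tau>" "\<mu> l \<noteq> \<tau>" "\<not> (\<forall>m\<ge>1. \<mu> l \<noteq> \<tau> + \<mu> m)" using 4 by auto
    show ?thesis
    proof (cases "\<mu> l \<in> \<int>")
      case False
      have "(THE Q. circle_solution (\<mu> l) F Q) = Rp"
        by (rule the_equality[of "circle_solution (\<mu> l) F", OF sol])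
          (rule circle_solution_unique_nonint[OF _ sol False])
      moreover have "R l = Rp" using False by (auto simp: R Rp_def)
      ultimately show ?thesis
        unfolding P if_not_P[OF not(1)] if_not_P[OF not(2)] if_not_P[OF not(3)] the_m F_eq
        using False by simp
    next
      case True
      define i where "i = nat \<lfloor>\<mu> l\<rfloor>"
      have i: "\<mu> l = real i" "1 \<le> i" using Ints_pos_nat[OF True pos] by (auto simp: i_def)
      have orth: "circle_orthogonal Rp (spherical_harmonics i)"
        unfolding Rp_eq
      proof (rule circle_orthogonal_trig_sum[OF finite_Q])
        fix q assume q: "q \<in> Q l"
        obtain p j k where pjk: "q = (p, j, k)" by (cases q)
        have "0 < real p * \<tau>" using q tau by (simp add: Q_def pjk)
        moreover have "real p * \<tau> + real j + real k = real i"
          using q i unfolding \<mu>_def by (simp add: Q_def pjk expo_def)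
        ultimately have "real (j + k) < real i" by simp
        then show "\<bar>freq q\<bar> \<noteq> int i" by (simp add: freq_def pjk)
      qed
      have "(THE Q. circle_solution (real i) F Q \<and> circle_orthogonal Q (spherical_harmonics i)) = Rp"
        using sol orth circle_solution_unique_int[OF _ _ i(2)] unfolding i(1) by (intro the_equality) blast+
      moreover have "R l = (\<lambda>h. X i h + Rp h)" using True by (auto simp: R Rp_def i_def)
      ultimately show ?thesis
        unfolding P if_not_P[OF not(1)] if_not_P[OF not(2)] if_not_P[OF not(3)] the_m F_eq i_def[symmetric]
        using True i(1) by simp
    qed
  qed
qed

end

theorem theorem1p1:
  fixes \<nu>\<^sub>0 a :: real
    and H :: "complex \<Rightarrow> real" and U :: "complex set"
    and X :: "nat \<Rightarrow> real \<Rightarrow> real"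
  defines "\<mu> \<equiv> index_seq (\<nu>\<^sub>0 + 2)"
    and "P \<equiv> P_seq (\<nu>\<^sub>0 + 2) (\<lambda>j. - exp a / fact j) X"
  defines "singular_solution \<equiv> (\<lambda>r u. liouville_solution r u \<and>
             leading_asymptotics \<nu>\<^sub>0 a r u \<and> full_asymptotics \<nu>\<^sub>0 a \<mu> P r u)"
  assumes "\<nu>\<^sub>0 > -2"
    and "open U" and "0 \<in> U" and "harmonic_on H U" and "H 0 = 0"
    and "\<forall>i\<ge>1. X i \<in> spherical_harmonics i"
    and "\<forall>\<^sub>F x in nhds 0. (\<lambda>i. norm x ^ Suc i * X (Suc i) (Arg x)) sums H x"
  shows "(\<exists>r>0. \<exists>u. singular_solution r u) \<and>
         (\<forall>r\<^sub>1>0. \<forall>r\<^sub>2>0. \<forall>u\<^sub>1 u\<^sub>2. singular_solution r\<^sub>1 u\<^sub>1 \<longrightarrow> singular_solution r\<^sub>2 u\<^sub>2 \<longrightarrow>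
            (\<forall>x\<in>ball 0 (min r\<^sub>1 r\<^sub>2) - {0}. u\<^sub>1 x = u\<^sub>2 x))"
proof (intro conjI allI impI ballI)
  fix r1 r2 :: real and u1 u2 :: "complex \<Rightarrow> real" and x :: complex
  assume "singular_solution r1 u1" "singular_solution r2 u2" "x \<in> ball 0 (min r1 r2) - {0}"
  then show "u1 x = u2 x"
    using singular_solution_unique[OF \<open>\<nu>\<^sub>0 > -2\<close>] unfolding singular_solution_def \<mu>_def by blast
next
  obtain \<gamma> C \<rho> where \<gamma>: "\<gamma> 0 = 0" "\<And>i h. i \<ge> 1 \<Longrightarrow> X i h = Re (\<gamma> i * cis (real i * h))"
    "\<rho> > 0" "\<And>i. norm (\<gamma> i) * \<rho> ^ i \<le> C"
    using spherical_harmonics_coefficients[OF assms(9,10)] by metis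
  define \<tau> where "\<tau> = \<nu>\<^sub>0 + 2"
  interpret liouville_data \<tau> a \<rho> C \<gamma>
    using \<gamma> \<open>\<nu>\<^sub>0 > -2\<close> by unfold_locales (auto simp: \<tau>_def)
  obtain r where r: "0 < r" "r \<le> 1" "liouville_solution r u"
    and u: "\<And>z. z \<in> ball 0 r - {0} \<Longrightarrow> u z = (\<tau> - 2) * ln (norm z) + a + v z"
    and M: "\<And>l. \<exists>M. \<forall>t h. 0 < t \<and> t \<le> r \<longrightarrow>
      \<bar>v (pt t h) - (\<Sum>j=1..l. R j h * t powr index_seq \<tau> j)\<bar> \<le> M * t powr index_seq \<tau> (Suc l)"
    by (rule R_remainder) (rule that)
  \<comment> \<open>Stated for every l, because l = 0, with its empty sum, yields the leading
    asymptotics with exponent \<open>\<mu> 1\<close>.\<close>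
  have bound: "\<exists>C>0. \<forall>x\<in>ball 0 r - {0}. \<bar>u x - \<nu>\<^sub>0 * ln (norm x) - a - (\<Sum>j=1..l. P j (Arg x) * norm x powr \<mu> j)\<bar>
      \<le> C * norm x powr \<mu> (Suc l)" for l
  proof -
    obtain M where M: "\<And>t h. 0 < t \<Longrightarrow> t \<le> r \<Longrightarrow>
      \<bar>v (pt t h) - (\<Sum>j=1..l. R j h * t powr index_seq \<tau> j)\<bar> \<le> M * t powr index_seq \<tau> (Suc l)"
      using M[of l] by blast
    have "\<bar>u x - \<nu>\<^sub>0 * ln (norm x) - a - (\<Sum>j=1..l. P j (Arg x) * norm x powr \<mu> j)\<bar>
      \<le> (\<bar>M\<bar> + 1) * norm x powr \<mu> (Suc l)" if x: "x \<in> ball 0 r - {0}" for x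
    proof -
      have "of_real (norm x) * cis (Arg x) = x" using rcis_cmod_Arg[of x] by (simp add: rcis_def)
      moreover have "u x - \<nu>\<^sub>0 * ln (norm x) - a = v x" using u[OF x] by (simp add: \<tau>_def)
      moreover have "(\<Sum>j=1..l. P j (Arg x) * norm x powr \<mu> j) = (\<Sum>j=1..l. R j (Arg x) * norm x powr index_seq \<tau> j)"
        using P_seq_eq_R[OF \<gamma>(2)] by (intro sum.cong) (auto simp: P_def \<mu>_def \<tau>_def)
      ultimately have "\<bar>u x - \<nu>\<^sub>0 * ln (norm x) - a - (\<Sum>j=1..l. P j (Arg x) * norm x powr \<mu> j)\<bar>
          \<le> M * norm x powr \<mu> (Suc l)"
        using M[of "norm x" "Arg x"] x by (simp add: \<mu>_def \<tau>_def del: index_seq.simps)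
      also have "\<dots> \<le> (\<bar>M\<bar> + 1) * norm x powr \<mu> (Suc l)" by (intro mult_right_mono) auto
      finally show ?thesis .
    qed
    then show ?thesis by (intro exI[of _ "\<bar>M\<bar> + 1"]) auto
  qed
  have "full_asymptotics \<nu>\<^sub>0 a \<mu> P r u" unfolding full_asymptotics_def using bound by blast
  moreover have "leading_asymptotics \<nu>\<^sub>0 a r u"
  proof -
    have "0 < \<mu> (Suc 0)" using index_seq_pos[OF tau, of "Suc 0"] by (simp add: \<mu>_def \<tau>_def del: index_seq.simps)
    then show ?thesis unfolding leading_asymptotics_def using bound[of 0] by auto
  qed
  ultimately show "\<exists>r>0. \<exists>u. singular_solution r u" using r unfolding singular_solution_def by blast
qed

end
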